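(* Let $C_1>1$ be a (sufficiently large) constant, $\alpha>1$, $\beta>\alpha/2+1$, and let $\gamma$ be such that $$0<\gamma\ \begin{cases}<\alpha-1,&\text{if }\alpha\le3,\\ \le2,&\text{if }\alpha>3.\end{cases}$$ Let $\mathcal{F}=\mathcal{F}(C_1,\alpha,\beta,\gamma)$ be the class of distributions of $(Y,X)$ defined in the context, and let $(Y_i,X_i)$, $i\ge1$, be i.i.d. copies of $(Y,X)$. Then: (1) There exists a constant $M>0$ such that $$\liminf_{n\to\infty}\inf_{\bar b}\sup_{F\in\mathcal{F}}\mathbb{P}_F\left[\sup_{u\in\mathcal{U}}\int_0^1\{\bar b(t,u)-b(t,u)\}^2dt>Mn^{-(2\beta-1)/(\alpha+2\beta)}\right]>0,$$ where $\inf_{\bar b}$ is taken over all estimators of the slope function $(t,u)\mapsto b(t,u)$ based on $(Y_1,X_1),\dots,(Y_n,X_n)$. (2) There exists a constant $M>0$ such that $$\liminf_{n\to\infty}\inf_{\bar Q_{Y|X}}\sup_{F\in\mathcal{F}}\mathbb{P}_F\left[\sup_{u\in\mathcal{U}}\mathcal{E}(\bar Q_{Y|X},u)>Mn^{-(\alpha+2\beta-1)/(\alpha+2\beta)}\right]>0,$$ where $\inf_{\bar Q_{Y|X}}$ is taken over all estimators of the conditional quantile function $(u,x)\mapsto Q_{Y|X}(u\mid x)$ based on $(Y_1,X_1),\dots,(Y_n,X_n)$. (3) When $\mathcal{U}$ is a bounded closed interval in $(0,1)$ (i.e. $\mathcal{U}=[u_L,u_U]$ with $0<u_L<u_U<1$),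 there exists a constant $M>0$ such that $$\liminf_{n\to\infty}\inf_{\bar Q_{Y|X}}\sup_{F\in\mathcal{F}}\mathbb{P}_F\left[\int_{\mathcal{U}}\mathcal{E}(\bar Q_{Y|X},u)\,du>Mn^{-(\alpha+2\beta-1)/(\alpha+2\beta)}\right]>0,$$ with the infimum as in (2).
   Context: Model. $Y$ is a real random variable and $X=(X(t))_{t\in[0,1]}$ is a random function whose paths are almost surely càdlàg, viewed as a $D[0,1]$-valued random variable ($D[0,1]$ with the Skorohod metric and its Borel $\sigma$-field), so that the regular conditional distribution of $Y$ given $X$ exists. $\mathcal{U}\subset[\epsilon,1-\epsilon]$ is a fixed nonempty set, for some $\epsilon\in(0,1/2)$. $Q_{Y|X}(u\mid X)$ denotes the conditional $u$-quantile of $Y$ given $X$. It is assumed that for each $u\in\mathcal{U}$ there are $a(u)\in\mathbb{R}$ and $b(\cdot,u)\in L_2[0,1]$ with $$Q_{Y|X}(u\mid X)=a(u)+\int_0^1 b(t,u)X^c(t)\,dt,\qquad X^c(t)=X(t)-\mathbb{E}[X(t)].$$ Assume $\int_0^1\mathbb{E}[X^2(t)]dt<\infty$. Let $K(s,t)=\mathrm{Cov}(X(s),X(t))=\sum_{j\ge1}\kappa_j\phi_j(s)\phi_j(t)$ be the spectral expansion, with $\kappa_1\ge\kappa_2\ge\cdots\ge0$ and $\{\phi_j\}$ an orthonormal basis of $L_2[0,1]$ of eigenfunctions of the integral operator with kernel $K$. Put $\xi_j=\int_0^1X^c(t)\phi_j(t)dt$ and $b_j(u)=\int_0^1b(t,u)\phi_j(t)dt$.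 Class $\mathcal{F}(C_1,\alpha,\beta,\gamma)$: all distributions $F$ of $(Y,X)$ such that $X$ has almost surely càdlàg paths, $\int_0^1\mathbb{E}[X^2(t)]dt<\infty$, for each $u\in\mathcal{U}$ there are $a(u)\in\mathbb{R}$ and $b(\cdot,u)\in L_2[0,1]$ with $Q_{Y|X}(u\mid X)=a(u)+\int_0^1 b(t,u)X^c(t)\,dt$, and the following conditions hold. (A2) $\int_0^1\mathbb{E}[X^4(t)]dt\le C_1$ and $\mathbb{E}[\xi_j^4]\le C_1\kappa_j^2$ for all $j\ge1$. (A3) $C_1^{-1}j^{-\alpha}\le\kappa_j\le C_1j^{-\alpha}$ and $\kappa_j-\kappa_{j+1}\ge C_1^{-1}j^{-\alpha-1}$ for all $j\ge1$. (A4) $\sup_{u\in\mathcal{U}}|b_j(u)|\le C_1j^{-\beta}$ for all $j\ge1$. (A5) For every realization of $X$, the conditional distribution function $y\mapsto F_{Y|X}(y|X)$ of $Y$ given $X$ is twice continuously differentiable, with $f_{Y|X}(y|X)=\partial F_{Y|X}(y|X)/\partial y$ and $f'_{Y|X}(y|X)=\partial f_{Y|X}(y|X)/\partial y$; and $\max\{f_{Y|X}(y|X),|f'_{Y|X}(y|X)|\}\le C_1$. (A6) $\inf_{u\in\mathcal{U}}f_{Y|X}(Q_{Y|X}(u\mid X)|X)\ge C_1^{-1}$. (A8) $\mathbb{E}[(X(t)-X(s))^2]\le C_1|t-s|^{\gamma}$ for all $s,t\in[0,1]$. As a standing convention, $C_1>1$ is some sufficiently large constant. $\mathbb{P}_F$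 denotes probability when the i.i.d. pairs $(Y_i,X_i)$ have distribution $F$; $b$ and $Q_{Y|X}$ inside $\mathbb{P}_F$ are those determined by $F$. For an estimator $\bar Q_{Y|X}$, $\mathcal{E}(\bar Q_{Y|X},u)=\int\{\bar Q_{Y|X}(u\mid x)-Q_{Y|X}(u\mid x)\}^2\,dP_X(x)$, where $P_X$ is the distribution of $X$ on $D[0,1]$. *)

theory Defs
  imports "HOL-Probability.Probability"
begin

section \<open>The Skorohod space on the unit interval\<close>

definition cadlag_unit :: "(real \<Rightarrow> real) \<Rightarrow> bool" where
  "cadlag_unit x \<longleftrightarrow>
     (\<forall>t\<in>{0..<1}. (x \<longlongrightarrow> x t) (at_right t)) \<and>
     (\<forall>t\<in>{0<..1}. \<exists>l. (x \<longlongrightarrow> l) (at_left t))"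

text \<open>
  Paths live on \<open>[0,1]\<close> only; \<open>extensional\<close> fixes the meaningless values outside, so that equal
  elements of the type are exactly equal functions on \<open>[0,1]\<close>.
\<close>
typedef D01 = "{x :: real \<Rightarrow> real. x \<in> extensional {0..1} \<and> cadlag_unit x}"
  morphisms path Abs_D01
proof -
  have "cadlag_unit (restrict (\<lambda>t. 0) {0..1})"
  proof -
    have "((restrict (\<lambda>t. 0::real) {0..1::real}) \<longlongrightarrow> 0) (at_right t)" if "t \<in> {0..<1}" for t
    proof (rule tendsto_eventually)
      have "eventually (\<lambda>s. s \<in> {t<..<1}) (at_right t)"
        using that by (intro eventually_at_right_real) auto
      then show "eventually (\<lambda>s. restrict (\<lambda>t. 0::real) {0..1::real} s = 0) (at_right t)"
        by eventually_elim (use that in auto)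
    qed
    moreover have "((restrict (\<lambda>t. 0::real) {0..1::real}) \<longlongrightarrow> 0) (at_left t)" if "t \<in> {0<..1}" for t
    proof (rule tendsto_eventually)
      have "eventually (\<lambda>s. s \<in> {0<..<t}) (at_left t)"
        using that by (intro eventually_at_left_real) auto
      then show "eventually (\<lambda>s. restrict (\<lambda>t. 0::real) {0..1::real} s = 0) (at_left t)"
        by eventually_elim (use that in auto)
    qed
    ultimately show ?thesis
      unfolding cadlag_unit_def by (intro conjI ballI exI[of _ "0::real"]) simp_all
  qed
  then show ?thesis
    by (intro exI[of _ "restrict (\<lambda>t. 0) {0..1}"]) auto
qed

lemma cadlag_path: "cadlag_unit (path x)"
  using path[of x] by simp

lemma path_ext: "path x \<in> extensional {0..1}"
  using path[of x] by simp

definition time_change :: "(real \<Rightarrow> real) \<Rightarrow> bool" where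
  "time_change l \<longleftrightarrow>
     strict_mono_on {0..1} l \<and> continuous_on {0..1} l \<and> l ` {0..1} = {0..1}"

definition skorohod_close :: "real \<Rightarrow> D01 \<Rightarrow> D01 \<Rightarrow> bool" where
  "skorohod_close r x y \<longleftrightarrow>
     (\<exists>l. time_change l \<and>
          (\<forall>t\<in>{0..1}. \<bar>l t - t\<bar> \<le> r) \<and> (\<forall>t\<in>{0..1}. \<bar>path x t - path y (l t)\<bar> \<le> r))"

lemma time_change_id: "time_change (\<lambda>t. t)"
  by (auto simp: time_change_def strict_mono_on_def)

lemma time_change_in: "time_change l \<Longrightarrow> t \<in> {0..1} \<Longrightarrow> l t \<in> {0..1}"
  by (auto simp: time_change_def)

lemma time_change_comp:
  assumes "time_change l" "time_change m"
  shows "time_change (\<lambda>t. m (l t))"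
proof -
  have "(\<lambda>t. m (l t)) ` {0..1} = m ` (l ` {0..1})" by (simp add: image_image)
  then have 1: "(\<lambda>t. m (l t)) ` {0..1} = {0..1}"
    using assms by (simp add: time_change_def)
  have 2: "strict_mono_on {0..1} (\<lambda>t. m (l t))"
  proof (rule strict_mono_onI)
    fix r t :: real assume rt: "r \<in> {0..1}" "t \<in> {0..1}" "r < t"
    then have "l r < l t" using assms(1) by (auto simp: time_change_def strict_mono_on_def)
    then show "m (l r) < m (l t)"
      using assms(2) time_change_in[OF assms(1) rt(1)] time_change_in[OF assms(1) rt(2)]
      by (auto simp: time_change_def strict_mono_on_def)
  qed
  have 3: "continuous_on {0..1} (\<lambda>t. m (l t))"
    by (rule continuous_on_compose2[of "{0..1}" m "{0..1}" l])
      (use assms in \<open>auto simp: time_change_def\<close>)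
  show ?thesis using 1 2 3 by (simp add: time_change_def)
qed

lemma time_change_inverse:
  assumes "time_change l"
  obtains m where "time_change m"
    and "\<And>t. t \<in> {0..1} \<Longrightarrow> l (m t) = t" and "\<And>t. t \<in> {0..1} \<Longrightarrow> m (l t) = t"
proof -
  let ?I = "{0..1::real}"
  let ?m = "inv_into ?I l"
  have mono: "strict_mono_on ?I l" and cont: "continuous_on ?I l" and im: "l ` ?I = ?I"
    using assms by (auto simp: time_change_def)
  have inj: "inj_on l ?I" using mono by (rule strict_mono_on_imp_inj_on)
  have lm: "l (?m t) = t" if "t \<in> ?I" for t using that im by (simp add: f_inv_into_f)
  have ml: "?m (l t) = t" if "t \<in> ?I" for t using that inj by simp
  have min: "?m t \<in> ?I" if "t \<in> ?I" for t using that im by (metis inv_into_into)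
  have "continuous_on (l ` ?I) ?m"
    using cont by (intro continuous_on_inv) (auto simp: ml)
  then have c: "continuous_on ?I ?m" by (simp add: im)
  have i: "?m ` ?I = ?I"
  proof
    show "?m ` ?I \<subseteq> ?I" using min by blast
    show "?I \<subseteq> ?m ` ?I" using ml im by (metis image_eqI subsetI)
  qed
  have s: "strict_mono_on ?I ?m"
  proof (rule strict_mono_onI)
    fix r t assume rt: "r \<in> ?I" "t \<in> ?I" "r < t"
    show "?m r < ?m t"
    proof (rule ccontr)
      assume "\<not> ?m r < ?m t"
      then have "l (?m t) \<le> l (?m r)"
        using strict_mono_onD[OF mono min[OF rt(2)] min[OF rt(1)]]
        by (cases "?m t < ?m r") (auto simp: not_less)
      then show False using lm rt by simp
    qed
  qed
  show ?thesis
    by (rule that[of ?m]) (simp_all only: time_change_def c s i lm ml simp_thms)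
qed

lemma skorohod_close_sym: "skorohod_close r x y \<Longrightarrow> skorohod_close r y x"
proof -
  assume "skorohod_close r x y"
  then obtain l where l: "time_change l" "\<And>t. t \<in> {0..1} \<Longrightarrow> \<bar>l t - t\<bar> \<le> r"
    "\<And>t. t \<in> {0..1} \<Longrightarrow> \<bar>path x t - path y (l t)\<bar> \<le> r"
    unfolding skorohod_close_def by auto
  obtain m where m: "time_change m" "\<And>t. t \<in> {0..1} \<Longrightarrow> l (m t) = t"
    by (rule time_change_inverse[OF l(1)]) blast
  have "\<bar>m t - t\<bar> \<le> r \<and> \<bar>path y t - path x (m t)\<bar> \<le> r" if "t \<in> {0..1}" for t
    using l(2,3)[OF time_change_in[OF m(1) that]] m(2)[OF that] by (simp add: abs_minus_commute)
  then show ?thesis unfolding skorohod_close_def using m(1) by blast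
qed

lemma skorohod_close_trans:
  assumes "skorohod_close r x y" "skorohod_close s y z"
  shows "skorohod_close (r + s) x z"
proof -
  obtain l where l: "time_change l" "\<And>t. t \<in> {0..1} \<Longrightarrow> \<bar>l t - t\<bar> \<le> r"
    "\<And>t. t \<in> {0..1} \<Longrightarrow> \<bar>path x t - path y (l t)\<bar> \<le> r"
    using assms(1) unfolding skorohod_close_def by auto
  obtain m where m: "time_change m" "\<And>t. t \<in> {0..1} \<Longrightarrow> \<bar>m t - t\<bar> \<le> s"
    "\<And>t. t \<in> {0..1} \<Longrightarrow> \<bar>path y t - path z (m t)\<bar> \<le> s"
    using assms(2) unfolding skorohod_close_def by auto
  have "\<bar>m (l t) - t\<bar> \<le> r + s \<and> \<bar>path x t - path z (m (l t))\<bar> \<le> r + s" if "t \<in> {0..1}" for t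
    using l(2,3)[OF that] m(2,3)[OF time_change_in[OF l(1) that]] by linarith
  then show ?thesis unfolding skorohod_close_def using time_change_comp[OF l(1) m(1)] by blast
qed

lemma skorohod_close_nonneg: "skorohod_close r x y \<Longrightarrow> 0 \<le> r"
proof -
  assume "skorohod_close r x y"
  then obtain l where "\<forall>t\<in>{0..1}. \<bar>l t - t\<bar> \<le> r" unfolding skorohod_close_def by blast
  then have "\<bar>l 0 - 0\<bar> \<le> r" by (rule bspec) simp
  then show "0 \<le> r" by linarith
qed

lemma cadlag_bounded:
  assumes "cadlag_unit x"
  obtains B where "\<And>t. t \<in> {0..1} \<Longrightarrow> \<bar>x t\<bar> \<le> B"
proof -
  have loc: "\<exists>d>0. \<exists>B. \<forall>s\<in>ball t d \<inter> {0..1}. \<bar>x s\<bar> \<le> B" if t: "t \<in> {0..1}" for t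
  proof -
    have R: "\<exists>e>t. \<exists>B. \<forall>s. t < s \<and> s < e \<and> s \<in> {0..1} \<longrightarrow> \<bar>x s\<bar> \<le> B"
    proof (cases "t < 1")
      case True
      then have "(x \<longlongrightarrow> x t) (at_right t)" using assms t by (auto simp: cadlag_unit_def)
      then have "eventually (\<lambda>s. dist (x s) (x t) < 1) (at_right t)"
        by (rule tendstoD) simp
      then obtain e where e: "e > t" "\<And>s. t < s \<Longrightarrow> s < e \<Longrightarrow> dist (x s) (x t) < 1"
        by (auto simp: eventually_at_right_field)
      have "\<bar>x s\<bar> \<le> \<bar>x t\<bar> + 1" if "t < s" "s < e" for s
      proof -
        have "dist (x s) (x t) < 1" using e(2) that by blast
        then show ?thesis unfolding dist_real_def by linarith
      qed
      then show ?thesis using e(1) by blast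
    next
      case False
      then show ?thesis using t by (intro exI[of _ "t + 1"]) auto
    qed
    have L: "\<exists>e<t. \<exists>B. \<forall>s. e < s \<and> s < t \<and> s \<in> {0..1} \<longrightarrow> \<bar>x s\<bar> \<le> B"
    proof (cases "0 < t")
      case True
      then have "\<exists>l. (x \<longlongrightarrow> l) (at_left t)" using assms t by (simp add: cadlag_unit_def)
      then obtain l where "(x \<longlongrightarrow> l) (at_left t)" ..
      then have "eventually (\<lambda>s. dist (x s) l < 1) (at_left t)"
        by (rule tendstoD) simp
      then obtain e where e: "e < t" "\<And>s. e < s \<Longrightarrow> s < t \<Longrightarrow> dist (x s) l < 1"
        by (auto simp: eventually_at_left_field)
      have "\<bar>x s\<bar> \<le> \<bar>l\<bar> + 1" if "e < s" "s < t" for s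
      proof -
        have "dist (x s) (l) < 1" using e(2) that by blast
        then show ?thesis unfolding dist_real_def by linarith
      qed
      then show ?thesis using e(1) by blast
    next
      case False
      then show ?thesis using t by (intro exI[of _ "t - 1"]) auto
    qed
    obtain e B where e: "e > t" "\<And>s. t < s \<Longrightarrow> s < e \<Longrightarrow> s \<in> {0..1} \<Longrightarrow> \<bar>x s\<bar> \<le> B"
      using R by blast
    obtain e' B' where e': "e' < t" "\<And>s. e' < s \<Longrightarrow> s < t \<Longrightarrow> s \<in> {0..1} \<Longrightarrow> \<bar>x s\<bar> \<le> B'"
      using L by blast
    define d where "d = min (e - t) (t - e')"
    define C where "C = max \<bar>x t\<bar> (max B B')"
    have "\<bar>x s\<bar> \<le> C" if "s \<in> ball t d \<inter> {0..1}" for s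
    proof -
      have s: "\<bar>t - s\<bar> < d" "s \<in> {0..1}" using that by (auto simp: dist_real_def)
      consider "s = t" | "t < s" | "s < t" by linarith
      then show ?thesis
      proof cases
        case 2
        then have "\<bar>x s\<bar> \<le> B" using s by (intro e(2)) (auto simp: d_def)
        then show ?thesis by (simp add: C_def)
      next
        case 3
        then have "\<bar>x s\<bar> \<le> B'" using s by (intro e'(2)) (auto simp: d_def)
        then show ?thesis by (simp add: C_def)
      qed (simp add: C_def)
    qed
    moreover have "d > 0" using e(1) e'(1) by (simp add: d_def)
    ultimately show ?thesis by blast
  qed
  then obtain d B where d: "\<And>t. t \<in> {0..1} \<Longrightarrow> d t > 0"
    and B: "\<And>t s. t \<in> {0..1} \<Longrightarrow> s \<in> ball t (d t) \<inter> {0..1} \<Longrightarrow> \<bar>x s\<bar> \<le> B t"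
    by metis
  obtain T where T: "T \<subseteq> {0..1}" "finite T" "{0..1} \<subseteq> (\<Union>t\<in>T. ball t (d t))"
  proof (rule compactE_image[of "{0..1::real}" "{0..1}" "\<lambda>t. ball t (d t)"])
    show "{0..1} \<subseteq> (\<Union>t\<in>{0..1}. ball t (d t))"
      using d by (meson UN_I centre_in_ball subsetI)
  qed auto
  show ?thesis
  proof (rule that[of "\<Sum>t\<in>T. \<bar>B t\<bar>"])
    fix s :: real assume s: "s \<in> {0..1}"
    then obtain t where t: "t \<in> T" "s \<in> ball t (d t)" using T(3) by blast
    then have "\<bar>x s\<bar> \<le> B t" using B[of t s] T(1) s by blast
    then have "\<bar>x s\<bar> \<le> \<bar>B t\<bar>" by linarith
    also have "\<dots> \<le> (\<Sum>t\<in>T. \<bar>B t\<bar>)" using T(2) t(1) by (intro member_le_sum) auto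
    finally show "\<bar>x s\<bar> \<le> (\<Sum>t\<in>T. \<bar>B t\<bar>)" .
  qed
qed

lemma skorohod_close_exists: "\<exists>r. skorohod_close r x y"
proof -
  obtain A where A: "\<And>t. t \<in> {0..1} \<Longrightarrow> \<bar>path x t\<bar> \<le> A"
    using cadlag_bounded[OF cadlag_path] by metis
  obtain B where B: "\<And>t. t \<in> {0..1} \<Longrightarrow> \<bar>path y t\<bar> \<le> B"
    using cadlag_bounded[OF cadlag_path] by metis
  have "\<bar>path x t - path y t\<bar> \<le> A + B \<and> \<bar>t - t\<bar> \<le> A + B" if "t \<in> {0..1}" for t
    using A[OF that] B[OF that] by linarith
  then have "skorohod_close (A + B) x y"
    unfolding skorohod_close_def using time_change_id by blast
  then show ?thesis ..
qed

lemma skorohod_close_zero: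
  assumes "\<And>e. e > 0 \<Longrightarrow> \<exists>r<e. skorohod_close r x y"
  shows "x = y"
proof -
  let ?x = "path x" and ?y = "path y"
  have one: "l 1 = 1" if "time_change l" for l
  proof -
    have "1 \<in> l ` {0..1}" using that by (simp add: time_change_def)
    then obtain s where s: "1 = l s" "s \<in> {0..1}" by (rule imageE)
    have "l 1 \<in> {0..1}" by (rule time_change_in[OF that]) simp
    moreover have "s < 1 \<Longrightarrow> l s < l 1"
      using that s(2) strict_mono_onD[of "{0..1}" l s 1] by (simp add: time_change_def)
    ultimately have "\<not> s < 1" using s by auto
    then have "s = 1" using s(2) by simp
    then show ?thesis using s(1) by simp
  qed
  have eq1: "?x 1 = ?y 1"
  proof (rule ccontr)
    assume "?x 1 \<noteq> ?y 1"
    then have "\<bar>?x 1 - ?y 1\<bar> > 0" by simp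
    then obtain r where r: "r < \<bar>?x 1 - ?y 1\<bar>" "skorohod_close r x y"
      using assms by blast
    obtain l where l: "time_change l" "\<forall>t\<in>{0..1}. \<bar>?x t - ?y (l t)\<bar> \<le> r"
      using r(2) unfolding skorohod_close_def by blast
    have "\<bar>?x 1 - ?y (l 1)\<bar> \<le> r" using l(2) by (rule bspec) simp
    then show False using one[OF l(1)] r(1) by simp
  qed
  have eq: "?x t = ?y t" if t: "t \<in> {0..<1}" for t
  proof -
    have "\<bar>?x t - ?y t\<bar> \<le> e" if e: "e > 0" for e
    proof -
      have "eventually (\<lambda>s. dist (?x s) (?x t) < e/3) (at_right t)"
        by (rule tendstoD) (use cadlag_path[of x] t e in \<open>auto simp: cadlag_unit_def\<close>)
      moreover have "eventually (\<lambda>s. dist (?y s) (?y t) < e/3) (at_right t)"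
        by (rule tendstoD) (use cadlag_path[of y] t e in \<open>auto simp: cadlag_unit_def\<close>)
      ultimately have "eventually (\<lambda>s. dist (?x s) (?x t) < e/3 \<and> dist (?y s) (?y t) < e/3) (at_right t)"
        by (rule eventually_conj)
      then obtain c where c: "c > t"
        "\<And>s. t < s \<Longrightarrow> s < c \<Longrightarrow> dist (?x s) (?x t) < e/3 \<and> dist (?y s) (?y t) < e/3"
        by (auto simp: eventually_at_right_field)
      define h where "h = (min c 1 - t) / 3"
      have h: "h > 0" using c(1) t by (simp add: h_def)
      define s where "s = t + h"
      obtain r where r: "r < min h (e/3)" "skorohod_close r x y"
      proof -
        have "min h (e/3) > 0" using h e by simp
        then show ?thesis using assms that by blast
      qed
      have s: "s \<in> {0..1}" "t < s" "s < c" "s + h < c"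
      proof -
        have "3 * h \<le> c - t" "3 * h \<le> 1 - t" by (simp_all add: h_def)
        moreover have "0 \<le> t" using t by simp
        ultimately have "0 \<le> s" "s \<le> 1" "t < s" "s < c" "s + h < c"
          using h unfolding s_def by linarith+
        then show "s \<in> {0..1}" "t < s" "s < c" "s + h < c" by simp_all
      qed
      obtain l where l: "\<bar>l s - s\<bar> \<le> r" "\<bar>?x s - ?y (l s)\<bar> \<le> r"
        using r(2) s(1) unfolding skorohod_close_def by blast
      have "t < l s" "l s < c" using l(1) r(1) s(4) h s_def by linarith+
      then have "dist (?y (l s)) (?y t) < e/3" using c(2) by blast
      moreover have "dist (?x s) (?x t) < e/3" using c(2) s by blast
      ultimately show ?thesis using l(2) r(1) unfolding dist_real_def by linarith
    qed
    then have "\<bar>?x t - ?y t\<bar> \<le> 0" by (rule field_le_epsilon) (simp only: add_0)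
    then show ?thesis by simp
  qed
  have "?x = ?y"
  proof (rule extensionalityI[OF path_ext path_ext])
    fix t :: real assume "t \<in> {0..1}"
    then consider "t = 1" | "t \<in> {0..<1}" by fastforce
    then show "?x t = ?y t" by cases (simp_all only: eq eq1)
  qed
  then show ?thesis by (simp add: path_inject)
qed

text \<open>
  The distance below is Billingsley's form of the Skorohod metric: the infimum of all \<open>r\<close> for which
  some time change moves every time point by at most \<open>r\<close> and matches the paths up to \<open>r\<close>.
\<close>
instantiation D01 :: metric_space
begin

definition dist_D01 :: "D01 \<Rightarrow> D01 \<Rightarrow> real" where
  "dist_D01 x y = Inf {r. skorohod_close r x y}"

definition uniformity_D01 :: "(D01 \<times> D01) filter" where
  "uniformity_D01 = (INF e\<in>{0 <..}. principal {(x, y). dist x y < e})"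

definition open_D01 :: "D01 set \<Rightarrow> bool" where
  "open_D01 U \<longleftrightarrow> (\<forall>x\<in>U. eventually (\<lambda>(x', y). x' = x \<longrightarrow> y \<in> U) uniformity)"

instance
proof
  have bdd: "bdd_below {r. skorohod_close r x y}" for x y :: D01
    using skorohod_close_nonneg by (meson bdd_belowI mem_Collect_eq)
  have ne: "{r. skorohod_close r x y} \<noteq> {}" for x y :: D01
    using skorohod_close_exists by auto
  have less: "\<exists>r<c. skorohod_close r x y" if "dist x y < c" for c and x y :: D01
    using that cInf_lessD[OF ne] unfolding dist_D01_def by blast
  have le: "dist x y \<le> r" if "skorohod_close r x y" for r and x y :: D01
    unfolding dist_D01_def using that by (intro cInf_lower bdd) auto
  have nn: "0 \<le> dist x y" for x y :: D01
    unfolding dist_D01_def using ne skorohod_close_nonneg by (intro cInf_greatest) auto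
  show "(dist x y = 0) = (x = y)" for x y :: D01
  proof
    assume "dist x y = 0"
    then show "x = y" using less by (intro skorohod_close_zero) simp
  next
    assume "x = y"
    then have "skorohod_close 0 x y"
      unfolding skorohod_close_def using time_change_id by (intro exI[of _ "\<lambda>t. t"]) auto
    then show "dist x y = 0" using le nn by (metis antisym)
  qed
  show "dist x y \<le> dist x z + dist y z" for x y z :: D01
  proof (rule field_le_epsilon)
    fix e :: real assume "e > 0"
    then have lt: "dist x z < dist x z + e/2" "dist y z < dist y z + e/2" by simp_all
    obtain r where r: "r < dist x z + e/2" "skorohod_close r x z"
      using less[OF lt(1)] by blast
    obtain s where s: "s < dist y z + e/2" "skorohod_close s y z"
      using less[OF lt(2)] by blast
    have "dist x y \<le> r + s"
      by (rule le, rule skorohod_close_trans[OF r(2)], rule skorohod_close_sym, rule s(2))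
    then show "dist x y \<le> dist x z + dist y z + e"
      using r(1) s(1) by linarith
  qed
qed (fact uniformity_D01_def open_D01_def)+

end


section \<open>Functional linear quantile regression\<close>

abbreviation unit_leb :: "real measure" where
  "unit_leb \<equiv> restrict_space lborel {0..1}"

definition in_L2 :: "(real \<Rightarrow> real) \<Rightarrow> bool" where
  "in_L2 f \<longleftrightarrow> f \<in> borel_measurable unit_leb \<and> integrable unit_leb (\<lambda>t. (f t)\<^sup>2)"

abbreviation obs :: "(real \<times> D01) measure" where
  "obs \<equiv> borel \<Otimes>\<^sub>M borel"

definition law_X :: "(real \<times> D01) measure \<Rightarrow> D01 measure" where
  "law_X F = distr F borel snd"

definition mean_fun :: "(real \<times> D01) measure \<Rightarrow> real \<Rightarrow> real" where
  "mean_fun F t = (\<integral>x. path x t \<partial>law_X F)"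

definition centred :: "(real \<times> D01) measure \<Rightarrow> D01 \<Rightarrow> real \<Rightarrow> real" where
  "centred F x t = path x t - mean_fun F t"

definition cov_kernel :: "(real \<times> D01) measure \<Rightarrow> real \<Rightarrow> real \<Rightarrow> real" where
  "cov_kernel F s t = (\<integral>x. centred F x s * centred F x t \<partial>law_X F)"

definition regular_cond_dist ::
    "(real \<times> D01) measure \<Rightarrow> (D01 \<Rightarrow> real measure) \<Rightarrow> bool" where
  "regular_cond_dist F \<mu> \<longleftrightarrow>
     \<mu> \<in> borel \<rightarrow>\<^sub>M prob_algebra borel \<and>
     (\<forall>A\<in>sets borel. \<forall>B\<in>sets borel.
        emeasure F (A \<times> B) = (\<integral>\<^sup>+x. emeasure (\<mu> x) A * indicator B x \<partial>law_X F))"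

definition quantile :: "real measure \<Rightarrow> real \<Rightarrow> real" where
  "quantile N u = Inf {y. u \<le> cdf N y}"

text \<open>
  Two regular conditional distributions agree for \<open>law_X F\<close>-almost every \<open>x\<close>, simultaneously in
  \<open>u\<close> for the quantiles; everything below depends on \<open>cond_quantile F u\<close> only up to
  \<open>law_X F\<close>-null sets, so the version chosen here is immaterial.
\<close>
definition cond_dist :: "(real \<times> D01) measure \<Rightarrow> D01 \<Rightarrow> real measure" where
  "cond_dist F = (SOME \<mu>. regular_cond_dist F \<mu>)"

definition cond_quantile :: "(real \<times> D01) measure \<Rightarrow> real \<Rightarrow> D01 \<Rightarrow> real" where
  "cond_quantile F u x = quantile (cond_dist F x) u"

definition linear_quantile ::
    "real set \<Rightarrow> (real \<times> D01) measure \<Rightarrow> (real \<Rightarrow> real) \<Rightarrow> (real \<Rightarrow> real \<Rightarrow> real) \<Rightarrow> bool" where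
  "linear_quantile U F a b \<longleftrightarrow>
     (\<forall>u\<in>U. in_L2 (\<lambda>t. b t u) \<and>
        (AE x in law_X F.
           cond_quantile F u x = a u + (\<integral>t. b t u * centred F x t \<partial>unit_leb)))"

text \<open>
  When all eigenvalues of the covariance operator are positive, as in the class below, the slope
  \<open>b(\<cdot>, u)\<close> of \<open>F\<close> is unique up to Lebesgue-null sets for each \<open>u \<in> U\<close>, and the loss below does not
  depend on the version.
\<close>
definition slope :: "real set \<Rightarrow> (real \<times> D01) measure \<Rightarrow> real \<Rightarrow> real \<Rightarrow> real" where
  "slope U F = (SOME b. \<exists>a. linear_quantile U F a b)"

text \<open>
  The eigenpairs are indexed by \<open>j \<ge> 1\<close>; the values at \<open>0\<close> are irrelevant. The last clause is the
  expansion of the covariance kernel, read in \<open>L\<^sub>2([0,1]\<^sup>2)\<close>.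
\<close>
definition spectral_expansion ::
    "(real \<times> D01) measure \<Rightarrow> (nat \<Rightarrow> real) \<Rightarrow> (nat \<Rightarrow> real \<Rightarrow> real) \<Rightarrow> bool" where
  "spectral_expansion F \<kappa> \<phi> \<longleftrightarrow>
     (\<forall>j\<ge>1. \<kappa> j \<ge> \<kappa> (Suc j) \<and> \<kappa> (Suc j) \<ge> 0) \<and>
     (\<forall>j\<ge>1. in_L2 (\<phi> j)) \<and>
     (\<forall>i\<ge>1. \<forall>j\<ge>1. (\<integral>t. \<phi> i t * \<phi> j t \<partial>unit_leb) = (if i = j then 1 else 0)) \<and>
     (\<forall>f. in_L2 f \<longrightarrow> (\<forall>j\<ge>1. (\<integral>t. f t * \<phi> j t \<partial>unit_leb) = 0) \<longrightarrow> (AE t in unit_leb. f t = 0)) \<and>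
     (\<forall>j\<ge>1. AE s in unit_leb. (\<integral>t. cov_kernel F s t * \<phi> j t \<partial>unit_leb) = \<kappa> j * \<phi> j s) \<and>
     ((\<lambda>N. \<integral>\<^sup>+s. \<integral>\<^sup>+t. ennreal ((cov_kernel F s t - (\<Sum>j=1..N. \<kappa> j * \<phi> j s * \<phi> j t))\<^sup>2)
        \<partial>unit_leb \<partial>unit_leb) \<longlonglongrightarrow> 0)"

definition score :: "(real \<times> D01) measure \<Rightarrow> (real \<Rightarrow> real) \<Rightarrow> D01 \<Rightarrow> real" where
  "score F \<phi>j x = (\<integral>t. centred F x t * \<phi>j t \<partial>unit_leb)"

text \<open>
  Moments are written as nonnegative integrals, so that their finiteness is part of the bounds.
\<close>
definition cond_A2 :: "real \<Rightarrow> (real \<times> D01) measure \<Rightarrow> (nat \<Rightarrow> real) \<Rightarrow> (nat \<Rightarrow> real \<Rightarrow> real) \<Rightarrow> bool" where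
  "cond_A2 C F \<kappa> \<phi> \<longleftrightarrow>
     (\<integral>\<^sup>+t. \<integral>\<^sup>+x. ennreal ((path x t)^4) \<partial>law_X F \<partial>unit_leb) \<le> ennreal C \<and>
     (\<forall>j\<ge>1. (\<integral>\<^sup>+x. ennreal ((score F (\<phi> j) x)^4) \<partial>law_X F) \<le> ennreal (C * (\<kappa> j)\<^sup>2))"

definition cond_A3 :: "real \<Rightarrow> real \<Rightarrow> (nat \<Rightarrow> real) \<Rightarrow> bool" where
  "cond_A3 C \<alpha> \<kappa> \<longleftrightarrow>
     (\<forall>j\<ge>1. inverse C * real j powr (-\<alpha>) \<le> \<kappa> j \<and> \<kappa> j \<le> C * real j powr (-\<alpha>) \<and>
            \<kappa> j - \<kappa> (Suc j) \<ge> inverse C * real j powr (-\<alpha> - 1))"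

definition cond_A4 ::
    "real set \<Rightarrow> real \<Rightarrow> real \<Rightarrow> (real \<Rightarrow> real \<Rightarrow> real) \<Rightarrow> (nat \<Rightarrow> real \<Rightarrow> real) \<Rightarrow> bool" where
  "cond_A4 U C \<beta> b \<phi> \<longleftrightarrow>
     (\<forall>j\<ge>1. \<forall>u\<in>U. \<bar>\<integral>t. b t u * \<phi> j t \<partial>unit_leb\<bar> \<le> C * real j powr (-\<beta>))"

definition cond_A5 :: "real \<Rightarrow> (D01 \<Rightarrow> real measure) \<Rightarrow> (D01 \<Rightarrow> real \<Rightarrow> real) \<Rightarrow> bool" where
  "cond_A5 C \<mu> f \<longleftrightarrow>
     (\<forall>x. \<exists>f'. continuous_on UNIV f' \<and>
        (\<forall>y. (cdf (\<mu> x) has_real_derivative f x y) (at y) \<and>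
             (f x has_real_derivative f' y) (at y) \<and>
             max (f x y) \<bar>f' y\<bar> \<le> C))"

definition cond_A6 ::
    "real set \<Rightarrow> real \<Rightarrow> (D01 \<Rightarrow> real measure) \<Rightarrow> (D01 \<Rightarrow> real \<Rightarrow> real) \<Rightarrow> bool" where
  "cond_A6 U C \<mu> f \<longleftrightarrow> (\<forall>x. \<forall>u\<in>U. f x (quantile (\<mu> x) u) \<ge> inverse C)"

definition cond_A8 :: "real \<Rightarrow> real \<Rightarrow> (real \<times> D01) measure \<Rightarrow> bool" where
  "cond_A8 C \<gamma> F \<longleftrightarrow>
     (\<forall>s\<in>{0..1}. \<forall>t\<in>{0..1}.
        (\<integral>\<^sup>+x. ennreal ((path x t - path x s)\<^sup>2) \<partial>law_X F) \<le> ennreal (C * \<bar>t - s\<bar> powr \<gamma>))"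

definition model_class ::
    "real set \<Rightarrow> real \<Rightarrow> real \<Rightarrow> real \<Rightarrow> real \<Rightarrow> (real \<times> D01) measure set" where
  "model_class U C \<alpha> \<beta> \<gamma> =
     {F. prob_space F \<and> sets F = sets obs \<and>
         (\<integral>\<^sup>+t. \<integral>\<^sup>+x. ennreal ((path x t)\<^sup>2) \<partial>law_X F \<partial>unit_leb) < \<infinity> \<and>
         (\<exists>a b \<kappa> \<phi> \<mu> f.
            linear_quantile U F a b \<and> spectral_expansion F \<kappa> \<phi> \<and> regular_cond_dist F \<mu> \<and>
            cond_A2 C F \<kappa> \<phi> \<and> cond_A3 C \<alpha> \<kappa> \<and> cond_A4 U C \<beta> b \<phi> \<and>
            cond_A5 C \<mu> f \<and> cond_A6 U C \<mu> f \<and> cond_A8 C \<gamma> F)}"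


section \<open>Estimators and losses\<close>

abbreviation sample :: "nat \<Rightarrow> (real \<times> D01) measure \<Rightarrow> (nat \<Rightarrow> real \<times> D01) measure" where
  "sample n F \<equiv> PiM {1..n} (\<lambda>_. F)"

definition slope_estimators ::
    "real set \<Rightarrow> nat \<Rightarrow> ((nat \<Rightarrow> real \<times> D01) \<Rightarrow> real \<Rightarrow> real \<Rightarrow> real) set" where
  "slope_estimators U n =
     {b'. \<forall>u\<in>U. (\<lambda>(d, t). b' d t u) \<in> borel_measurable (sample n obs \<Otimes>\<^sub>M unit_leb)}"

definition quantile_estimators ::
    "real set \<Rightarrow> nat \<Rightarrow> ((nat \<Rightarrow> real \<times> D01) \<Rightarrow> real \<Rightarrow> D01 \<Rightarrow> real) set" where
  "quantile_estimators U n =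
     {q. \<forall>u\<in>U. (\<lambda>(d, x). q d u x) \<in> borel_measurable (sample n obs \<Otimes>\<^sub>M borel)}"

text \<open>
  Joint measurability in the quantile index as well, needed for integrals over \<open>u\<close> to make sense.
  It implies membership in \<open>quantile_estimators U n\<close>.
\<close>
definition measurable_quantile_estimators ::
    "real set \<Rightarrow> nat \<Rightarrow> ((nat \<Rightarrow> real \<times> D01) \<Rightarrow> real \<Rightarrow> D01 \<Rightarrow> real) set" where
  "measurable_quantile_estimators U n =
     {q. (\<lambda>(d, u, x). q d u x) \<in>
           borel_measurable (sample n obs \<Otimes>\<^sub>M (restrict_space borel U \<Otimes>\<^sub>M borel))}"

definition slope_loss ::
    "real set \<Rightarrow> (real \<times> D01) measure \<Rightarrow> (real \<Rightarrow> real \<Rightarrow> real) \<Rightarrow> real \<Rightarrow> ennreal" where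
  "slope_loss U F b' u = (\<integral>\<^sup>+t. ennreal ((b' t u - slope U F t u)\<^sup>2) \<partial>unit_leb)"

definition pred_loss ::
    "(real \<times> D01) measure \<Rightarrow> (real \<Rightarrow> D01 \<Rightarrow> real) \<Rightarrow> real \<Rightarrow> ennreal" where
  "pred_loss F q u = (\<integral>\<^sup>+x. ennreal ((q u x - cond_quantile F u x)\<^sup>2) \<partial>law_X F)"

text \<open>
  A supremum over an uncountable \<open>U\<close> need not be a measurable function of the data. Probabilities
  of events are therefore inner probabilities: they coincide with \<open>emeasure\<close> on measurable events,
  and for the lower bounds they are the most demanding convention.
\<close>
definition inner_prob :: "'a measure \<Rightarrow> ('a \<Rightarrow> bool) \<Rightarrow> ennreal" where
  "inner_prob M P = (SUP A\<in>{A \<in> sets M. \<forall>\<omega>\<in>A. P \<omega>}. emeasure M A)"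

end

theory Submission
  imports Defs
begin

text \<open>
  Why the rates are unavoidable. Already a simple subfamily of the model is too rich: one fixed law
  of the covariate \<open>X\<close>, slopes \<open>b = \<delta> (\<phi>\<^bsub>j\<^esub> summed over j \<in> \<theta>)\<close> that do not depend on \<open>u\<close>, where
  \<open>\<theta>\<close> runs through the subsets of a block \<open>{m+1..2m}\<close>, and
  \<open>Y = \<langle>b, X\<rangle> + W\<close> with standard logistic noise \<open>W\<close>. The conditional \<open>u\<close>-quantile is then
  \<open>ln (u / (1 - u)) + \<langle>b, X\<rangle>\<close>, which is linear as required. Switching one index \<open>j\<close> in or out of
  \<open>\<theta>\<close> moves the location of \<open>Y\<close> by \<open>\<delta> |\<xi>\<^bsub>j\<^esub>|\<close>, whose square has mean
  \<open>\<delta>\<^sup>2 \<kappa>\<^bsub>j\<^esub>\<close>. The smoothness condition allows \<open>\<delta> = (2m) powr -\<beta>\<close>, and with \<open>m\<close> of the order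
  \<open>n powr (1 / (\<alpha> + 2 \<beta>))\<close> this is at most \<open>1 / n\<close>, so that \<open>n\<close> observations cannot decide whether
  \<open>j \<in> \<theta>\<close> (\<open>sample_testing_bound\<close>). By Assouad's argument (\<open>assouad_decoding\<close>) every estimator gets a
  fixed fraction of the \<open>m\<close> bits wrong with a probability bounded below, for some \<open>\<theta>\<close>. Each wrong
  bit costs \<open>\<delta>\<^sup>2\<close> in the slope and at least \<open>\<delta>\<^sup>2 (2m) powr -\<alpha>\<close> in the prediction, and \<open>m\<close> times these
  numbers are the two rates.

  All the work is in exhibiting a covariate law in the class. It needs cadlag paths, eigenvalues
  \<open>\<kappa>\<^bsub>j\<^esub> = j powr -\<alpha>\<close> and mean-square smoothness, for every \<open>\<alpha> > 1\<close>. For \<open>\<alpha> \<le> 2\<close> the series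
  \<open>j powr (-\<alpha>/2)\<close> diverges, so continuity of the paths must come from cancellation. Take
  \<open>X(t) = g(t + V) + g(t - V)\<close> with \<open>V\<close> uniform on \<open>[0,1]\<close> and
  \<open>g(x) = (\<Sum>j. \<epsilon>\<^bsub>j\<^esub> j powr (-\<alpha>/2) sin (\<pi> j x))\<close>. By the addition theorem
  \<open>X(t) = (\<Sum>j. \<epsilon>\<^bsub>j\<^esub> j powr (-\<alpha>/2) (\<surd>2 cos (\<pi> j V)) (\<surd>2 sin (\<pi> j t)))\<close>, hence the sine basis
  diagonalises the covariance and the scores are uncorrelated and bounded. With the Rudin--Shapiro
  signs \<open>\<epsilon>\<^bsub>j\<^esub>\<close> the sums of the first \<open>N\<close> terms \<open>\<epsilon>\<^bsub>j\<^esub> sin (\<pi> j x)\<close> are at most \<open>5 \<surd>(N+1)\<close>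
  (\<open>rs_sine_sum_le\<close>), and summation by parts makes the series for \<open>g\<close> converge uniformly for all
  \<open>\<alpha> > 1\<close>. Bounded scores combine well with logistic noise, whose log-density is
  \<open>1\<close>-Lipschitz: the chi-square distance of two shifted versions is of the order of the squared shift
  (\<open>logistic_chi_square_bound\<close>), uniformly over the paths.

  The slope and the conditional quantile of a distribution are only defined up to null sets, so it also has
  to be shown that any admissible version agrees with the intended one: \<open>cond_quantile_eq_AE\<close> does this
  for the quantile, \<open>slope_identified\<close> together with completeness of the sine basis
  (\<open>sin_basis_complete\<close>) for the slope.
\<close>

section \<open>Rudin--Shapiro sums\<close>

text \<open>
  The Rudin--Shapiro sequence: the sign is negative iff the binary expansion of \<open>n\<close> contains an odd number
  of adjacent ones. The recursion strips the last binary digit, which is the form used for the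
  doubling of partial sums below.
\<close>
fun rs_sign :: "nat \<Rightarrow> real" where
  "rs_sign n = (if n = 0 then 1 else if even n then rs_sign (n div 2)
                else (-1) ^ (n div 2) * rs_sign (n div 2))"

declare rs_sign.simps [simp del]

lemma rs_sign_even: "rs_sign (2 * n) = rs_sign n"
  by (subst rs_sign.simps) (simp add: rs_sign.simps[of 0])

lemma rs_sign_odd: "rs_sign (Suc (2 * n)) = (-1) ^ n * rs_sign n"
  by (subst rs_sign.simps) simp

lemma abs_rs_sign: "\<bar>rs_sign n\<bar> = 1"
proof (induction n rule: less_induct)
  case (less n)
  show ?case
  proof (cases "n = 0")
    case False
    then have "\<bar>rs_sign (n div 2)\<bar> = 1" by (intro less) simp
    then show ?thesis by (subst rs_sign.simps) (simp add: abs_mult power_abs)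
  qed (simp add: rs_sign.simps[of 0])
qed

lemma rs_sign_sq: "(rs_sign n)\<^sup>2 = 1"
  using abs_rs_sign[of n] by (metis power2_abs one_power2)

definition rs_poly :: "nat \<Rightarrow> real \<Rightarrow> complex" where
  "rs_poly N x = (\<Sum>n<N. of_real (rs_sign n) * cis (real n * x))"

lemma rs_poly_Suc:
  "rs_poly (Suc N) x = rs_poly N x + of_real (rs_sign N) * cis (real N * x)"
  by (simp add: rs_poly_def)

lemma cis_add_pi: "cis (real n * (x + pi)) = (-1) ^ n * cis (real n * x)"
proof -
  have "cis (real n * (x + pi)) = cis (real n * x) * cis (real n * pi)"
    by (simp add: cis_mult algebra_simps)
  also have "cis (real n * pi) = (-1) ^ n"
    by (simp only: Complex.DeMoivre[symmetric] cis_pi)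
  finally show ?thesis by simp
qed

text \<open>
  Splitting the sum into even and odd indices; the factor \<open>(-1) ^ k\<close> at the odd index \<open>2 k + 1\<close> is a shift
  of the argument by \<open>\<pi>\<close>.
\<close>
lemma rs_poly_double:
  "rs_poly (2 * N) x = rs_poly N (2 * x) + cis x * rs_poly N (2 * x + pi)"
proof (induction N)
  case (Suc N)
  have *: "cis (real (Suc (2 * N)) * x) = cis x * cis (real N * (2 * x))"
    by (simp add: cis_mult algebra_simps)
  have **: "cis (real (2 * N) * x) = cis (real N * (2 * x))"
    by (simp add: algebra_simps)
  have "rs_poly (2 * Suc N) x = rs_poly (2 * N) x
      + of_real (rs_sign (2 * N)) * cis (real (2 * N) * x)
      + of_real (rs_sign (Suc (2 * N))) * cis (real (Suc (2 * N)) * x)"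
    by (simp add: rs_poly_def)
  then show ?case
    unfolding Suc.IH * ** rs_sign_even rs_sign_odd rs_poly_Suc cis_add_pi
    by (simp add: algebra_simps)
qed (simp add: rs_poly_def)

lemma rs_poly_periodic: "rs_poly N (x + 2 * pi) = rs_poly N x"
proof -
  have "cis (real n * (x + 2 * pi)) = cis (real n * x)" for n
  proof -
    have "x + 2 * pi = (x + pi) + pi" by simp
    then have "cis (real n * (x + 2 * pi)) = ((-1) ^ n * (-1) ^ n) * cis (real n * x)"
      by (simp only: cis_add_pi mult.assoc)
    also have "(-1) ^ n * (-1) ^ n = (1::complex)" by (simp flip: power_mult_distrib)
    finally show ?thesis by simp
  qed
  then show ?thesis by (simp add: rs_poly_def)
qed

text \<open>
  The doubling formula mixes the values at \<open>x\<close> and \<open>x + \<pi>\<close>; as a pair they satisfy the parallelogram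
  law, so doubling the number of terms multiplies the norm by exactly \<open>\<surd>2\<close>.
\<close>
definition rs_pair :: "nat \<Rightarrow> real \<Rightarrow> complex \<times> complex" where
  "rs_pair N x = (rs_poly N x, rs_poly N (x + pi))"

lemma norm_rs_pair_double: "norm (rs_pair (2 * N) x) = sqrt 2 * norm (rs_pair N (2 * x))"
proof -
  define a where "a = rs_poly N (2 * x)"
  define b where "b = cis x * rs_poly N (2 * x + pi)"
  have 1: "rs_poly (2 * N) x = a + b" by (simp add: rs_poly_double a_def b_def)
  have "rs_poly (2 * N) (x + pi)
      = rs_poly N (2 * x + 2 * pi) + cis (x + pi) * rs_poly N (2 * x + pi + 2 * pi)"
  proof -
    have "2 * (x + pi) = 2 * x + 2 * pi" "2 * x + 2 * pi + pi = 2 * x + pi + 2 * pi" by simp_all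
    then show ?thesis by (simp only: rs_poly_double)
  qed
  also have "\<dots> = a - b"
    by (simp only: rs_poly_periodic a_def b_def) (simp add: cis_mult[symmetric])
  finally have 2: "rs_poly (2 * N) (x + pi) = a - b" .
  have "(norm (a + b))\<^sup>2 + (norm (a - b))\<^sup>2 = 2 * ((norm a)\<^sup>2 + (norm b)\<^sup>2)"
    by (simp only: cmod_power2) (simp add: algebra_simps power2_eq_square)
  moreover have "norm b = norm (rs_poly N (2 * x + pi))"
    by (simp add: b_def norm_mult)
  ultimately show ?thesis
    by (simp add: rs_pair_def 1 2 norm_Pair a_def real_sqrt_mult[symmetric] del: real_sqrt_mult)
qed

lemma norm_rs_pair_Suc: "norm (rs_pair (Suc N) x) \<le> norm (rs_pair N x) + sqrt 2"
proof -
  define p where "p = (of_real (rs_sign N) * cis (real N * x),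
    of_real (rs_sign N) * cis (real N * (x + pi)))"
  have "rs_pair (Suc N) x = rs_pair N x + p" by (simp add: rs_pair_def rs_poly_def p_def)
  moreover have "norm p = sqrt 2"
    by (simp add: p_def norm_Pair norm_mult abs_rs_sign)
  ultimately show ?thesis using norm_triangle_ineq[of "rs_pair N x" p] by simp
qed

text \<open>
  Binary descent gives \<open>a (2N) = \<surd>2 a(N)\<close> and \<open>a (2N + 1) \<le> \<surd>2 a(N) + \<surd>2\<close>. The negative constant
  \<open>-7/2\<close> absorbs the additive \<open>\<surd>2\<close> because \<open>(\<surd>2 - 1) 7/2 \<ge> \<surd>2\<close>, and the factor \<open>5\<close> then makes the start
  \<open>N = 1\<close> true.
\<close>
lemma norm_rs_pair_le:
  "N \<ge> 1 \<Longrightarrow> norm (rs_pair N x) \<le> 5 * sqrt (real N) - 7/2"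
proof (induction N arbitrary: x rule: less_induct)
  case (less N)
  have lo: "14/10 \<le> sqrt 2" by (rule real_le_rsqrt) (simp add: power2_eq_square)
  have up: "sqrt 2 \<le> 15/10" by (rule real_le_lsqrt) (simp_all add: power2_eq_square)
  define k where "k = N div 2"
  show ?case
  proof (cases "k = 0")
    case True
    then have "N = Suc 0" using less.prems by (simp add: k_def)
    then show ?thesis using norm_rs_pair_Suc[of 0 x] up by (simp add: rs_pair_def rs_poly_def zero_prod_def[symmetric])
  next
    case False
    then have k: "k < N" "k \<ge> 1" by (auto simp: k_def)
    have "sqrt 2 * norm (rs_pair k (2 * x)) \<le> sqrt 2 * (5 * sqrt (real k) - 7/2)"
      using less.IH[OF k] by (intro mult_left_mono) auto
    also have "\<dots> = 5 * sqrt (real (2 * k)) - 7/2 * sqrt 2"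
      by (simp add: real_sqrt_mult algebra_simps)
    finally have *: "norm (rs_pair (2 * k) x) \<le> 5 * sqrt (real (2 * k)) - 7/2 * sqrt 2"
      by (simp only: norm_rs_pair_double)
    show ?thesis
    proof (cases "even N")
      case True
      then have N: "N = 2 * k" by (simp add: k_def)
      show ?thesis using * lo unfolding N by linarith
    next
      case False
      then have N: "N = Suc (2 * k)" by (simp add: k_def)
      have "sqrt (real (2 * k)) \<le> sqrt (real N)" by (simp add: N)
      then show ?thesis using * norm_rs_pair_Suc[of "2 * k" x] lo unfolding N by linarith
    qed
  qed
qed

lemma rs_sine_sum_le:
  "\<bar>\<Sum>j=1..N. rs_sign j * sin (pi * real j * x)\<bar> \<le> 5 * sqrt (real (Suc N))"
proof -
  have "(\<Sum>j=1..N. rs_sign j * sin (pi * real j * x)) = Im (rs_poly (Suc N) (pi * x))"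
    by (simp add: rs_poly_def lessThan_Suc_atMost atMost_atLeast0 sum.atLeast_Suc_atMost[of 0] mult_ac)
  also have "\<bar>\<dots>\<bar> \<le> norm (rs_pair (Suc N) (pi * x))"
    using abs_Im_le_cmod[of "rs_poly (Suc N) (pi * x)"]
      norm_fst_le[of "rs_poly (Suc N) (pi * x)" "rs_poly (Suc N) (pi * x + pi)"]
    by (simp add: rs_pair_def)
  also have "\<dots> \<le> 5 * sqrt (real (Suc N))"
    using norm_rs_pair_le[of "Suc N" "pi * x"] by simp
  finally show ?thesis .
qed

section \<open>The sine system on the unit interval\<close>

lemma space_unit_leb [simp]: "space unit_leb = {0..1}"
  by (simp add: space_restrict_space)

lemma prob_space_unit_leb: "prob_space unit_leb"
  by (rule prob_spaceI) (simp add: emeasure_restrict_space)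

lemma continuous_measurable_unit_leb:
  fixes f :: "real \<Rightarrow> 'a :: topological_space"
  assumes "continuous_on {0..1} f"
  shows "f \<in> borel_measurable unit_leb"
proof -
  have "f \<in> borel_measurable (restrict_space borel {0..1})"
    by (rule borel_measurable_continuous_on_restrict[OF assms])
  moreover have eq: "sets unit_leb = sets (restrict_space borel {0..1::real})"
    by (simp add: sets_restrict_space)
  ultimately show ?thesis using measurable_cong_sets[OF eq refl, of borel] by blast
qed

lemma bounded_integrable_unit_leb:
  fixes f :: "real \<Rightarrow> real"
  assumes "f \<in> borel_measurable unit_leb" "\<And>t. t \<in> {0..1} \<Longrightarrow> \<bar>f t\<bar> \<le> B"
  shows "integrable unit_leb f"
proof -
  interpret prob_space unit_leb by (rule prob_space_unit_leb)
  show ?thesis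
    by (rule integrable_const_bound[of _ B]) (use assms in auto)
qed

lemma integrable_mult_continuous:
  fixes k g :: "real \<Rightarrow> real"
  assumes k: "integrable unit_leb k" and g: "continuous_on {0..1} g"
  shows "integrable unit_leb (\<lambda>t. k t * g t)"
proof -
  have "compact (g ` {0..1})" by (rule compact_continuous_image[OF g]) simp
  then obtain B where B: "\<And>t. t \<in> {0..1} \<Longrightarrow> \<bar>g t\<bar> \<le> B"
    by (metis compact_imp_bounded bounded_real image_eqI)
  show ?thesis
  proof (rule Bochner_Integration.integrable_bound[of _ "\<lambda>t. \<bar>k t\<bar> * B"])
    show "(\<lambda>t. k t * g t) \<in> borel_measurable unit_leb"
      using k continuous_measurable_unit_leb[OF g] by simp
    show "AE t in unit_leb. norm (k t * g t) \<le> norm (\<bar>k t\<bar> * B)"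
    proof (rule AE_I2)
      fix t :: real assume "t \<in> space unit_leb"
      then have "\<bar>k t\<bar> * \<bar>g t\<bar> \<le> \<bar>k t\<bar> * \<bar>B\<bar>"
        using B[of t] by (intro mult_left_mono) auto
      then show "norm (k t * g t) \<le> norm (\<bar>k t\<bar> * B)" by (simp add: abs_mult)
    qed
  qed (use k in simp)
qed

lemma continuous_integrable_unit_leb:
  fixes f :: "real \<Rightarrow> real"
  assumes "continuous_on {0..1} f"
  shows "integrable unit_leb f"
proof -
  have "integrable unit_leb (\<lambda>t. 1 * f t)"
    by (intro integrable_mult_continuous assms bounded_integrable_unit_leb[of _ 1]) simp_all
  then show ?thesis by simp
qed

lemma integral_unit_leb_FTC:
  fixes F f :: "real \<Rightarrow> real"
  assumes "\<And>t. (F has_real_derivative f t) (at t)" "\<And>t. isCont f t"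
  shows "(\<integral>t. f t \<partial>unit_leb) = F 1 - F 0"
proof -
  have "(\<integral>t. f t * indicator {0..1} t \<partial>lborel) = F 1 - F 0"
    by (rule integral_FTC_Icc_real) (use assms in auto)
  then show ?thesis by (simp add: integral_restrict_space mult.commute)
qed

lemma integral_cos_unit_leb:
  "(\<integral>t. cos (pi * real_of_int k * t) \<partial>unit_leb) = (if k = 0 then 1 else 0)"
proof (cases "k = 0")
  case True
  then show ?thesis
    using integral_unit_leb_FTC[of "\<lambda>t. t" "\<lambda>t. 1"] by (simp add: DERIV_ident)
next
  case False
  have "(\<integral>t. cos (pi * real_of_int k * t) \<partial>unit_leb)
      = sin (pi * real_of_int k * 1) / (pi * real_of_int k) - sin (pi * real_of_int k * 0) / (pi * real_of_int k)"
    by (rule integral_unit_leb_FTC)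
       (use False in \<open>auto intro!: derivative_eq_intros continuous_intros\<close>)
  also have "sin (pi * real_of_int k * 1) = 0"
    by (simp add: sin_int_times_real mult.commute)
  finally show ?thesis using False by simp
qed

definition sin_basis :: "nat \<Rightarrow> real \<Rightarrow> real" where
  "sin_basis j t = sqrt 2 * sin (pi * real j * t)"

definition cos_basis :: "nat \<Rightarrow> real \<Rightarrow> real" where
  "cos_basis j t = sqrt 2 * cos (pi * real j * t)"

lemma continuous_sin_basis: "continuous_on A (sin_basis j)"
  unfolding sin_basis_def by (intro continuous_intros)

lemma continuous_cos_basis: "continuous_on A (cos_basis j)"
  unfolding cos_basis_def by (intro continuous_intros)

lemma sin_basis_le: "\<bar>sin_basis j t\<bar> \<le> sqrt 2"
  unfolding sin_basis_def using abs_sin_le_one by (simp add: abs_mult mult_left_le)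

lemma cos_basis_le: "\<bar>cos_basis j t\<bar> \<le> sqrt 2"
  unfolding cos_basis_def using abs_cos_le_one by (simp add: abs_mult mult_left_le)

lemma
  assumes "i \<ge> 1" "j \<ge> 1"
  shows integral_sin_basis:
    "(\<integral>t. sin_basis i t * sin_basis j t \<partial>unit_leb) = (if i = j then 1 else 0)"
  and integral_cos_basis:
    "(\<integral>t. cos_basis i t * cos_basis j t \<partial>unit_leb) = (if i = j then 1 else 0)"
proof -
  let ?c = "\<lambda>k t. cos (pi * real_of_int k * t)"
  have int: "integrable unit_leb (?c k)" for k
    by (intro continuous_integrable_unit_leb continuous_intros)
  have *: "sqrt 2 * x * (sqrt 2 * y) = 2 * x * y" for x y :: real by simp
  have s: "sin_basis i t * sin_basis j t = ?c (int i - int j) t - ?c (int i + int j) t" for t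
    unfolding sin_basis_def * by (simp add: sin_times_sin algebra_simps diff_divide_distrib)
  have c: "cos_basis i t * cos_basis j t = ?c (int i - int j) t + ?c (int i + int j) t" for t
    unfolding cos_basis_def * by (simp add: cos_times_cos algebra_simps add_divide_distrib)
  have "(\<integral>t. sin_basis i t * sin_basis j t \<partial>unit_leb)
      = (\<integral>t. ?c (int i - int j) t \<partial>unit_leb) - (\<integral>t. ?c (int i + int j) t \<partial>unit_leb)"
    unfolding s by (rule Bochner_Integration.integral_diff[OF int int])
  then show "(\<integral>t. sin_basis i t * sin_basis j t \<partial>unit_leb) = (if i = j then 1 else 0)"
    unfolding integral_cos_unit_leb using assms by auto
  have "(\<integral>t. cos_basis i t * cos_basis j t \<partial>unit_leb)
      = (\<integral>t. ?c (int i - int j) t \<partial>unit_leb) + (\<integral>t. ?c (int i + int j) t \<partial>unit_leb)"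
    unfolding c by (rule Bochner_Integration.integral_add[OF int int])
  then show "(\<integral>t. cos_basis i t * cos_basis j t \<partial>unit_leb) = (if i = j then 1 else 0)"
    unfolding integral_cos_unit_leb using assms by auto
qed

lemma integral_cos_basis_zero:
  assumes "j \<ge> 1" shows "(\<integral>t. cos_basis j t \<partial>unit_leb) = 0"
  using assms integral_cos_unit_leb[of "int j"] by (simp add: cos_basis_def)

lemma in_L2_sin_basis: "in_L2 (sin_basis j)"
proof -
  have "continuous_on {0..1} (\<lambda>t. (sin_basis j t)\<^sup>2)"
    by (intro continuous_intros continuous_sin_basis)
  then show ?thesis
    unfolding in_L2_def
    by (intro conjI continuous_measurable_unit_leb continuous_integrable_unit_leb
        continuous_sin_basis)
qed

lemma in_L2_integrable: "in_L2 f \<Longrightarrow> integrable unit_leb f"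
proof -
  assume f: "in_L2 f"
  interpret prob_space unit_leb by (rule prob_space_unit_leb)
  show ?thesis
    by (rule square_integrable_imp_integrable) (use f in \<open>simp_all add: in_L2_def\<close>)
qed

text \<open>
  The functions \<open>max 0 (1 - n infdist t A)\<close> decrease to the indicator of a closed set \<open>A\<close>, so \<open>H\<close>
  integrates to zero over closed sets, hence over all Borel sets by Dynkin's argument.
\<close>
lemma integral_zero_of_orthogonal_continuous:
  fixes H :: "real \<Rightarrow> real"
  assumes H: "integrable unit_leb H"
    and orth: "\<And>g. continuous_on {0..1} g \<Longrightarrow> (\<integral>t. H t * g t \<partial>unit_leb) = 0"
  shows "AE t in unit_leb. H t = 0"
proof (rule density_unique_real[OF H])
  have H_meas [measurable]: "H \<in> borel_measurable unit_leb" using H by simp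
  have int_ind: "integrable unit_leb (\<lambda>t. H t * indicator A t)" if "A \<in> sets borel" for A
  proof -
    have "A \<inter> {0..1} \<in> sets unit_leb" using that by (auto simp: sets_restrict_space)
    then have "integrable unit_leb (\<lambda>t. H t * indicator (A \<inter> {0..1}) t)"
      by (rule integrable_real_mult_indicator[OF _ H])
    also have "?this \<longleftrightarrow> ?thesis"
      by (rule Bochner_Integration.integrable_cong) (auto simp: indicator_def)
    finally show ?thesis .
  qed
  have gen: "(\<integral>t. H t * indicator A t \<partial>unit_leb) = 0" if "A \<in> sets borel" for A :: "real set"
  proof -
    have cs: "Int_stable (Collect closed :: real set set)" by (auto simp: Int_stable_def)
    have sub: "(Collect closed :: real set set) \<subseteq> Pow UNIV" by simp
    have "A \<in> sigma_sets UNIV (Collect closed)"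
      using that by (simp add: borel_eq_closed)
    with cs sub show ?thesis
    proof (induction rule: sigma_sets_induct_disjoint)
      case (basic A)
      then have cl: "closed A" by simp
      show ?case
      proof (cases "A = {}")
        case False
        define g where "g n t = max 0 (1 - real n * infdist t A)" for n t
        have "(\<lambda>n. \<integral>t. H t * g n t \<partial>unit_leb) \<longlonglongrightarrow> (\<integral>t. H t * indicator A t \<partial>unit_leb)"
        proof (rule integral_dominated_convergence[where w="\<lambda>t. \<bar>H t\<bar>"])
          show "AE t in unit_leb. (\<lambda>n. H t * g n t) \<longlonglongrightarrow> H t * indicator A t"
          proof (rule AE_I2, rule tendsto_mult[OF tendsto_const])
            fix t :: real
            show "(\<lambda>n. g n t) \<longlonglongrightarrow> indicator A t"
            proof (cases "t \<in> A")
              case True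
              then show ?thesis by (simp add: g_def)
            next
              case out: False
              then have pos: "infdist t A > 0"
                using cl False by (metis in_closed_iff_infdist_zero infdist_nonneg less_eq_real_def)
              obtain N where N: "1 < real N * infdist t A"
                using reals_Archimedean3[OF pos] by blast
              have "eventually (\<lambda>n. g n t = 0) sequentially"
                using eventually_ge_at_top[of N]
              proof eventually_elim
                case (elim n)
                then have "real N * infdist t A \<le> real n * infdist t A"
                  using pos by (intro mult_right_mono) auto
                then show ?case using N by (simp add: g_def)
              qed
              then show ?thesis using out by (simp add: tendsto_eventually)
            qed
          qed
          have "\<bar>g n t\<bar> \<le> 1" for n t
            by (auto simp: g_def infdist_nonneg)
          then show "AE t in unit_leb. norm (H t * g n t) \<le> \<bar>H t\<bar>" for n
            by (auto simp: abs_mult mult_left_le)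
          show "(\<lambda>t. H t * g n t) \<in> borel_measurable unit_leb" for n
            by (intro borel_measurable_times H_meas continuous_measurable_unit_leb)
               (auto simp: g_def intro!: continuous_intros)
          show "integrable unit_leb (\<lambda>t. \<bar>H t\<bar>)" using H by simp
          show "(\<lambda>t. H t * indicator A t) \<in> borel_measurable unit_leb"
            using int_ind[of A] cl by auto
        qed
        moreover have "(\<integral>t. H t * g n t \<partial>unit_leb) = 0" for n
          by (rule orth) (auto simp: g_def intro!: continuous_intros)
        ultimately show ?thesis by (simp add: LIMSEQ_const_iff)
      qed simp
    next
      case (compl A)
      then have A: "A \<in> sets borel" by (simp add: borel_eq_closed)
      have "H t * indicator (UNIV - A) t = H t - H t * indicator A t" for t
        by (simp add: indicator_def)
      moreover have "(\<integral>t. H t \<partial>unit_leb) = 0"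
        using orth[of "\<lambda>t. 1"] by simp
      ultimately show ?case
        using compl by (simp add: Bochner_Integration.integral_diff[OF H int_ind[OF A]])
    next
      case (union A)
      then have A: "A i \<in> sets borel" for i by (auto simp: borel_eq_closed)
      have "(\<lambda>n. \<integral>t. H t * indicator (\<Union>i<n. A i) t \<partial>unit_leb)
          \<longlonglongrightarrow> (\<integral>t. H t * indicator (\<Union>i. A i) t \<partial>unit_leb)"
      proof (rule integral_dominated_convergence[where w="\<lambda>t. \<bar>H t\<bar>"])
        show "AE t in unit_leb. (\<lambda>n. H t * indicator (\<Union>i<n. A i) t) \<longlonglongrightarrow> H t * indicator (\<Union>i. A i) t"
          by (rule AE_I2, rule tendsto_mult[OF tendsto_const], rule LIMSEQ_indicator_UN)
        show "integrable unit_leb (\<lambda>t. \<bar>H t\<bar>)" using H by simp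
        show "(\<lambda>t. H t * indicator (\<Union>i. A i) t) \<in> borel_measurable unit_leb"
          by (rule borel_measurable_integrable, rule int_ind) (use A in auto)
        show "(\<lambda>t. H t * indicator (\<Union>i<n. A i) t) \<in> borel_measurable unit_leb" for n
          by (rule borel_measurable_integrable, rule int_ind) (use A in auto)
      qed (auto simp: indicator_def)
      moreover have "(\<integral>t. H t * indicator (\<Union>i<n. A i) t \<partial>unit_leb) = 0" for n
      proof -
        have eq: "H t * indicator (\<Union>i<n. A i) t = (\<Sum>i<n. H t * indicator (A i) t)" for t
        proof -
          have "indicator (\<Union>i<n. A i) t = (\<Sum>i<n. indicator (A i) t :: real)"
            using union(1) by (intro indicator_UN_disjoint) (auto simp: disjoint_family_on_def)
          then show ?thesis by (simp add: sum_distrib_left)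
        qed
        have "(\<integral>t. H t * indicator (\<Union>i<n. A i) t \<partial>unit_leb)
            = (\<Sum>i<n. \<integral>t. H t * indicator (A i) t \<partial>unit_leb)"
          unfolding eq by (rule Bochner_Integration.integral_sum) (rule int_ind[OF A])
        then show ?thesis using union(3) by simp
      qed
      ultimately show ?case by (simp add: LIMSEQ_const_iff)
    qed simp
  qed
  show "integrable unit_leb (\<lambda>_. 0 :: real)" by simp
  fix A assume "A \<in> sets unit_leb"
  then have "A \<in> sets borel" by (auto simp: sets_restrict_space)
  then show "(\<integral>t\<in>A. H t \<partial>unit_leb) = (\<integral>t\<in>A. 0 \<partial>unit_leb)"
    using gen[of A] by (simp add: set_lebesgue_integral_def mult.commute)
qed

text \<open>
  Since \<open>2 cos (\<pi> t) sin (\<pi> j t) = sin (\<pi> (j+1) t) + sin (\<pi> (j-1) t)\<close>, a function orthogonal to all sines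
  is orthogonal to \<open>sin (\<pi> t) cos (\<pi> t) ^ n\<close> for every \<open>n\<close>. In the variable \<open>cos (\<pi> t)\<close>, which
  parametrises \<open>[0,1]\<close>, the Weierstrass theorem shows that \<open>h(t) sin (\<pi> t)\<close> is orthogonal to all
  continuous functions, and the sine vanishes only at the end points.
\<close>
lemma sin_basis_complete:
  assumes h: "in_L2 h" and orth: "\<And>j. j \<ge> 1 \<Longrightarrow> (\<integral>t. h t * sin_basis j t \<partial>unit_leb) = 0"
  shows "AE t in unit_leb. h t = 0"
proof -
  have int: "integrable unit_leb h" using h by (rule in_L2_integrable)
  have hm [measurable]: "h \<in> borel_measurable unit_leb" using int by simp
  note int_mult = integrable_mult_continuous[OF int]
  let ?S = "\<lambda>j t. sin (pi * real j * t)"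
  have trig: "(\<integral>t. h t * (cos (pi * t) ^ n * ?S j t) \<partial>unit_leb) = 0" for n j
  proof (induction n arbitrary: j)
    case 0
    show ?case
    proof (cases "j = 0")
      case False
      then have "(\<integral>t. sqrt 2 * (h t * ?S j t) \<partial>unit_leb) = 0"
        using orth[of j] by (simp add: sin_basis_def mult_ac)
      then show ?thesis by simp
    qed simp
  next
    case (Suc n)
    show ?case
    proof (cases j)
      case (Suc i)
      have "cos (pi * t) * ?S j t = (?S (Suc j) t + ?S i t) / 2" for t
      proof -
        have "?S j t * cos (pi * t) = (sin (pi * real j * t + pi * t) + sin (pi * real j * t - pi * t)) / 2"
          by (rule sin_times_cos)
        also have "pi * real j * t + pi * t = pi * real (Suc j) * t"
          by (simp add: algebra_simps)
        also have "pi * real j * t - pi * t = pi * real i * t"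
          by (simp add: Suc algebra_simps)
        finally show ?thesis by (simp only: mult.commute)
      qed
      note step = this
      have eq: "h t * (cos (pi * t) ^ Suc n * ?S j t)
          = h t * (cos (pi * t) ^ n * ?S (Suc j) t) / 2 + h t * (cos (pi * t) ^ n * ?S i t) / 2" for t
      proof -
        have "h t * (cos (pi * t) ^ Suc n * ?S j t) = h t * (cos (pi * t) ^ n * (cos (pi * t) * ?S j t))"
          by (simp only: power_Suc mult_ac)
        then show ?thesis
          unfolding step by (simp only: ring_distribs add_divide_distrib times_divide_eq_right)
      qed
      have int2: "integrable unit_leb (\<lambda>t. h t * (cos (pi * t) ^ n * ?S k t) / 2)" for k
        by (intro integrable_divide int_mult continuous_intros)
      show ?thesis
        unfolding eq Bochner_Integration.integral_add[OF int2 int2]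
        using Suc.IH[of "Suc j"] Suc.IH[of i] by (simp del: of_nat_Suc)
    qed simp
  qed
  define H where "H t = h t * sin (pi * t)" for t
  have H: "integrable unit_leb H"
    unfolding H_def by (intro int_mult continuous_intros)
  have poly: "(\<integral>t. H t * p (cos (pi * t)) \<partial>unit_leb) = 0" if p: "real_polynomial_function p" for p
  proof -
    obtain a n where p: "p = (\<lambda>x. \<Sum>i\<le>n. a i * x ^ i)"
      using p unfolding real_polynomial_function_iff_sum by blast
    have int: "integrable unit_leb (\<lambda>t. a i * (h t * (cos (pi * t) ^ i * ?S 1 t)))" for i
      by (intro integrable_mult_right int_mult continuous_intros)
    have eq: "H t * p (cos (pi * t)) = (\<Sum>i\<le>n. a i * (h t * (cos (pi * t) ^ i * ?S 1 t)))" for t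
      by (simp add: p H_def sum_distrib_left mult_ac)
    show ?thesis
      unfolding eq Bochner_Integration.integral_sum[OF int]
      by (intro sum.neutral ballI) (simp only: integral_mult_right_zero trig mult_zero_right)
  qed
  have "AE t in unit_leb. H t = 0"
  proof (rule integral_zero_of_orthogonal_continuous[OF H])
    fix g :: "real \<Rightarrow> real" assume g: "continuous_on {0..1} g"
    have Hg: "integrable unit_leb (\<lambda>t. H t * g t)"
      unfolding H_def mult.assoc by (intro int_mult continuous_intros g)
    define G where "G x = g (arccos x / pi)" for x
    have Gc: "continuous_on {-1..1} G"
      unfolding G_def
    proof (rule continuous_on_compose2[OF g])
      show "continuous_on {-1..1} (\<lambda>x. arccos x / pi)"
        by (intro continuous_on_divide continuous_on_arccos' continuous_on_const) auto
      show "(\<lambda>x. arccos x / pi) ` {-1..1} \<subseteq> {0..1}"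
        by (auto simp: arccos_lbound arccos_ubound)
    qed
    have Gg: "G (cos (pi * t)) = g t" if "t \<in> {0..1}" for t
      using that by (simp add: G_def arccos_cos mult_left_le)
    define K where "K = (\<integral>t. \<bar>H t\<bar> \<partial>unit_leb)"
    have K: "K \<ge> 0" by (simp add: K_def)
    have "\<bar>\<integral>t. H t * g t \<partial>unit_leb\<bar> \<le> 0 + e" if e: "e > 0" for e
    proof -
      have "e / (K + 1) > 0" using e K by simp
      then obtain p where p: "real_polynomial_function p"
        "\<And>x. x \<in> {-1..1} \<Longrightarrow> \<bar>G x - p x\<bar> < e / (K + 1)"
        using Stone_Weierstrass_real_polynomial_function[OF compact_Icc Gc] by blast
      have "continuous_on UNIV p"
        using p(1) by (simp add: real_polynomial_function_eq continuous_on_polymonial_function)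
      then have pc: "continuous_on {0..1} (\<lambda>t. p (cos (pi * t)))"
        by (rule continuous_on_compose2) (auto intro!: continuous_intros)
      have Hp: "integrable unit_leb (\<lambda>t. H t * p (cos (pi * t)))"
        unfolding H_def mult.assoc by (intro int_mult continuous_intros pc)
      have "\<bar>\<integral>t. H t * g t \<partial>unit_leb\<bar> = \<bar>\<integral>t. H t * g t - H t * p (cos (pi * t)) \<partial>unit_leb\<bar>"
        using poly[OF p(1)] Hg Hp by simp
      also have "\<dots> \<le> (\<integral>t. \<bar>H t * g t - H t * p (cos (pi * t))\<bar> \<partial>unit_leb)"
        by (rule integral_abs_bound)
      also have "\<dots> \<le> (\<integral>t. \<bar>H t\<bar> * (e / (K + 1)) \<partial>unit_leb)"
      proof (rule integral_mono)
        fix t assume "t \<in> space unit_leb"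
        then have t: "t \<in> {0..1}" by simp
        have "\<bar>g t - p (cos (pi * t))\<bar> \<le> e / (K + 1)"
          using p(2)[of "cos (pi * t)"] Gg[OF t] by simp
        then have "\<bar>H t\<bar> * \<bar>g t - p (cos (pi * t))\<bar> \<le> \<bar>H t\<bar> * (e / (K + 1))"
          by (intro mult_left_mono) auto
        then show "\<bar>H t * g t - H t * p (cos (pi * t))\<bar> \<le> \<bar>H t\<bar> * (e / (K + 1))"
          by (simp add: abs_mult[symmetric] right_diff_distrib)
      qed (use Hg Hp H in auto)
      also have "\<dots> = K * (e / (K + 1))" by (simp add: K_def)
      also have "\<dots> \<le> e" using e K by (simp add: field_simps)
      finally show ?thesis by simp
    qed
    then have "\<bar>\<integral>t. H t * g t \<partial>unit_leb\<bar> \<le> 0" by (rule field_le_epsilon)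
    then show "(\<integral>t. H t * g t \<partial>unit_leb) = 0" by simp
  qed
  moreover have "AE t in unit_leb. t \<noteq> 0 \<and> t \<noteq> 1"
    using AE_lborel_singleton[of 0] AE_lborel_singleton[of "1::real"]
    by (subst AE_restrict_space_iff) auto
  moreover have "AE t in unit_leb. t \<in> {0..1}" by (rule AE_I2) simp
  ultimately show ?thesis
  proof eventually_elim
    case (elim t)
    then have "sin (pi * t) > 0" by (intro sin_gt_zero) auto
    then show ?case using elim(1) by (simp add: H_def)
  qed
qed

section \<open>Measurability of path functionals on the Skorohod space\<close>

lemma dist_D01_less: "dist x y < c \<Longrightarrow> \<exists>r<c. skorohod_close r x y"
  using cInf_lessD[of "{r. skorohod_close r x y}" c] skorohod_close_exists[of x y]
  unfolding dist_D01_def by blast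

lemma dist_D01_le: "skorohod_close r x y \<Longrightarrow> dist x y \<le> r"
  unfolding dist_D01_def using skorohod_close_nonneg
  by (intro cInf_lower) (auto intro!: bdd_belowI[of _ 0])

text \<open>
  Point evaluation is not Skorohod continuous, but exceeding a level somewhere in an open time interval is
  an open property: a nearby path exceeds it at a slightly shifted time in the same interval.
\<close>
lemma open_path_exceeds_on:
  "open {x. \<exists>s\<in>{a<..<b} \<inter> {0..1}. c < path x s}"
  unfolding open_dist
proof (intro ballI)
  fix x assume "x \<in> {x. \<exists>s\<in>{a<..<b} \<inter> {0..1}. c < path x s}"
  then obtain s where s: "s \<in> {a<..<b}" "s \<in> {0..1}" "c < path x s" by blast
  define e where "e = min (path x s - c) (min (s - a) (b - s))"
  have e: "e > 0" using s by (simp add: e_def)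
  have "y \<in> {x. \<exists>s\<in>{a<..<b} \<inter> {0..1}. c < path x s}" if "dist y x < e" for y
  proof -
    have "dist x y < e" using that by (simp add: dist_commute)
    then obtain r where r: "r < e" "skorohod_close r x y"
      using dist_D01_less by blast
    then obtain l where l: "time_change l" "\<bar>l s - s\<bar> \<le> r" "\<bar>path x s - path y (l s)\<bar> \<le> r"
      using s(2) unfolding skorohod_close_def by blast
    have "l s \<in> {a<..<b} \<inter> {0..1}"
      using l(2) r(1) time_change_in[OF l(1) s(2)] by (auto simp: e_def)
    moreover have "c < path y (l s)" using l(3) r(1) by (auto simp: e_def)
    ultimately show ?thesis by blast
  qed
  then show "\<exists>e>0. \<forall>y. dist y x < e \<longrightarrow> y \<in> {x. \<exists>s\<in>{a<..<b} \<inter> {0..1}. c < path x s}"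
    using e by blast
qed

lemma time_change_one: "time_change l \<Longrightarrow> l 1 = 1"
proof -
  assume l: "time_change l"
  have "1 \<in> l ` {0..1}" using l by (simp add: time_change_def)
  then obtain s where s: "1 = l s" "s \<in> {0..1}" by (rule imageE)
  have "l 1 \<in> {0..1}" by (rule time_change_in[OF l]) simp
  moreover have "s < 1 \<Longrightarrow> l s < l 1"
    using l s(2) strict_mono_onD[of "{0..1}" l s 1] by (simp add: time_change_def)
  ultimately have "\<not> s < 1" using s by auto
  then show ?thesis using s by simp
qed

text \<open>
  There is no time to the right of \<open>1\<close>, but time changes fix \<open>1\<close>.
\<close>
lemma open_path_one_exceeds: "open {x. c < path x 1}"
  unfolding open_dist
proof (intro ballI)
  fix x assume "x \<in> {x. c < path x 1}"
  then have c: "c < path x 1" by simp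
  have "y \<in> {x. c < path x 1}" if d: "dist y x < path x 1 - c" for y
  proof -
    have "dist x y < path x 1 - c" using d by (simp add: dist_commute)
    then obtain r where r: "r < path x 1 - c" "skorohod_close r x y"
      using dist_D01_less by blast
    then obtain l where l: "time_change l" "\<bar>path x 1 - path y (l 1)\<bar> \<le> r"
      unfolding skorohod_close_def by (meson atLeastAtMost_iff order.refl zero_le_one)
    then show ?thesis using r(1) time_change_one[OF l(1)] by auto
  qed
  then show "\<exists>e>0. \<forall>y. dist y x < e \<longrightarrow> y \<in> {x. c < path x 1}"
    using c by (intro exI[of _ "path x 1 - c"]) auto
qed

text \<open>
  Right continuity recovers the value at \<open>t\<close> from the suprema over short intervals to the right of \<open>t\<close>.
\<close>
lemma path_eval_less_iff:
  assumes t: "t \<in> {0..<1}"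
  shows "path x t < c \<longleftrightarrow> (\<exists>k m. \<not> (\<exists>s\<in>{t<..<t + inverse (real (Suc k))} \<inter> {0..1}.
    c - inverse (real (Suc m)) < path x s))"
proof
  have lim: "(path x \<longlongrightarrow> path x t) (at_right t)"
    using cadlag_path[of x] t by (simp add: cadlag_unit_def)
  {
    assume "path x t < c"
    then obtain m where m: "inverse (real (Suc m)) < c - path x t"
      using reals_Archimedean[of "c - path x t"] by auto
    then have "path x t < c - inverse (real (Suc m))" by simp
    then have "eventually (\<lambda>s. path x s < c - inverse (real (Suc m))) (at_right t)"
      by (rule order_tendstoD(2)[OF lim])
    then obtain b where b: "b > t" "\<And>s. t < s \<Longrightarrow> s < b \<Longrightarrow> path x s < c - inverse (real (Suc m))"
      by (auto simp: eventually_at_right_field)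
    obtain k where k: "inverse (real (Suc k)) < b - t"
      using reals_Archimedean[of "b - t"] b(1) by auto
    have "\<not> c - inverse (real (Suc m)) < path x s"
      if "s \<in> {t<..<t + inverse (real (Suc k))} \<inter> {0..1}" for s
    proof -
      have "t < s" "s < b" using that k by auto
      then show ?thesis using b(2)[of s] by simp
    qed
    then show "\<exists>k m. \<not> (\<exists>s\<in>{t<..<t + inverse (real (Suc k))} \<inter> {0..1}.
      c - inverse (real (Suc m)) < path x s)" by blast
  }
  {
    assume "\<exists>k m. \<not> (\<exists>s\<in>{t<..<t + inverse (real (Suc k))} \<inter> {0..1}.
      c - inverse (real (Suc m)) < path x s)"
    then obtain k m where km: "\<And>s. s \<in> {t<..<t + inverse (real (Suc k))} \<inter> {0..1} \<Longrightarrow>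
      path x s \<le> c - inverse (real (Suc m))" by (meson not_le)
    have "eventually (\<lambda>s. s \<in> {t<..<min 1 (t + inverse (real (Suc k)))}) (at_right t)"
      by (rule eventually_at_right_real) (use t in auto)
    then have "eventually (\<lambda>s. path x s \<le> c - inverse (real (Suc m))) (at_right t)"
      by eventually_elim (rule km, use t in auto)
    then have "path x t \<le> c - inverse (real (Suc m))"
      by (intro tendsto_upperbound[OF lim]) auto
    then show "path x t < c" by (smt (verit) inverse_positive_iff_positive of_nat_0_less_iff zero_less_Suc)
  }
qed

lemma measurable_path_eval: "(\<lambda>x. path x t) \<in> borel_measurable borel"
proof -
  consider "t \<in> {0..<1}" | "t = 1" | "t \<notin> {0..1}" by fastforce
  then show ?thesis
  proof cases
    case 1
    show ?thesis
    proof (rule borel_measurableI_less)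
      fix c :: real
      let ?G = "\<lambda>k m. {x. \<exists>s\<in>{t<..<t + inverse (real (Suc k))} \<inter> {0..1}.
          c - inverse (real (Suc m)) < path x s}"
      have "{x \<in> space borel. path x t < c} = (\<Union>k m. - ?G k m)"
        unfolding path_eval_less_iff[OF 1] by (simp only: space_borel) blast
      moreover have "?G k m \<in> sets borel" for k m
        by (rule borel_open, rule open_path_exceeds_on)
      ultimately show "{x \<in> space borel. path x t < c} \<in> sets borel"
        by (simp only:) (intro sets.countable_UN'' countableI_type borel_comp ballI)
    qed
  next
    case 2
    show ?thesis
      by (rule borel_measurableI_greater) (simp add: 2 open_path_one_exceeds)
  next
    case 3
    then have "(\<lambda>x. path x t) = (\<lambda>x. undefined)"
      using path_ext by (auto simp: extensional_def fun_eq_iff)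
    then show ?thesis by simp
  qed
qed

text \<open>
  The path is the limit of its values at grid points that approach \<open>t\<close> strictly from the right; for each
  grid only countably many evaluations are involved. Capping the grid at \<open>1\<close> handles the end point.
\<close>
lemma measurable_path_joint:
  "(\<lambda>(x, t). path x t) \<in> borel_measurable (borel \<Otimes>\<^sub>M unit_leb)"
proof -
  define g :: "nat \<Rightarrow> int \<Rightarrow> real" where
    "g N i = min 1 ((of_int i + 1) / real (Suc N))" for N i
  define u where "u N z = path (fst z) (g N \<lfloor>real (Suc N) * snd z\<rfloor>)" for N and z :: "D01 \<times> real"
  have u: "u N \<in> borel_measurable (borel \<Otimes>\<^sub>M unit_leb)" for N
    unfolding u_def
  proof (rule measurable_compose_countable)
    show "(\<lambda>z. path (fst z) (g N i)) \<in> borel_measurable (borel \<Otimes>\<^sub>M unit_leb)" for i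
      by (rule measurable_compose[OF measurable_fst measurable_path_eval])
    have "snd \<in> borel_measurable (borel \<Otimes>\<^sub>M unit_leb)"
      by (rule measurable_compose[OF measurable_snd measurable_restrict_space1]) simp
    then have "(\<lambda>z. real (Suc N) * snd z) \<in> borel_measurable (borel \<Otimes>\<^sub>M unit_leb)"
      by (intro borel_measurable_times borel_measurable_const)
    then show "(\<lambda>z. \<lfloor>real (Suc N) * snd z\<rfloor>) \<in> borel \<Otimes>\<^sub>M unit_leb \<rightarrow>\<^sub>M count_space UNIV"
      by (rule measurable_compose[OF _ measurable_real_floor])
  qed
  have lim: "(\<lambda>N. u N z) \<longlonglongrightarrow> path (fst z) (snd z)" if "z \<in> space (borel \<Otimes>\<^sub>M unit_leb)" for z
  proof -
    define t where "t = snd z"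
    have t: "t \<in> {0..1}" using that by (auto simp: space_pair_measure space_restrict_space t_def)
    define h where "h N = g N \<lfloor>real (Suc N) * t\<rfloor>" for N
    show ?thesis
    proof (cases "t = 1")
      case True
      have "h N = 1" for N
      proof -
        have "\<lfloor>real (Suc N) * t\<rfloor> = int (Suc N)" using True by (simp only: mult_1_right floor_of_nat)
        then show ?thesis by (simp add: h_def g_def)
      qed
      then show ?thesis by (simp add: u_def True h_def flip: t_def)
    next
      case False
      have lo: "t < h N" for N
      proof -
        have "real (Suc N) * t < of_int \<lfloor>real (Suc N) * t\<rfloor> + 1" by linarith
        then have "t < (of_int \<lfloor>real (Suc N) * t\<rfloor> + 1) / real (Suc N)"
          by (simp add: field_simps)
        then show ?thesis using t False by (simp add: h_def g_def)
      qed
      have up: "h N \<le> t + inverse (real (Suc N))" for N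
      proof -
        have "of_int \<lfloor>real (Suc N) * t\<rfloor> \<le> real (Suc N) * t" by linarith
        then have "of_int \<lfloor>real (Suc N) * t\<rfloor> / real (Suc N) \<le> t"
          by (subst pos_divide_le_eq) (auto simp: mult.commute)
        then have "(of_int \<lfloor>real (Suc N) * t\<rfloor> + 1) / real (Suc N) \<le> t + inverse (real (Suc N))"
          by (simp only: add_divide_distrib inverse_eq_divide)
        then show ?thesis by (simp add: h_def g_def min_le_iff_disj)
      qed
      have "(\<lambda>N. t + inverse (real (Suc N))) \<longlonglongrightarrow> t + 0"
        by (intro tendsto_add tendsto_const LIMSEQ_inverse_real_of_nat)
      then have "h \<longlonglongrightarrow> t"
        by (intro tendsto_sandwich[of "\<lambda>_. t" h sequentially])
           (use up less_imp_le[OF lo] in simp_all)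
      then have "filterlim h (at_right t) sequentially"
        by (rule tendsto_imp_filterlim_at_right) (simp add: lo)
      moreover have "(path (fst z) \<longlongrightarrow> path (fst z) t) (at_right t)"
        using cadlag_path[of "fst z"] t False by (simp add: cadlag_unit_def)
      ultimately have "(\<lambda>N. path (fst z) (h N)) \<longlonglongrightarrow> path (fst z) t"
        by (rule filterlim_compose[rotated])
      then show ?thesis by (simp add: u_def h_def t_def)
    qed
  qed
  have "(\<lambda>z. path (fst z) (snd z)) \<in> borel_measurable (borel \<Otimes>\<^sub>M unit_leb)"
    by (rule borel_measurable_LIMSEQ_real[OF lim u])
  then show ?thesis by (simp add: case_prod_beta')
qed

lemma measurable_path: "path x \<in> borel_measurable unit_leb"
  using measurable_compose[OF measurable_Pair1' measurable_path_joint, of x] by simp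

section \<open>The logistic distribution\<close>

definition logistic_cdf :: "real \<Rightarrow> real" where
  "logistic_cdf y = inverse (1 + exp (- y))"

definition logistic_pdf :: "real \<Rightarrow> real" where
  "logistic_pdf y = logistic_cdf y * (1 - logistic_cdf y)"

lemma exp_plus_one_pos: "1 + exp (y::real) > 0"
  by (simp add: add_pos_pos)

lemma logistic_cdf_bounds: "0 < logistic_cdf y" "logistic_cdf y < 1"
  unfolding logistic_cdf_def
  using exp_plus_one_pos[of "- y"] by (simp_all add: field_simps)

lemma logistic_pdf_pos: "0 < logistic_pdf y"
  unfolding logistic_pdf_def using logistic_cdf_bounds[of y] by simp

lemma logistic_cdf_deriv: "(logistic_cdf has_real_derivative logistic_pdf y) (at y)"
proof -
  have *: "1 + exp (- y) \<noteq> 0" using exp_plus_one_pos[of "- y"] by linarith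
  have "(logistic_cdf has_real_derivative - (- exp (- y) * inverse ((1 + exp (- y))^2))) (at y)"
    unfolding logistic_cdf_def [abs_def]
    by (rule derivative_eq_intros refl *)+ (simp add: power2_eq_square)
  also have "- (- exp (- y) * inverse ((1 + exp (- y))^2)) = logistic_pdf y"
    using * by (simp add: logistic_pdf_def logistic_cdf_def field_simps power2_eq_square)
  finally show ?thesis .
qed

lemma logistic_pdf_deriv:
  "(logistic_pdf has_real_derivative logistic_pdf y * (1 - 2 * logistic_cdf y)) (at y)"
proof -
  have "((\<lambda>y. logistic_cdf y * (1 - logistic_cdf y)) has_real_derivative
      logistic_cdf y * (0 - logistic_pdf y) + logistic_pdf y * (1 - logistic_cdf y)) (at y)"
    by (rule derivative_eq_intros logistic_cdf_deriv refl)+ simp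
  then show ?thesis
    by (simp add: logistic_pdf_def[abs_def] algebra_simps)
qed

lemma continuous_logistic_pdf: "continuous_on A logistic_pdf"
  by (intro continuous_at_imp_continuous_on ballI DERIV_isCont[OF logistic_pdf_deriv])

lemma continuous_logistic_cdf: "continuous_on A logistic_cdf"
  by (intro continuous_at_imp_continuous_on ballI DERIV_isCont[OF logistic_cdf_deriv])

lemma measurable_logistic_pdf [measurable]: "logistic_pdf \<in> borel_measurable borel"
  by (rule borel_measurable_continuous_onI) (rule continuous_logistic_pdf)

lemma logistic_pdf_le_1: "logistic_pdf y \<le> 1"
  unfolding logistic_pdf_def using logistic_cdf_bounds[of y] by (intro mult_le_one) auto

lemma logistic_pdf_deriv_le_1: "\<bar>logistic_pdf y * (1 - 2 * logistic_cdf y)\<bar> \<le> 1"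
  unfolding abs_mult
  by (intro mult_le_one) (use logistic_pdf_le_1[of y] logistic_pdf_pos[of y] logistic_cdf_bounds[of y] in auto)

lemma logistic_pdf_alt: "logistic_pdf y = inverse ((exp (y/2) + exp (- (y/2)))\<^sup>2)"
proof -
  have 1: "exp y = exp (y/2) ^ 2" "exp (- y) = exp (- (y/2)) ^ 2"
    using exp_add[of "y/2" "y/2"] exp_add[of "-(y/2)" "-(y/2)"] by (simp_all add: power2_eq_square)
  have 2: "exp (- (y/2)) * exp (y/2) = 1" using exp_add[of "-(y/2)" "y/2"] by simp
  have "exp (- y) * (exp (y/2) + exp (- (y/2)))\<^sup>2 = (1 + exp (- y))\<^sup>2"
    unfolding 1 using 2 by algebra
  moreover have "logistic_pdf y = exp (- y) / (1 + exp (- y))\<^sup>2"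
    using exp_plus_one_pos[of "- y"] by (simp add: logistic_pdf_def logistic_cdf_def field_simps power2_eq_square)
  moreover have "exp (y/2) + exp (- (y/2)) > 0" by (simp add: add_pos_pos)
  ultimately show ?thesis
    by (metis exp_not_eq_zero inverse_eq_divide nonzero_divide_mult_cancel_left)
qed

lemma logistic_pdf_minus: "logistic_pdf (- y) = logistic_pdf y"
  by (simp add: logistic_pdf_alt add.commute)

text \<open>
  The density is \<open>(exp (y/2) + exp (- y/2)) powr -2\<close>, and a shift by \<open>d\<close> changes each exponential by a
  factor of at most \<open>exp (d/2)\<close>: the logarithm of the density is \<open>1\<close>-Lipschitz.
\<close>
lemma logistic_pdf_shift_le: "logistic_pdf y \<le> exp \<bar>y - z\<bar> * logistic_pdf z"
proof -
  define d where "d = \<bar>y - z\<bar>"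
  define A where "A = (\<lambda>y::real. exp (y/2) + exp (- (y/2)))"
  have pos: "A y > 0" for y by (simp add: A_def add_pos_pos)
  have ab: "z / 2 \<le> d / 2 + y / 2" "- (z / 2) \<le> d / 2 + - (y / 2)"
    by (auto simp: d_def abs_if field_simps)
  have "exp (z/2) \<le> exp (d/2 + y/2)" "exp (- (z/2)) \<le> exp (d/2 + - (y/2))"
    unfolding exp_le_cancel_iff using ab by simp_all
  then have "A z \<le> exp (d/2) * A y"
    unfolding A_def exp_add distrib_left by (rule add_mono)
  then have "(A z)\<^sup>2 \<le> (exp (d/2) * A y)\<^sup>2"
    using pos[of z] by (intro power_mono) auto
  also have "\<dots> = exp d * (A y)\<^sup>2"
    using exp_add[of "d/2" "d/2"] by (simp add: power2_eq_square)
  finally have "inverse ((A y)\<^sup>2) \<le> exp d * inverse ((A z)\<^sup>2)"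
    using pos[of z] pos[of y] by (simp add: field_simps)
  then show ?thesis by (simp add: logistic_pdf_alt A_def d_def)
qed

lemma logistic_cdf_minus: "logistic_cdf (- y) = 1 - logistic_cdf y"
proof -
  have "(1 + exp y) * (1 + exp (- y)) = (1 + exp y) + (1 + exp (- y))"
    using exp_add[of y "- y"] by (simp add: distrib_left distrib_right)
  then show ?thesis
    using exp_plus_one_pos[of y] exp_plus_one_pos[of "- y"]
    by (simp add: logistic_cdf_def field_simps)
qed

lemma logistic_cdf_at_top: "(logistic_cdf \<longlongrightarrow> 1) at_top"
proof -
  have "((\<lambda>y::real. exp (- y)) \<longlongrightarrow> 0) at_top"
    by (rule filterlim_compose[OF exp_at_bot filterlim_uminus_at_bot_at_top])
  from tendsto_inverse[OF tendsto_add[OF tendsto_const[of 1] this]]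
  have "((\<lambda>y::real. inverse (1 + exp (- y))) \<longlongrightarrow> inverse (1 + 0)) at_top"
    by simp
  then show ?thesis by (simp add: logistic_cdf_def[abs_def])
qed

definition logistic_dist :: "real \<Rightarrow> real measure" where
  "logistic_dist h = density lborel (\<lambda>y. ennreal (logistic_pdf (y - h)))"

lemma sets_logistic_dist [simp]: "sets (logistic_dist h) = sets borel"
  and space_logistic_dist [simp]: "space (logistic_dist h) = UNIV"
  by (simp_all add: logistic_dist_def)

text \<open>
  The reflection \<open>y \<mapsto> - y\<close>, which preserves the density, turns the half-line into an upper one, over which
  the integral is the increment of the distribution function up to its limit at infinity.
\<close>
lemma emeasure_logistic_dist_atMost:
  "emeasure (logistic_dist h) {..a} = ennreal (logistic_cdf (a - h))"
proof -
  have "emeasure (logistic_dist h) {..a}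
      = (\<integral>\<^sup>+y. ennreal (logistic_pdf (y - h)) * indicator {..a} y \<partial>lborel)"
    by (simp add: logistic_dist_def emeasure_density)
  also have "\<dots> = (\<integral>\<^sup>+y. ennreal (logistic_pdf (0 + (-1) * y - h)) * indicator {..a} (0 + (-1) * y) \<partial>lborel)"
    by (subst nn_integral_real_affine[of _ "-1" 0]) auto
  also have "\<dots> = (\<integral>\<^sup>+y. ennreal (logistic_pdf (y + h)) * indicator {- a..} y \<partial>lborel)"
  proof (rule nn_integral_cong)
    fix y :: real
    have "logistic_pdf (0 + (-1) * y - h) = logistic_pdf (y + h)"
      using logistic_pdf_minus[of "y + h"] by simp
    then show "ennreal (logistic_pdf (0 + (-1) * y - h)) * indicator {..a} (0 + (-1) * y)
        = ennreal (logistic_pdf (y + h)) * indicator {- a..} y"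
      by (auto simp: indicator_def)
  qed
  also have "\<dots> = ennreal (1 - logistic_cdf (- a + h))"
  proof (rule nn_integral_FTC_atLeast)
    show "(\<lambda>y. logistic_pdf (y + h)) \<in> borel_measurable borel" by simp
    show "((\<lambda>y. logistic_cdf (y + h)) has_real_derivative logistic_pdf (y + h)) (at y)" for y
      using logistic_cdf_deriv[of "y + h"] by (simp add: DERIV_shift)
    show "0 \<le> logistic_pdf (y + h)" for y using logistic_pdf_pos[of "y + h"] by simp
    show "((\<lambda>y. logistic_cdf (y + h)) \<longlongrightarrow> 1) at_top"
      using filterlim_compose[OF logistic_cdf_at_top
          filterlim_tendsto_add_at_top[OF tendsto_const[of h] filterlim_ident]]
      by (simp add: add.commute)
  qed
  also have "1 - logistic_cdf (- a + h) = logistic_cdf (a - h)"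
    using logistic_cdf_minus[of "a - h"] by simp
  finally show ?thesis .
qed

lemma prob_space_logistic_dist: "prob_space (logistic_dist h)"
proof (rule prob_spaceI)
  have "(\<lambda>n. emeasure (logistic_dist h) {..real n}) \<longlonglongrightarrow> emeasure (logistic_dist h) (\<Union>n. {..real n})"
    by (rule Lim_emeasure_incseq) (auto simp: incseq_def)
  moreover have "(\<Union>n. {..real n}) = UNIV" using real_arch_simple by auto
  moreover have "(\<lambda>n. emeasure (logistic_dist h) {..real n}) \<longlonglongrightarrow> ennreal 1"
    unfolding emeasure_logistic_dist_atMost
  proof (rule tendsto_ennrealI, rule filterlim_compose[OF logistic_cdf_at_top])
    show "filterlim (\<lambda>n. real n - h) at_top sequentially"
      using filterlim_tendsto_add_at_top[OF tendsto_const[of "- h"] filterlim_real_sequentially] by simp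
  qed
  ultimately show "emeasure (logistic_dist h) (space (logistic_dist h)) = 1"
    using LIMSEQ_unique by (metis ennreal_1 space_logistic_dist)
qed

lemma nn_integral_logistic_pdf: "(\<integral>\<^sup>+y. ennreal (logistic_pdf (y - h)) \<partial>lborel) = 1"
proof -
  interpret prob_space "logistic_dist h" by (rule prob_space_logistic_dist)
  show ?thesis using emeasure_space_1 by (simp add: logistic_dist_def emeasure_density)
qed

lemma cdf_logistic_dist: "cdf (logistic_dist h) y = logistic_cdf (y - h)"
  unfolding cdf_def measure_def emeasure_logistic_dist_atMost
  using logistic_cdf_bounds(1)[of "y - h"] by simp

lemma logistic_cdf_ge_iff:
  assumes "0 < u" "u < 1"
  shows "u \<le> logistic_cdf z \<longleftrightarrow> ln (u / (1 - u)) \<le> z"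
proof -
  have "u \<le> logistic_cdf z \<longleftrightarrow> u * (1 + exp (- z)) \<le> 1"
    using exp_plus_one_pos[of "- z"] by (simp add: logistic_cdf_def field_simps)
  also have "\<dots> \<longleftrightarrow> u / (1 - u) \<le> exp z"
    using assms by (simp add: exp_minus field_simps)
  also have "\<dots> \<longleftrightarrow> ln (u / (1 - u)) \<le> z"
    using assms ln_le_cancel_iff[of "u / (1 - u)" "exp z"] by simp
  finally show ?thesis .
qed

lemma quantile_logistic_dist:
  assumes "0 < u" "u < 1"
  shows "quantile (logistic_dist h) u = ln (u / (1 - u)) + h"
proof -
  have "{y. u \<le> cdf (logistic_dist h) y} = {ln (u / (1 - u)) + h..}"
    using logistic_cdf_ge_iff[OF assms] by (auto simp: cdf_logistic_dist le_diff_eq)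
  then show ?thesis by (simp add: quantile_def)
qed

lemma logistic_pdf_quantile:
  assumes "0 < u" "u < 1"
  shows "logistic_pdf (ln (u / (1 - u))) = u * (1 - u)"
proof -
  have "logistic_cdf (ln (u / (1 - u))) = u"
    using assms by (simp add: logistic_cdf_def exp_minus field_simps)
  then show ?thesis by (simp add: logistic_pdf_def)
qed

text \<open>
  With the likelihood ratio \<open>r\<close> of the two shifts, \<open>r\<^sup>2 + 1 = 2 r + (r - 1)\<^sup>2\<close>, and \<open>r\<close> lies between
  \<open>exp (- d)\<close> and \<open>exp d\<close> where \<open>d = |a - b| \<le> 1\<close>, so that \<open>|r - 1| \<le> 2 d\<close>.
\<close>
lemma logistic_chi_square_bound:
  assumes "\<bar>a - b\<bar> \<le> 1"
  shows "(\<integral>\<^sup>+y. ennreal ((logistic_pdf (y - b))\<^sup>2 / logistic_pdf (y - a)) \<partial>lborel)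
    \<le> ennreal (1 + 4 * (a - b)\<^sup>2)"
proof -
  define d where "d = \<bar>a - b\<bar>"
  have d: "0 \<le> d" "d \<le> 1" using assms by (auto simp: d_def)
  have exp_d: "exp d - 1 \<le> 2 * d" using exp_bound[OF d] d
    by (smt (verit) mult_left_le power2_eq_square)
  let ?f = "\<lambda>y. logistic_pdf (y - a)" and ?g = "\<lambda>y. logistic_pdf (y - b)"
  have pointwise: "(?g y)\<^sup>2 / ?f y + ?f y \<le> 2 * ?g y + 4 * d\<^sup>2 * ?f y" for y
  proof -
    define r where "r = ?g y / ?f y"
    have f: "?f y > 0" and g: "?g y > 0" by (rule logistic_pdf_pos)+
    have gr: "?g y = r * ?f y" using f by (simp add: r_def)
    have r: "r > 0" using f g by (simp add: r_def)
    have 1: "r \<le> exp d"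
      using logistic_pdf_shift_le[of "y - b" "y - a"] f
      by (simp add: r_def d_def divide_le_eq abs_minus_commute)
    have "?f y \<le> exp d * ?g y"
      using logistic_pdf_shift_le[of "y - a" "y - b"] by (simp add: d_def abs_minus_commute)
    then have "1 \<le> exp d * r" using f by (simp add: gr)
    then have 2: "1 - r \<le> (exp d - 1) * r" by (simp add: algebra_simps)
    have "\<bar>r - 1\<bar> \<le> 2 * d"
    proof (cases "r \<ge> 1")
      case True
      then show ?thesis using 1 exp_d by linarith
    next
      case False
      then have "(exp d - 1) * r \<le> (exp d - 1) * 1"
        using d by (intro mult_left_mono) auto
      then have "1 - r \<le> exp d - 1" using 2 by simp
      then show ?thesis using exp_d False by simp
    qed
    then have "(r - 1)\<^sup>2 \<le> (2 * d)\<^sup>2"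
      using power_mono[of "\<bar>r - 1\<bar>" "2 * d" 2] by simp
    then have "r\<^sup>2 + 1 \<le> 2 * r + 4 * d\<^sup>2" by (simp add: power2_eq_square algebra_simps)
    then have "(r\<^sup>2 + 1) * ?f y \<le> (2 * r + 4 * d\<^sup>2) * ?f y" using f by (intro mult_right_mono) auto
    moreover have "(?g y)\<^sup>2 / ?f y = r\<^sup>2 * ?f y" using f by (simp add: gr power2_eq_square)
    ultimately show ?thesis unfolding gr by (simp add: algebra_simps)
  qed
  let ?I = "\<integral>\<^sup>+y. ennreal ((?g y)\<^sup>2 / ?f y) \<partial>lborel"
  have pos: "0 \<le> ?f y" "0 \<le> ?g y" for y using logistic_pdf_pos less_imp_le by auto
  have "?I + 1 = (\<integral>\<^sup>+y. ennreal ((?g y)\<^sup>2 / ?f y) + ennreal (?f y) \<partial>lborel)"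
    by (subst nn_integral_add) (auto simp: nn_integral_logistic_pdf)
  also have "\<dots> \<le> (\<integral>\<^sup>+y. ennreal 2 * ennreal (?g y) + ennreal (4 * d\<^sup>2) * ennreal (?f y) \<partial>lborel)"
  proof (rule nn_integral_mono)
    fix y
    have "ennreal ((?g y)\<^sup>2 / ?f y) + ennreal (?f y) = ennreal ((?g y)\<^sup>2 / ?f y + ?f y)"
      using pos by (intro ennreal_plus[symmetric]) auto
    also have "\<dots> \<le> ennreal (2 * ?g y + 4 * d\<^sup>2 * ?f y)" by (rule ennreal_leI[OF pointwise])
    also have "\<dots> = ennreal 2 * ennreal (?g y) + ennreal (4 * d\<^sup>2) * ennreal (?f y)"
      using pos by (subst ennreal_plus) (auto simp: ennreal_mult)
    finally show "ennreal ((?g y)\<^sup>2 / ?f y) + ennreal (?f y) \<le> ennreal 2 * ennreal (?g y) + ennreal (4 * d\<^sup>2) * ennreal (?f y)" .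
  qed
  also have "\<dots> = ennreal 2 * (\<integral>\<^sup>+y. ennreal (?g y) \<partial>lborel) + ennreal (4 * d\<^sup>2) * (\<integral>\<^sup>+y. ennreal (?f y) \<partial>lborel)"
    by (simp add: nn_integral_add nn_integral_cmult)
  also have "\<dots> = ennreal (1 + 4 * d\<^sup>2) + 1"
    unfolding nn_integral_logistic_pdf mult_1_right
    by (subst ennreal_1[symmetric], subst (1 2) ennreal_plus[symmetric]) auto
  finally have "?I \<le> ennreal (1 + 4 * d\<^sup>2)" by (simp add: add.commute)
  then show ?thesis by (simp add: d_def)
qed

section \<open>Uniqueness of the conditional distribution\<close>

lemma sets_law_X [simp]: "sets (law_X F) = sets borel"
  and space_law_X [simp]: "space (law_X F) = UNIV"
  unfolding law_X_def by simp_all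

lemma regular_cond_dist_measurable:
  assumes "regular_cond_dist F \<mu>" "A \<in> sets borel"
  shows "(\<lambda>x. emeasure (\<mu> x) A) \<in> borel_measurable borel"
proof -
  have "\<mu> \<in> borel \<rightarrow>\<^sub>M subprob_algebra borel"
    using assms(1) by (auto simp: regular_cond_dist_def intro: measurable_prob_algebraD)
  then show ?thesis
    by (rule measurable_compose[OF _ measurable_emeasure_subprob_algebra[OF assms(2)]])
qed

lemma cdf_le_of_rational:
  assumes "real_distribution M" "real_distribution N"
    and eq: "\<And>q :: rat. cdf M (of_rat q) = cdf N (of_rat q)"
  shows "cdf M y \<le> cdf N y"
proof -
  interpret M: real_distribution M by fact
  interpret N: real_distribution N by fact
  have "(cdf N \<longlongrightarrow> cdf N y) (at_right y)"
    using N.cdf_is_right_cont[of y] by (simp add: continuous_within)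
  moreover have "cdf M y \<le> cdf N z" if z: "y < z" for z
  proof -
    obtain q where q: "y < of_rat q" "of_rat q < z" using of_rat_dense[OF z] by blast
    have "cdf M y \<le> cdf M (of_rat q)" using q by (intro M.cdf_nondecreasing) simp
    also have "\<dots> \<le> cdf N z" unfolding eq using q by (intro N.cdf_nondecreasing) simp
    finally show ?thesis .
  qed
  then have "eventually (\<lambda>z. cdf M y \<le> cdf N z) (at_right y)"
    by (simp add: eventually_at_filter)
  ultimately show ?thesis by (intro tendsto_lowerbound) auto
qed

lemma real_distribution_eqI_rational_cdf:
  assumes "real_distribution M" "real_distribution N"
    and eq: "\<And>q :: rat. cdf M (of_rat q) = cdf N (of_rat q)"
  shows "M = N"
proof (rule cdf_unique[OF assms(1,2)])
  show "cdf M = cdf N"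
    using cdf_le_of_rational[OF assms(1,2) eq] cdf_le_of_rational[OF assms(2,1) eq[symmetric]]
    by (auto simp: fun_eq_iff intro!: antisym)
qed

text \<open>
  For each fixed event two versions have the same integrals over all Borel sets, so they agree almost
  everywhere. Countably many events suffice to determine a distribution on the line: the half-lines
  with rational end points.
\<close>
lemma regular_cond_dist_unique:
  assumes F: "prob_space F" "sets F = sets obs"
    and \<mu>: "regular_cond_dist F \<mu>" and \<nu>: "regular_cond_dist F \<nu>"
  shows "AE x in law_X F. \<mu> x = \<nu> x"
proof -
  have "snd \<in> F \<rightarrow>\<^sub>M borel"
    using measurable_snd[of borel borel] measurable_cong_sets[OF F(2) refl] by blast
  then interpret P: prob_space "law_X F"
    unfolding law_X_def by (rule prob_space.prob_space_distr[OF F(1)])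
  have em: "AE x in law_X F. emeasure (\<mu> x) A = emeasure (\<nu> x) A" if A: "A \<in> sets borel" for A
  proof -
    have m: "(\<lambda>x. emeasure (\<mu> x) A) \<in> borel_measurable (law_X F)"
      "(\<lambda>x. emeasure (\<nu> x) A) \<in> borel_measurable (law_X F)"
      using regular_cond_dist_measurable[OF \<mu> A] regular_cond_dist_measurable[OF \<nu> A]
      by (simp_all add: measurable_def)
    have "density (law_X F) (\<lambda>x. emeasure (\<mu> x) A) = density (law_X F) (\<lambda>x. emeasure (\<nu> x) A)"
    proof (rule measure_eqI)
      fix B assume "B \<in> sets (density (law_X F) (\<lambda>x. emeasure (\<mu> x) A))"
      then have B: "B \<in> sets borel" "B \<in> sets (law_X F)" by simp_all
      show "emeasure (density (law_X F) (\<lambda>x. emeasure (\<mu> x) A)) B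
        = emeasure (density (law_X F) (\<lambda>x. emeasure (\<nu> x) A)) B"
        using \<mu> \<nu> A B(1) unfolding emeasure_density[OF m(1) B(2)] emeasure_density[OF m(2) B(2)]
        by (metis regular_cond_dist_def)
    qed simp
    then show ?thesis by (simp only: P.density_unique_iff[OF m])
  qed
  have "AE x in law_X F. \<forall>q::rat. emeasure (\<mu> x) {..of_rat q} = emeasure (\<nu> x) {..of_rat q}"
    unfolding AE_all_countable using em by simp
  then show ?thesis
  proof eventually_elim
    case (elim x)
    have "real_distribution (\<mu> x)" "real_distribution (\<nu> x)"
      using measurable_space[of \<mu> borel "prob_algebra borel" x]
        measurable_space[of \<nu> borel "prob_algebra borel" x] \<mu> \<nu>
      unfolding regular_cond_dist_def space_prob_algebra
      by (auto intro!: real_distribution.intro real_distribution_axioms.intro dest: sets_eq_imp_space_eq)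
    then show ?case
      by (rule real_distribution_eqI_rational_cdf) (use elim in \<open>simp add: cdf_def measure_def\<close>)
  qed
qed

lemma cond_quantile_eq_AE:
  assumes F: "prob_space F" "sets F = sets obs" and \<mu>: "regular_cond_dist F \<mu>"
  shows "AE x in law_X F. \<forall>u. cond_quantile F u x = quantile (\<mu> x) u"
proof -
  have "regular_cond_dist F (cond_dist F)"
    unfolding cond_dist_def by (rule someI[of _ \<mu>]) (rule \<mu>)
  then have "AE x in law_X F. cond_dist F x = \<mu> x"
    by (rule regular_cond_dist_unique[OF F _ \<mu>])
  then show ?thesis by eventually_elim (simp add: cond_quantile_def)
qed

section \<open>Assouad decoding from two-point tests\<close>

text \<open>
  An event that is rare under \<open>P\<close> cannot be almost certain under \<open>Q\<close>: \<open>Q A\<close> is the \<open>P\<close>-integral of the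
  likelihood ratio \<open>L\<close> over \<open>A\<close>, which a bounded second moment of \<open>L\<close> controls.
\<close>
lemma two_point_testing_bound:
  assumes P: "prob_space P" and L [measurable]: "L \<in> borel_measurable P"
    and L0: "\<And>d. 0 \<le> L d"
    and Q: "prob_space (density P (\<lambda>d. ennreal (L d)))"
    and L2: "(\<integral>\<^sup>+d. ennreal ((L d)\<^sup>2) \<partial>P) \<le> ennreal B" and B: "B \<ge> 1"
    and A: "A \<in> sets P"
  shows "3 / (4 * B) \<le> measure P A + measure (density P (\<lambda>d. ennreal (L d))) (space P - A)"
proof -
  let ?Q = "density P (\<lambda>d. ennreal (L d))"
  interpret P: prob_space P by fact
  interpret Q: prob_space ?Q by fact
  have "emeasure ?Q A = (\<integral>\<^sup>+d. ennreal (L d) * indicator A d \<partial>P)"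
    using A by (intro emeasure_density) auto
  also have "\<dots> \<le> (\<integral>\<^sup>+d. ennreal (1 / (4 * B)) * ennreal ((L d)\<^sup>2) + ennreal B * indicator A d \<partial>P)"
  proof (rule nn_integral_mono)
    fix d
    \<comment> \<open>The weights of this instance of the arithmetic-geometric mean inequality make the second
      moment contribute at most \<open>1/4\<close>.\<close>
    have "0 \<le> (L d - 2 * B)\<^sup>2" by simp
    then have "L d * (4 * B) \<le> (L d)\<^sup>2 + B * (4 * B)" by (simp add: power2_eq_square algebra_simps)
    then have "L d \<le> ((L d)\<^sup>2 + B * (4 * B)) / (4 * B)"
      using B by (simp only: pos_le_divide_eq)
    also have "\<dots> = 1 / (4 * B) * (L d)\<^sup>2 + B" using B by (simp add: field_simps)
    finally have *: "L d \<le> 1 / (4 * B) * (L d)\<^sup>2 + B" .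
    have "ennreal (L d) \<le> ennreal (1 / (4 * B) * (L d)\<^sup>2 + B)" using * by (rule ennreal_leI)
    also have "\<dots> = ennreal (1 / (4 * B)) * ennreal ((L d)\<^sup>2) + ennreal B"
      unfolding ennreal_mult[OF divide_nonneg_nonneg zero_le_power2, symmetric]
      using B by (subst ennreal_plus) (simp_all flip: ennreal_mult)
    finally show "ennreal (L d) * indicator A d
        \<le> ennreal (1 / (4 * B)) * ennreal ((L d)\<^sup>2) + ennreal B * indicator A d"
      by (cases "d \<in> A") auto
  qed
  also have "\<dots> = ennreal (1 / (4 * B)) * (\<integral>\<^sup>+d. ennreal ((L d)\<^sup>2) \<partial>P) + ennreal B * emeasure P A"
    using A by (subst nn_integral_add) (auto simp: nn_integral_cmult)
  also have "\<dots> \<le> ennreal (1 / (4 * B)) * ennreal B + ennreal B * emeasure P A"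
    by (intro add_right_mono mult_left_mono L2) simp
  also have "\<dots> = ennreal (1 / 4 + B * measure P A)"
    using B by (subst ennreal_plus) (simp_all add: P.emeasure_eq_measure ennreal_mult'[symmetric])
  finally have "ennreal (measure ?Q A) \<le> ennreal (1 / 4 + B * measure P A)"
    by (simp only: Q.emeasure_eq_measure)
  then have "measure ?Q A \<le> 1 / 4 + B * measure P A"
    by (rule ennreal_le_iff[THEN iffD1, rotated]) (use B in simp)
  moreover have "measure ?Q (space P - A) = 1 - measure ?Q A"
    using Q.prob_compl[of A] A by simp
  ultimately have 1: "3 / 4 \<le> B * measure P A + measure ?Q (space P - A)" by linarith
  also have "\<dots> \<le> B * measure P A + B * measure ?Q (space P - A)"
    using mult_right_mono[of 1 B "measure ?Q (space P - A)"] B by simp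
  finally show ?thesis using B by (simp add: field_simps)
qed

definition toggle :: "'i \<Rightarrow> 'i set \<Rightarrow> 'i set" where
  "toggle j \<theta> = (if j \<in> \<theta> then \<theta> - {j} else insert j \<theta>)"

lemma toggle_toggle [simp]: "toggle j (toggle j \<theta>) = \<theta>"
  by (auto simp: toggle_def)

lemma toggle_subset: "j \<in> J \<Longrightarrow> \<theta> \<subseteq> J \<Longrightarrow> toggle j \<theta> \<subseteq> J"
  by (auto simp: toggle_def)

lemma mem_toggle_iff: "j \<in> toggle j \<theta> \<longleftrightarrow> j \<notin> \<theta>"
  by (auto simp: toggle_def)

text \<open>
  Assouad's lemma for events instead of estimators. Think of \<open>A \<theta>\<close> as the event that the estimate is
  close to hypothesis \<open>\<theta>\<close>. Decode the data into any \<open>\<theta>'\<close> whose event occurs. For each \<open>j\<close>, averaging over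
  pairs of neighbours, the decoded \<open>j\<close>-th bit is wrong with probability at least \<open>\<kappa> / 2\<close>, so for some \<open>\<theta>\<close>
  the expected number of wrong bits is at least \<open>\<kappa> (card J) / 2\<close>. On \<open>A \<theta>\<close> at most half of that many
  are wrong, so the complement of \<open>A \<theta>\<close> has to carry the rest.
\<close>
lemma assouad_decoding:
  fixes P :: "'i set \<Rightarrow> 'a measure" and A :: "'i set \<Rightarrow> 'a set"
  assumes J: "finite J" "J \<noteq> {}" and \<kappa>: "\<kappa> \<ge> 0"
    and prob: "\<And>\<theta>. \<theta> \<subseteq> J \<Longrightarrow> prob_space (P \<theta>)"
    and sets: "\<And>\<theta>. \<theta> \<subseteq> J \<Longrightarrow> sets (P \<theta>) = sets M"
    and A: "\<And>\<theta>. \<theta> \<subseteq> J \<Longrightarrow> A \<theta> \<in> sets M"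
    and test: "\<And>\<theta> j B. \<theta> \<subseteq> J \<Longrightarrow> j \<in> J \<Longrightarrow> B \<in> sets M \<Longrightarrow>
      \<kappa> \<le> measure (P \<theta>) B + measure (P (toggle j \<theta>)) (space M - B)"
    and close: "\<And>\<theta> \<theta>' d. \<theta> \<subseteq> J \<Longrightarrow> \<theta>' \<subseteq> J \<Longrightarrow> d \<in> A \<theta> \<Longrightarrow> d \<in> A \<theta>' \<Longrightarrow>
      real (card (sym_diff \<theta> \<theta>')) \<le> \<kappa> * real (card J) / 4"
  shows "\<exists>\<theta>\<subseteq>J. measure (P \<theta>) (space M - A \<theta>) \<ge> \<kappa> / 4"
proof -
  define m where "m = real (card J)"
  have m: "m > 0" using J by (simp add: m_def card_gt_0_iff)
  have space: "space (P \<theta>) = space M" if "\<theta> \<subseteq> J" for \<theta>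
    using sets[OF that] by (rule sets_eq_imp_space_eq)
  have finP: "finite (Pow J)" using J by simp
  \<comment> \<open>The decoder depends on the data only through the finite pattern of events that occur, which
    makes it measurable for an arbitrary choice function.\<close>
  define pat where "pat d = {\<theta> \<in> Pow J. d \<in> A \<theta>}" for d
  define ch :: "'i set set \<Rightarrow> 'i set" where "ch S = (if S = {} then {} else SOME \<theta>. \<theta> \<in> S)" for S
  have ch: "ch S \<in> S" if "S \<noteq> {}" for S
    using that by (simp add: ch_def some_in_eq)
  define E where "E j = {d \<in> space M. j \<in> ch (pat d)}" for j
  have pat_sets: "{d \<in> space M. pat d = S} \<in> sets M" if S: "S \<subseteq> Pow J" for S
  proof -
    have "{d \<in> space M. pat d = S} = space M \<inter> (\<Inter>\<theta>\<in>Pow J. if \<theta> \<in> S then A \<theta> else space M - A \<theta>)"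
    proof (intro equalityI subsetI)
      fix d assume d: "d \<in> space M \<inter> (\<Inter>\<theta>\<in>Pow J. if \<theta> \<in> S then A \<theta> else space M - A \<theta>)"
      then have "d \<in> A \<theta> \<longleftrightarrow> \<theta> \<in> S" if "\<theta> \<in> Pow J" for \<theta>
        using that by (cases "\<theta> \<in> S") (auto dest!: INT_D[of _ _ _ \<theta>])
      then show "d \<in> {d \<in> space M. pat d = S}" using d S by (auto simp: pat_def)
    qed (auto simp: pat_def)
    also have "\<dots> \<in> sets M"
    proof (rule sets.Int[OF sets.top], rule sets.finite_INT[OF finP])
      show "Pow J \<noteq> {}" by auto
      show "(if \<theta> \<in> S then A \<theta> else space M - A \<theta>) \<in> sets M" if "\<theta> \<in> Pow J" for \<theta>
        using A[of \<theta>] that by auto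
    qed
    finally show ?thesis .
  qed
  have E: "E j \<in> sets M" for j
  proof -
    have "E j = (\<Union>S\<in>{S \<in> Pow (Pow J). j \<in> ch S}. {d \<in> space M. pat d = S})"
      by (auto simp: E_def pat_def)
    also have "\<dots> \<in> sets M"
      by (rule sets.finite_UN) (use finP pat_sets in auto)
    finally show ?thesis .
  qed
  \<comment> \<open>\<open>wrong \<theta> j\<close> is the event that the decoder errs on bit \<open>j\<close> when \<open>\<theta>\<close> is true.\<close>
  define wrong where "wrong \<theta> j = (if j \<in> \<theta> then space M - E j else E j)" for \<theta> j
  have wrong: "wrong \<theta> j \<in> sets M" for \<theta> j using E by (simp add: wrong_def)
  have wrong_toggle: "wrong (toggle j \<theta>) j = space M - wrong \<theta> j" for \<theta> j
    using sets.sets_into_space[OF E[of j]] by (auto simp: wrong_def mem_toggle_iff)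
  define p where "p \<theta> j = measure (P \<theta>) (wrong \<theta> j)" for \<theta> j
  have col: "real (card (Pow J)) * (\<kappa> / 2) \<le> (\<Sum>\<theta>\<in>Pow J. p \<theta> j)" if j: "j \<in> J" for j
  proof -
    have "bij_betw (toggle j) (Pow J) (Pow J)"
      by (rule bij_betwI[of _ _ _ "toggle j"]) (use toggle_subset[OF j] in auto)
    then have re: "(\<Sum>\<theta>\<in>Pow J. p (toggle j \<theta>) j) = (\<Sum>\<theta>\<in>Pow J. p \<theta> j)"
      by (rule sum.reindex_bij_betw)
    have "real (card (Pow J)) * \<kappa> \<le> (\<Sum>\<theta>\<in>Pow J. p \<theta> j + p (toggle j \<theta>) j)"
    proof (rule sum_bounded_below)
      fix \<theta> assume "\<theta> \<in> Pow J"
      then show "\<kappa> \<le> p \<theta> j + p (toggle j \<theta>) j"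
        using test[of \<theta> j "wrong \<theta> j"] wrong j by (simp add: p_def wrong_toggle)
    qed
    then show ?thesis by (simp add: sum.distrib re)
  qed
  have "\<exists>\<theta>\<in>Pow J. m * \<kappa> / 2 \<le> (\<Sum>j\<in>J. p \<theta> j)"
  proof (rule ccontr)
    assume "\<not> ?thesis"
    then have "(\<Sum>\<theta>\<in>Pow J. \<Sum>j\<in>J. p \<theta> j) < (\<Sum>\<theta>\<in>Pow J. m * \<kappa> / 2)"
      using finP by (intro sum_strict_mono) (auto simp: not_le)
    also have "\<dots> = m * (real (card (Pow J)) * (\<kappa> / 2))" by simp
    also have "\<dots> \<le> (\<Sum>j\<in>J. \<Sum>\<theta>\<in>Pow J. p \<theta> j)"
      unfolding m_def by (rule sum_bounded_below) (rule col)
    also have "\<dots> = (\<Sum>\<theta>\<in>Pow J. \<Sum>j\<in>J. p \<theta> j)" by (rule sum.swap)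
    finally show False by simp
  qed
  then obtain \<theta> where \<theta>: "\<theta> \<subseteq> J" "m * \<kappa> / 2 \<le> (\<Sum>j\<in>J. p \<theta> j)" by auto
  interpret P: prob_space "P \<theta>" using prob[OF \<theta>(1)] .
  have sP: "B \<in> sets M \<Longrightarrow> B \<in> P.events" for B using sets[OF \<theta>(1)] by simp
  have bound: "(\<Sum>j\<in>J. indicator (wrong \<theta> j) d) \<le> m * \<kappa> / 4 + m * indicator (space M - A \<theta>) d"
    if d: "d \<in> space M" for d :: 'a
  proof -
    have "(\<Sum>j\<in>J. indicator (wrong \<theta> j) d :: real) = (\<Sum>j\<in>J. if j \<in> sym_diff \<theta> (ch (pat d)) then 1 else 0)"
      by (intro sum.cong) (use d in \<open>auto simp: wrong_def E_def indicator_def\<close>)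
    also have "\<dots> = real (card (J \<inter> sym_diff \<theta> (ch (pat d))))"
      using J by (simp add: sum.If_cases Int_def del: Un_iff Diff_iff)
    finally have eq: "(\<Sum>j\<in>J. indicator (wrong \<theta> j) d :: real) = real (card (J \<inter> sym_diff \<theta> (ch (pat d))))" .
    show ?thesis
    proof (cases "d \<in> A \<theta>")
      case True
      then have "\<theta> \<in> pat d" using \<theta>(1) by (simp add: pat_def)
      then have "ch (pat d) \<in> pat d" using ch[of "pat d"] by blast
      then have "ch (pat d) \<subseteq> J" "d \<in> A (ch (pat d))" by (auto simp: pat_def)
      then have "real (card (sym_diff \<theta> (ch (pat d)))) \<le> m * \<kappa> / 4"
        using close[OF \<theta>(1) _ True] by (simp add: m_def mult.commute)
      moreover have "J \<inter> sym_diff \<theta> (ch (pat d)) = sym_diff \<theta> (ch (pat d))"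
        using \<theta>(1) \<open>ch (pat d) \<subseteq> J\<close> by blast
      ultimately show ?thesis using True by (simp add: eq)
    next
      case False
      have "card (J \<inter> sym_diff \<theta> (ch (pat d))) \<le> card J"
        using J by (intro card_mono) auto
      then have "real (card (J \<inter> sym_diff \<theta> (ch (pat d)))) \<le> m" by (simp add: m_def)
      moreover have "0 \<le> m * \<kappa> / 4" using m \<kappa> by simp
      ultimately show ?thesis unfolding eq using False d by simp
    qed
  qed
  have "(\<Sum>j\<in>J. p \<theta> j) = (\<integral>d. (\<Sum>j\<in>J. indicator (wrong \<theta> j) d) \<partial>P \<theta>)"
    unfolding p_def using sP[OF wrong] sets.sets_into_space[OF wrong]
    by (subst Bochner_Integration.integral_sum)
       (auto simp: Int_absorb2 space[OF \<theta>(1)] P.emeasure_eq_measure)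
  also have "\<dots> \<le> (\<integral>d. m * \<kappa> / 4 + m * indicator (space M - A \<theta>) d \<partial>P \<theta>)"
  proof (rule integral_mono)
    show "integrable (P \<theta>) (\<lambda>d. \<Sum>j\<in>J. indicator (wrong \<theta> j) d :: real)"
      using sP[OF wrong] by (intro Bochner_Integration.integrable_sum) (simp add: P.emeasure_eq_measure)
    show "integrable (P \<theta>) (\<lambda>d. m * \<kappa> / 4 + m * indicator (space M - A \<theta>) d)"
      using sP[OF sets.compl_sets[OF A[OF \<theta>(1)]]] by (simp add: P.emeasure_eq_measure)
  qed (use bound space[OF \<theta>(1)] in auto)
  also have "\<dots> = m * \<kappa> / 4 + m * measure (P \<theta>) (space M - A \<theta>)"
    using sP[OF sets.compl_sets[OF A[OF \<theta>(1)]]] 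
    using P.prob_space
    by (simp add: P.emeasure_eq_measure Int_absorb2 space[OF \<theta>(1)])
  finally have "m * (\<kappa> / 4) \<le> m * measure (P \<theta>) (space M - A \<theta>)" using \<theta>(2) by simp
  then have "\<kappa> / 4 \<le> measure (P \<theta>) (space M - A \<theta>)" using m by simp
  then show ?thesis using \<theta>(1) by blast
qed

section \<open>A covariate process with prescribed polynomial eigenvalues\<close>

lemma powr_diff_bounds:
  fixes p x :: real
  assumes "p > 0" "x > 0"
  shows "x powr (-p) - (x + 1) powr (-p) \<le> p * x powr (-p - 1)"
    and "p * (x + 1) powr (-p - 1) \<le> x powr (-p) - (x + 1) powr (-p)"
proof -
  have "\<exists>z. x < z \<and> z < x + 1 \<and>
      (x + 1) powr (-p) - x powr (-p) = (x + 1 - x) * (-p * z powr (-p - 1))"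
  proof (rule MVT2)
    show "((\<lambda>z. z powr (-p)) has_real_derivative -p * z powr (-p - 1)) (at z)"
      if "x \<le> z" "z \<le> x + 1" for z
      by (rule has_real_derivative_powr) (use that assms in simp)
  qed simp
  then obtain z where z: "x < z" "z < x + 1"
    "x powr (-p) - (x + 1) powr (-p) = p * z powr (-p - 1)"
    by auto
  have "z powr (-p - 1) \<le> x powr (-p - 1)"
    by (rule powr_mono2') (use z assms in auto)
  then show "x powr (-p) - (x + 1) powr (-p) \<le> p * x powr (-p - 1)"
    unfolding z(3) using assms by (intro mult_left_mono) auto
  have "(x + 1) powr (-p - 1) \<le> z powr (-p - 1)"
    by (rule powr_mono2') (use z assms in auto)
  then show "p * (x + 1) powr (-p - 1) \<le> x powr (-p) - (x + 1) powr (-p)"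
    unfolding z(3) using assms by (intro mult_left_mono) auto
qed

lemma cos_basis_mult_sin_basis: "cos_basis j v * sin_basis j t
  = sin (pi * real j * (t + v)) + sin (pi * real j * (t - v))"
proof -
  have "cos_basis j v * sin_basis j t = 2 * (sin (pi * real j * t) * cos (pi * real j * v))"
    by (simp add: cos_basis_def sin_basis_def)
  also have "\<dots> = sin (pi * real j * t + pi * real j * v) + sin (pi * real j * t - pi * real j * v)"
    by (simp only: sin_times_cos) simp
  also have "\<dots> = sin (pi * real j * (t + v)) + sin (pi * real j * (t - v))"
    by (simp only: right_diff_distrib distrib_left)
  finally show ?thesis .
qed

text \<open>
  Common ground of the sine basis in the time variable and the cosine functions in the phase variable. Indices
  start at \<open>1\<close>.
\<close>
locale orthonormal_system =
  fixes e :: "nat \<Rightarrow> real \<Rightarrow> real"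
  assumes cont: "continuous_on A (e i)" and bound: "\<bar>e i t\<bar> \<le> sqrt 2"
    and orth: "i \<ge> 1 \<Longrightarrow> j \<ge> 1 \<Longrightarrow> (\<integral>t. e i t * e j t \<partial>unit_leb) = (if i = j then 1 else 0)"
begin

lemma integral_sum_product:
  assumes "finite I" "\<And>i. i \<in> I \<Longrightarrow> i \<ge> 1"
  shows "(\<integral>t. (\<Sum>i\<in>I. a i * e i t) * (\<Sum>j\<in>I. b j * e j t) \<partial>unit_leb) = (\<Sum>j\<in>I. a j * b j)"
proof -
  have int: "integrable unit_leb (\<lambda>t. a i * b j * (e i t * e j t))" for i j
    by (intro continuous_integrable_unit_leb continuous_intros cont)
  have "(\<Sum>i\<in>I. a i * e i t) * (\<Sum>j\<in>I. b j * e j t) = (\<Sum>i\<in>I. \<Sum>j\<in>I. a i * b j * (e i t * e j t))" for t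
    unfolding sum_product by (simp only: mult_ac)
  then have "(\<integral>t. (\<Sum>i\<in>I. a i * e i t) * (\<Sum>j\<in>I. b j * e j t) \<partial>unit_leb)
      = (\<Sum>i\<in>I. \<Sum>j\<in>I. \<integral>t. a i * b j * (e i t * e j t) \<partial>unit_leb)"
    by (simp only: Bochner_Integration.integral_sum Bochner_Integration.integrable_sum int)
  also have "\<dots> = (\<Sum>i\<in>I. \<Sum>j\<in>I. if i = j then a i * b j else 0)"
    by (intro sum.cong refl) (simp only: integral_mult_right_zero orth assms(2), simp)
  also have "\<dots> = (\<Sum>i\<in>I. a i * b i)"
    using assms(1) by (intro sum.cong refl) simp
  finally show ?thesis .
qed

lemma coefficient_of_bounded_limit:
  assumes lim: "\<And>t. (\<lambda>N. \<Sum>i=1..N. a i * e i t) \<longlonglongrightarrow> f t"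
    and le: "\<And>N t. \<bar>\<Sum>i=1..N. a i * e i t\<bar> \<le> B" and j: "j \<ge> 1"
  shows "(\<integral>t. f t * e j t \<partial>unit_leb) = a j"
proof -
  let ?f = "\<lambda>N t. \<Sum>i=1..N. a i * e i t"
  have meas: "e j \<in> borel_measurable unit_leb" "?f N \<in> borel_measurable unit_leb" for N
    by (intro continuous_measurable_unit_leb continuous_intros cont)+
  have "(\<lambda>N. \<integral>t. ?f N t * e j t \<partial>unit_leb) \<longlonglongrightarrow> (\<integral>t. f t * e j t \<partial>unit_leb)"
  proof (rule integral_dominated_convergence[where w="\<lambda>_. B * sqrt 2"])
    show "AE t in unit_leb. (\<lambda>N. ?f N t * e j t) \<longlonglongrightarrow> f t * e j t"
      by (intro AE_I2 tendsto_mult tendsto_const lim)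
    show "AE t in unit_leb. norm (?f N t * e j t) \<le> B * sqrt 2" for N
      unfolding real_norm_def abs_mult
      by (intro AE_I2 mult_mono bound le) (use le[of 0 0] in auto)
    show "integrable unit_leb (\<lambda>_. B * sqrt 2)"
      by (rule continuous_integrable_unit_leb) (rule continuous_on_const)
  qed (intro borel_measurable_times meas borel_measurable_LIMSEQ_real[OF lim meas(2)])+
  moreover have "(\<integral>t. ?f N t * e j t \<partial>unit_leb) = a j" if "N \<ge> j" for N
  proof -
    have "j \<in> {1..N}" using that j by simp
    then have delta: "(\<Sum>i=1..N. (if i = j then 1 else 0) * e i t) = e j t"
      "(\<Sum>i=1..N. a i * (if i = j then 1 else 0)) = a j" for t
      by (simp_all add: if_distrib[of "\<lambda>x. x * _"] if_distrib[of "\<lambda>x. _ * x"] cong: if_cong)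
    show ?thesis
      using integral_sum_product[of "{1..N}" a "\<lambda>i. if i = j then 1 else 0"]
      unfolding delta by simp
  qed
  then have "(\<lambda>N. \<integral>t. ?f N t * e j t \<partial>unit_leb) \<longlonglongrightarrow> a j"
    by (intro tendsto_eventually) (auto simp: eventually_at_top_linorder)
  ultimately show ?thesis by (rule LIMSEQ_unique)
qed

end

interpretation sines: orthonormal_system sin_basis
  by unfold_locales (rule continuous_sin_basis, rule sin_basis_le, rule integral_sin_basis)

interpretation cosines: orthonormal_system cos_basis
  by unfold_locales (rule continuous_cos_basis, rule cos_basis_le, rule integral_cos_basis)

locale polynomial_decay =
  fixes \<alpha> :: real
  assumes \<alpha>: "\<alpha> > 1"
begin

text \<open>
  The names \<open>amp\<close> and \<open>kap\<close> stand for the amplitudes \<open>\<surd>\<kappa>\<^bsub>j\<^esub>\<close> and the eigenvalues \<open>\<kappa>\<^bsub>j\<^esub>\<close>. The process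
  is built from the wave \<open>g(x) = (\<Sum>j. \<epsilon>\<^bsub>j\<^esub> \<surd>\<kappa>\<^bsub>j\<^esub> sin (\<pi> j x))\<close>, which need not converge absolutely; it is
  defined by the series that summation by parts produces.
\<close>
definition amp :: "nat \<Rightarrow> real" where
  "amp j = real j powr (- (\<alpha> / 2))"

definition kap :: "nat \<Rightarrow> real" where
  "kap j = real j powr (- \<alpha>)"

lemma amp_sq: "(amp j)\<^sup>2 = kap j"
  by (simp add: amp_def kap_def power2_eq_square flip: powr_add)

lemma amp_nonneg: "amp j \<ge> 0" by (simp add: amp_def)

lemma kap_nonneg: "kap j \<ge> 0" by (simp add: kap_def)

definition sin_sum :: "nat \<Rightarrow> real \<Rightarrow> real" where
  "sin_sum N x = (\<Sum>j=1..N. rs_sign j * sin (pi * real j * x))"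

definition wave_partial :: "nat \<Rightarrow> real \<Rightarrow> real" where
  "wave_partial N x = (\<Sum>j=1..N. rs_sign j * amp j * sin (pi * real j * x))"

definition abel_term :: "nat \<Rightarrow> real \<Rightarrow> real" where
  "abel_term i x = (amp (Suc i) - amp (Suc (Suc i))) * sin_sum (Suc i) x"

definition wave :: "real \<Rightarrow> real" where
  "wave x = (\<Sum>i. abel_term i x)"

lemma wave_partial_abel:
  "wave_partial N x = (\<Sum>i<N. abel_term i x) + amp (Suc N) * sin_sum N x"
proof (induction N)
  case (Suc N)
  have 1: "sin_sum (Suc N) x = sin_sum N x + rs_sign (Suc N) * sin (pi * real (Suc N) * x)"
    by (simp add: sin_sum_def)
  have 2: "wave_partial (Suc N) x = wave_partial N x + amp (Suc N) * (rs_sign (Suc N) * sin (pi * real (Suc N) * x))"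
    by (simp add: wave_partial_def)
  have 3: "(\<Sum>i<Suc N. abel_term i x) = (\<Sum>i<N. abel_term i x) + (amp (Suc N) - amp (Suc (Suc N))) * sin_sum (Suc N) x"
    by (simp add: abel_term_def)
  show ?case unfolding 3 2 Suc.IH unfolding 1 by (simp only: algebra_simps)
qed (simp add: wave_partial_def sin_sum_def)

definition abel_bound :: "nat \<Rightarrow> real" where
  "abel_bound i = 5 * \<alpha> * real (Suc i) powr (- ((\<alpha> + 1) / 2))"

lemma summable_abel_bound: "summable abel_bound"
proof -
  have "summable (\<lambda>i. real i powr (- ((\<alpha> + 1) / 2)))"
    unfolding summable_real_powr_iff using \<alpha> by simp
  then have "summable (\<lambda>i. real (Suc i) powr (- ((\<alpha> + 1) / 2)))"
    by (subst summable_Suc_iff)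
  then show ?thesis unfolding abel_bound_def [abs_def] by (rule summable_mult)
qed

text \<open>
  The increments of the amplitudes are of order \<open>i powr (- \<alpha>/2 - 1)\<close> and the Rudin--Shapiro sums of order
  \<open>\<surd>i\<close>, so the exponent of the product is \<open>- (\<alpha> + 1)/2 < -1\<close>. This is where \<open>\<alpha> > 1\<close> is used.
\<close>
lemma abel_term_le: "\<bar>abel_term i x\<bar> \<le> abel_bound i"
proof -
  define n where "n = real (Suc i)"
  have n: "n \<ge> 1" by (simp add: n_def)
  have amp: "amp (Suc i) = n powr (- (\<alpha> / 2))" "amp (Suc (Suc i)) = (n + 1) powr (- (\<alpha> / 2))"
    by (simp_all add: amp_def n_def add.commute)
  have lo: "0 \<le> amp (Suc i) - amp (Suc (Suc i))"
    unfolding amp using n \<alpha> by (simp add: powr_mono2')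
  have up: "amp (Suc i) - amp (Suc (Suc i)) \<le> \<alpha> / 2 * n powr (- (\<alpha> / 2) - 1)"
    unfolding amp using n \<alpha> by (intro powr_diff_bounds) auto
  have "sqrt (n + 1) \<le> sqrt (4 * n)" using n by (intro real_sqrt_le_mono) simp
  also have "\<dots> = 2 * n powr (1 / 2)" using n by (simp add: real_sqrt_mult powr_half_sqrt)
  finally have sq: "sqrt (n + 1) \<le> 2 * n powr (1 / 2)" .
  have "\<bar>sin_sum (Suc i) x\<bar> \<le> 5 * sqrt (real (Suc (Suc i)))"
    unfolding sin_sum_def by (rule rs_sine_sum_le)
  also have "real (Suc (Suc i)) = n + 1" by (simp add: n_def)
  finally have "\<bar>sin_sum (Suc i) x\<bar> \<le> 10 * n powr (1 / 2)" using sq by linarith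
  then have "\<bar>abel_term i x\<bar> \<le> (\<alpha> / 2 * n powr (- (\<alpha> / 2) - 1)) * (10 * n powr (1 / 2))"
    unfolding abel_term_def abs_mult using lo up by (intro mult_mono) auto
  also have "\<dots> = 5 * \<alpha> * (n powr (- (\<alpha> / 2) - 1) * n powr (1 / 2))" by simp
  also have "n powr (- (\<alpha> / 2) - 1) * n powr (1 / 2) = n powr (- ((\<alpha> + 1) / 2))"
  proof -
    have "- (\<alpha> / 2) - 1 + 1 / 2 = - ((\<alpha> + 1) / 2)" by (simp add: field_simps)
    then show ?thesis unfolding powr_add[symmetric] by (simp only:)
  qed
  finally show ?thesis by (simp add: abel_bound_def n_def)
qed

lemma boundary_term_le: "\<bar>amp (Suc N) * sin_sum N x\<bar> \<le> 5 * real (Suc N) powr (- ((\<alpha> - 1) / 2))"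
proof -
  have "\<bar>amp (Suc N) * sin_sum N x\<bar> \<le> amp (Suc N) * (5 * sqrt (real (Suc N)))"
    unfolding abs_mult using amp_nonneg[of "Suc N"] rs_sine_sum_le[of x N]
    by (auto simp: sin_sum_def intro!: mult_left_mono)
  also have "\<dots> = 5 * (real (Suc N) powr (- (\<alpha> / 2)) * real (Suc N) powr (1 / 2))"
    by (simp add: amp_def powr_half_sqrt del: of_nat_Suc)
  also have "real (Suc N) powr (- (\<alpha> / 2)) * real (Suc N) powr (1 / 2) = real (Suc N) powr (- ((\<alpha> - 1) / 2))"
  proof -
    have "- (\<alpha> / 2) + 1 / 2 = - ((\<alpha> - 1) / 2)" by (simp add: field_simps)
    then show ?thesis unfolding powr_add[symmetric] by (simp only:)
  qed
  finally show ?thesis .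
qed

definition wave_bound :: real where
  "wave_bound = suminf abel_bound + 5"

text \<open>
  A bound that is uniform in \<open>N\<close> is what later allows integrals of partial sums to be passed to the
  limit by dominated convergence.
\<close>
lemma wave_partial_le: "\<bar>wave_partial N x\<bar> \<le> wave_bound"
proof -
  have nn: "0 \<le> abel_bound i" for i using abel_term_le[of i 0] by linarith
  have "\<bar>\<Sum>i<N. abel_term i x\<bar> \<le> (\<Sum>i<N. abel_bound i)"
    by (rule order_trans[OF sum_abs]) (intro sum_mono abel_term_le)
  also have "\<dots> \<le> suminf abel_bound"
    using summable_abel_bound nn by (intro sum_le_suminf) auto
  finally have "\<bar>\<Sum>i<N. abel_term i x\<bar> \<le> suminf abel_bound" .
  moreover have "real (Suc N) powr (- ((\<alpha> - 1) / 2)) \<le> real (Suc N) powr 0"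
    using \<alpha> by (intro powr_mono) auto
  then have "\<bar>amp (Suc N) * sin_sum N x\<bar> \<le> 5" using boundary_term_le[of N x] by simp
  ultimately show ?thesis unfolding wave_partial_abel wave_bound_def by linarith
qed

lemma wave_partial_tendsto: "(\<lambda>N. wave_partial N x) \<longlonglongrightarrow> wave x"
proof -
  have "summable (\<lambda>i. abel_term i x)"
    by (rule summable_comparison_test'[OF summable_abel_bound, of 0]) (simp add: abel_term_le)
  then have 1: "(\<lambda>N. \<Sum>i<N. abel_term i x) \<longlonglongrightarrow> wave x"
    unfolding wave_def by (rule summable_LIMSEQ)
  have "(\<lambda>N. real (Suc N) powr (- ((\<alpha> - 1) / 2))) \<longlonglongrightarrow> 0"
    by (rule tendsto_neg_powr[OF _ filterlim_compose[OF filterlim_real_sequentially filterlim_Suc]])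
       (use \<alpha> in simp)
  then have "(\<lambda>N. 5 * real (Suc N) powr (- ((\<alpha> - 1) / 2))) \<longlonglongrightarrow> 0"
    by (rule tendsto_mult_right_zero)
  then have 2: "(\<lambda>N. amp (Suc N) * sin_sum N x) \<longlonglongrightarrow> 0"
    by (rule Lim_null_comparison[rotated]) (simp only: real_norm_def boundary_term_le eventually_True)
  show ?thesis
    unfolding wave_partial_abel using tendsto_add[OF 1 2] by simp
qed

lemma continuous_sin_sum: "continuous_on A (sin_sum N)"
  unfolding sin_sum_def by (intro continuous_intros)

lemma continuous_wave: "continuous_on UNIV wave"
proof (rule uniform_limit_theorem)
  show "uniform_limit UNIV (\<lambda>N x. \<Sum>i<N. abel_term i x) wave sequentially"
    unfolding wave_def [abs_def]
    by (rule Weierstrass_m_test[OF _ summable_abel_bound]) (simp add: abel_term_le)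
  show "\<forall>\<^sub>F N in sequentially. continuous_on UNIV (\<lambda>x. \<Sum>i<N. abel_term i x)"
    unfolding abel_term_def by (intro always_eventually allI continuous_intros continuous_sin_sum)
qed simp

text \<open>
  The path of the covariate for the phase \<open>v\<close>, which will be uniformly distributed on \<open>[0,1]\<close>. In
  \<open>proc_partial\<close> the cosines are orthonormal functions of the phase, so \<open>proc_coef\<close> collects the time
  dependence.
\<close>
definition proc :: "real \<Rightarrow> real \<Rightarrow> real" where
  "proc v t = wave (t + v) + wave (t - v)"

definition proc_coef :: "nat \<Rightarrow> real \<Rightarrow> real" where
  "proc_coef j t = rs_sign j * amp j * sin_basis j t"

definition proc_partial :: "nat \<Rightarrow> real \<Rightarrow> real \<Rightarrow> real" where
  "proc_partial N v t = (\<Sum>j=1..N. proc_coef j t * cos_basis j v)"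

lemma proc_partial_wave: "proc_partial N v t = wave_partial N (t + v) + wave_partial N (t - v)"
proof -
  have "proc_partial N v t = (\<Sum>j=1..N. rs_sign j * amp j * (cos_basis j v * sin_basis j t))"
    by (simp only: proc_partial_def proc_coef_def mult_ac)
  then show ?thesis
    unfolding cos_basis_mult_sin_basis wave_partial_def by (simp only: distrib_left sum.distrib)
qed

lemma proc_partial_tendsto: "(\<lambda>N. proc_partial N v t) \<longlonglongrightarrow> proc v t"
  unfolding proc_partial_wave proc_def by (intro tendsto_add wave_partial_tendsto)

definition proc_bound :: real where "proc_bound = 2 * wave_bound"

lemma proc_partial_le: "\<bar>proc_partial N v t\<bar> \<le> proc_bound"
  unfolding proc_partial_wave proc_bound_def
  using wave_partial_le[of N "t + v"] wave_partial_le[of N "t - v"] by linarith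

lemma proc_le: "\<bar>proc v t\<bar> \<le> proc_bound"
  by (rule tendsto_upperbound[OF tendsto_rabs[OF proc_partial_tendsto]])
     (simp_all add: proc_partial_le)

lemma proc_bound_nonneg: "proc_bound \<ge> 0"
  using proc_le[of 0 0] by linarith

lemma continuous_proc_time: "continuous_on A (proc v)"
  unfolding proc_def [abs_def]
  by (intro continuous_on_add continuous_on_compose2[OF continuous_wave] continuous_intros) auto

lemma continuous_proc_phase: "continuous_on A (\<lambda>v. proc v t)"
  unfolding proc_def
  by (intro continuous_on_add continuous_on_compose2[OF continuous_wave] continuous_intros) auto

lemma continuous_proc_partial_phase: "continuous_on A (\<lambda>v. proc_partial N v t)"
  unfolding proc_partial_def by (intro continuous_intros continuous_cos_basis)

lemma continuous_proc_partial_time: "continuous_on A (proc_partial N v)"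
  unfolding proc_partial_def [abs_def] proc_coef_def
  by (intro continuous_intros continuous_sin_basis)

lemma integral_proc_sin:
  assumes "j \<ge> 1"
  shows "(\<integral>t. proc v t * sin_basis j t \<partial>unit_leb) = rs_sign j * amp j * cos_basis j v"
proof -
  have eq: "proc_partial N v t = (\<Sum>i=1..N. (rs_sign i * amp i * cos_basis i v) * sin_basis i t)" for N t
    by (simp only: proc_partial_def proc_coef_def mult_ac)
  show ?thesis
    by (rule sines.coefficient_of_bounded_limit[OF proc_partial_tendsto[where v=v, unfolded eq]
          proc_partial_le[where v=v, unfolded eq] assms])
qed

lemma integral_proc_zero: "(\<integral>v. proc v t \<partial>unit_leb) = 0"
proof -
  have "(\<lambda>N. \<integral>v. proc_partial N v t \<partial>unit_leb) \<longlonglongrightarrow> (\<integral>v. proc v t \<partial>unit_leb)"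
  proof (rule integral_dominated_convergence[where w="\<lambda>_. proc_bound"])
    show "AE v in unit_leb. (\<lambda>N. proc_partial N v t) \<longlonglongrightarrow> proc v t"
      by (intro AE_I2 proc_partial_tendsto)
    show "AE v in unit_leb. norm (proc_partial N v t) \<le> proc_bound" for N
      by (simp add: proc_partial_le)
  qed (intro continuous_measurable_unit_leb continuous_integrable_unit_leb continuous_intros
      continuous_proc_phase continuous_proc_partial_phase)+
  moreover have "(\<integral>v. proc_partial N v t \<partial>unit_leb) = 0" for N
  proof -
    have "integrable unit_leb (\<lambda>v. proc_coef j t * cos_basis j v)" for j
      by (intro continuous_integrable_unit_leb continuous_intros continuous_cos_basis)
    then have "(\<integral>v. proc_partial N v t \<partial>unit_leb) = (\<Sum>j=1..N. \<integral>v. proc_coef j t * cos_basis j v \<partial>unit_leb)"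
      unfolding proc_partial_def by (rule Bochner_Integration.integral_sum)
    also have "\<dots> = 0"
      by (intro sum.neutral ballI) (simp add: integral_cos_basis_zero)
    finally show ?thesis .
  qed
  ultimately show ?thesis by (simp add: LIMSEQ_const_iff)
qed

text \<open>
  The covariance kernel of the process; \<open>kern_tail\<close> bounds, uniformly in both arguments, what its
  spectral expansion leaves out after \<open>N\<close> terms.
\<close>
definition kern :: "real \<Rightarrow> real \<Rightarrow> real" where
  "kern s t = (\<integral>v. proc v s * proc v t \<partial>unit_leb)"

definition kern_partial :: "nat \<Rightarrow> real \<Rightarrow> real \<Rightarrow> real" where
  "kern_partial N s t = (\<Sum>j=1..N. kap j * sin_basis j s * sin_basis j t)"

lemma proc_coef_mult: "proc_coef j s * proc_coef j t = kap j * sin_basis j s * sin_basis j t"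
proof -
  have "proc_coef j s * proc_coef j t = (rs_sign j)\<^sup>2 * (amp j)\<^sup>2 * sin_basis j s * sin_basis j t"
    by (simp only: proc_coef_def power2_eq_square mult_ac)
  then show ?thesis by (simp only: rs_sign_sq amp_sq mult_1_left)
qed

lemma kern_partial_tendsto: "(\<lambda>N. kern_partial N s t) \<longlonglongrightarrow> kern s t"
proof -
  have "(\<lambda>N. \<integral>v. proc_partial N v s * proc_partial N v t \<partial>unit_leb) \<longlonglongrightarrow> kern s t"
    unfolding kern_def
  proof (rule integral_dominated_convergence[where w="\<lambda>_. proc_bound * proc_bound"])
    show "AE v in unit_leb. (\<lambda>N. proc_partial N v s * proc_partial N v t) \<longlonglongrightarrow> proc v s * proc v t"
      by (intro AE_I2 tendsto_mult proc_partial_tendsto)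
    show "AE v in unit_leb. norm (proc_partial N v s * proc_partial N v t) \<le> proc_bound * proc_bound" for N
      unfolding real_norm_def abs_mult
      by (intro AE_I2 mult_mono proc_partial_le) (auto simp: proc_bound_nonneg)
  qed (intro continuous_measurable_unit_leb continuous_integrable_unit_leb continuous_intros
      continuous_proc_phase continuous_proc_partial_phase)+
  moreover have "(\<integral>v. proc_partial N v s * proc_partial N v t \<partial>unit_leb) = kern_partial N s t" for N
    unfolding proc_partial_def kern_partial_def
    by (subst cosines.integral_sum_product) (auto simp: proc_coef_mult)
  ultimately show ?thesis by simp
qed

lemma summable_kap: "summable kap"
  unfolding kap_def [abs_def] summable_real_powr_iff using \<alpha> by simp

definition kern_tail :: "nat \<Rightarrow> real" where
  "kern_tail N = 2 * (suminf kap - (\<Sum>j=1..N. kap j))"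

lemma kern_tail_tendsto: "kern_tail \<longlonglongrightarrow> 0"
proof -
  have "(\<lambda>N. \<Sum>j<Suc N. kap j) \<longlonglongrightarrow> suminf kap"
    by (rule LIMSEQ_Suc[OF summable_LIMSEQ[OF summable_kap]])
  moreover have "(\<Sum>j<Suc N. kap j) = (\<Sum>j=1..N. kap j)" for N
    unfolding lessThan_Suc_atMost atMost_atLeast0
    by (subst sum.atLeast_Suc_atMost) (auto simp: kap_def)
  ultimately have "(\<lambda>N. \<Sum>j=1..N. kap j) \<longlonglongrightarrow> suminf kap" by simp
  from tendsto_mult[OF tendsto_const tendsto_diff[OF tendsto_const this], of 2 "suminf kap"]
  show ?thesis unfolding kern_tail_def [abs_def] by simp
qed

lemma kern_partial_diff_le: "\<bar>kern s t - kern_partial N s t\<bar> \<le> kern_tail N"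
proof -
  have "\<bar>kern_partial M s t - kern_partial N s t\<bar> \<le> kern_tail N" if "M \<ge> N" for M
  proof -
    have split: "(\<Sum>j=1..M. f j) = (\<Sum>j=1..N. f j) + (\<Sum>j=Suc N..M. f j)" for f :: "nat \<Rightarrow> real"
    proof -
      have "{1..M} = {1..N} \<union> {Suc N..M}" using that by auto
      then show ?thesis by (simp only:) (rule sum.union_disjoint, auto)
    qed
    have le: "\<bar>kap j * sin_basis j s * sin_basis j t\<bar> \<le> 2 * kap j" for j
    proof -
      have "\<bar>sin_basis j s\<bar> * \<bar>sin_basis j t\<bar> \<le> 2"
        using mult_mono[OF sin_basis_le[of j s] sin_basis_le[of j t]] by simp
      from mult_left_mono[OF this kap_nonneg[of j]] show ?thesis
        using kap_nonneg[of j] by (simp add: abs_mult mult_ac)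
    qed
    have "\<bar>kern_partial M s t - kern_partial N s t\<bar> = \<bar>\<Sum>j=Suc N..M. kap j * sin_basis j s * sin_basis j t\<bar>"
      unfolding kern_partial_def split by simp
    also have "\<dots> \<le> (\<Sum>j=Suc N..M. 2 * kap j)"
      by (rule order_trans[OF sum_abs]) (intro sum_mono le)
    also have "\<dots> = 2 * ((\<Sum>j=1..M. kap j) - (\<Sum>j=1..N. kap j))"
      unfolding split by (simp add: sum_distrib_left)
    also have "(\<Sum>j=1..M. kap j) \<le> suminf kap"
      using summable_kap kap_nonneg by (intro sum_le_suminf) auto
    finally show ?thesis by (simp add: kern_tail_def)
  qed
  then have "eventually (\<lambda>M. \<bar>kern_partial M s t - kern_partial N s t\<bar> \<le> kern_tail N) sequentially"
    by (auto simp: eventually_at_top_linorder)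
  then show ?thesis
    by (intro tendsto_upperbound[OF tendsto_rabs[OF tendsto_diff[OF kern_partial_tendsto tendsto_const]]]) auto
qed

lemma integral_proc_increment:
  "(\<integral>v. (proc v t - proc v s)\<^sup>2 \<partial>unit_leb) = kern t t - 2 * kern s t + kern s s"
proof -
  have int: "integrable unit_leb (\<lambda>v. proc v a * proc v b)" for a b
    by (intro continuous_integrable_unit_leb continuous_intros continuous_proc_phase)
  have "(proc v t - proc v s)\<^sup>2 = proc v t * proc v t - 2 * (proc v s * proc v t) + proc v s * proc v s" for v
    by (simp add: power2_eq_square algebra_simps)
  then show ?thesis
    unfolding kern_def by (simp add: int del: mult_cancel_left)
qed

end

section \<open>Location models with logistic noise\<close>

text \<open>
  The law of \<open>(h(X) + W, X)\<close> with \<open>X\<close> distributed according to \<open>P\<close> and independent standard logistic \<open>W\<close>.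
  Writing it as a density makes likelihood ratios immediate.
\<close>
definition logistic_model :: "D01 measure \<Rightarrow> (D01 \<Rightarrow> real) \<Rightarrow> (real \<times> D01) measure" where
  "logistic_model P h = density (lborel \<Otimes>\<^sub>M P) (\<lambda>(y, x). ennreal (logistic_pdf (y - h x)))"

locale design =
  fixes P :: "D01 measure"
  assumes prob_P: "prob_space P" and sets_P [simp, measurable_cong]: "sets P = sets borel"
begin

sublocale P: prob_space P by (rule prob_P)

sublocale pair: pair_sigma_finite lborel P
  by (intro pair_sigma_finite.intro sigma_finite_lborel P.sigma_finite_measure_axioms)

lemma space_P [simp]: "space P = UNIV"
  using sets_eq_imp_space_eq[OF sets_P] by simp

lemma measurable_P: "f \<in> borel_measurable borel \<Longrightarrow> f \<in> borel_measurable P"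
  using measurable_cong_sets[OF sets_P refl] by blast

lemma sets_logistic_model: "sets (logistic_model P h) = sets obs"
  unfolding logistic_model_def by (simp cong: sets_pair_measure_cong)

context
  fixes h :: "D01 \<Rightarrow> real"
  assumes h [measurable]: "h \<in> borel_measurable borel"
begin

lemma measurable_shifted_pdf [measurable]:
  "(\<lambda>(y, x). ennreal (logistic_pdf (y - h x))) \<in> borel_measurable (lborel \<Otimes>\<^sub>M P)"
  by measurable

lemma nn_integral_logistic_model:
  assumes g [measurable]: "g \<in> borel_measurable obs"
  shows "(\<integral>\<^sup>+z. g z \<partial>logistic_model P h)
    = (\<integral>\<^sup>+x. \<integral>\<^sup>+y. ennreal (logistic_pdf (y - h x)) * g (y, x) \<partial>lborel \<partial>P)"
proof -
  have g' [measurable]: "g \<in> borel_measurable (lborel \<Otimes>\<^sub>M P)"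
    using g by (simp cong: measurable_cong_sets sets_pair_measure_cong)
  have "(\<integral>\<^sup>+z. g z \<partial>logistic_model P h)
      = (\<integral>\<^sup>+z. (case z of (y, x) \<Rightarrow> ennreal (logistic_pdf (y - h x))) * g z \<partial>(lborel \<Otimes>\<^sub>M P))"
    unfolding logistic_model_def by (rule nn_integral_density) measurable
  also have "\<dots> = (\<integral>\<^sup>+x. \<integral>\<^sup>+y. (case (y, x) of (y, x) \<Rightarrow> ennreal (logistic_pdf (y - h x))) * g (y, x) \<partial>lborel \<partial>P)"
    by (rule pair.nn_integral_snd[symmetric]) measurable
  finally show ?thesis by simp
qed

lemma emeasure_logistic_model_Times:
  assumes A: "A \<in> sets borel" and B: "B \<in> sets borel"
  shows "emeasure (logistic_model P h) (A \<times> B)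
    = (\<integral>\<^sup>+x. emeasure (logistic_dist (h x)) A * indicator B x \<partial>P)"
proof -
  have AB: "A \<times> B \<in> sets obs" using A B by simp
  have "emeasure (logistic_model P h) (A \<times> B) = (\<integral>\<^sup>+z. indicator (A \<times> B) z \<partial>logistic_model P h)"
    by (rule nn_integral_indicator[symmetric]) (simp add: sets_logistic_model A B)
  also have "\<dots> = (\<integral>\<^sup>+x. \<integral>\<^sup>+y. ennreal (logistic_pdf (y - h x)) * indicator (A \<times> B) (y, x) \<partial>lborel \<partial>P)"
    by (rule nn_integral_logistic_model) (use AB in simp)
  also have "\<dots> = (\<integral>\<^sup>+x. emeasure (logistic_dist (h x)) A * indicator B x \<partial>P)"
  proof (rule nn_integral_cong)
    fix x
    have "(\<integral>\<^sup>+y. ennreal (logistic_pdf (y - h x)) * indicator (A \<times> B) (y, x) \<partial>lborel)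
        = (\<integral>\<^sup>+y. (ennreal (logistic_pdf (y - h x)) * indicator A y) * indicator B x \<partial>lborel)"
      by (intro nn_integral_cong) (simp add: indicator_times mult.assoc)
    also have "\<dots> = (\<integral>\<^sup>+y. ennreal (logistic_pdf (y - h x)) * indicator A y \<partial>lborel) * indicator B x"
      by (rule nn_integral_multc) (use A in measurable)
    also have "(\<integral>\<^sup>+y. ennreal (logistic_pdf (y - h x)) * indicator A y \<partial>lborel) = emeasure (logistic_dist (h x)) A"
      unfolding logistic_dist_def using A by (intro emeasure_density[symmetric]) auto
    finally show "(\<integral>\<^sup>+y. ennreal (logistic_pdf (y - h x)) * indicator (A \<times> B) (y, x) \<partial>lborel)
        = emeasure (logistic_dist (h x)) A * indicator B x" .
  qed
  finally show ?thesis .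
qed

lemma emeasure_logistic_model_UNIV_Times:
  assumes B: "B \<in> sets borel"
  shows "emeasure (logistic_model P h) (UNIV \<times> B) = emeasure P B"
proof -
  have "emeasure (logistic_dist (h x)) UNIV = 1" for x
    using prob_space.emeasure_space_1[OF prob_space_logistic_dist, of "h x"] by simp
  then show ?thesis using emeasure_logistic_model_Times[of UNIV B] B by simp
qed

lemma prob_space_logistic_model: "prob_space (logistic_model P h)"
proof (rule prob_spaceI)
  have "space (logistic_model P h) = UNIV \<times> UNIV"
    by (simp add: logistic_model_def space_pair_measure)
  then show "emeasure (logistic_model P h) (space (logistic_model P h)) = 1"
    using emeasure_logistic_model_UNIV_Times[of UNIV] P.emeasure_space_1 by simp
qed

lemma law_X_logistic_model: "law_X (logistic_model P h) = P"
proof (rule measure_eqI)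
  fix B assume "B \<in> sets (law_X (logistic_model P h))"
  then have B: "B \<in> sets borel" by simp
  have m: "snd \<in> logistic_model P h \<rightarrow>\<^sub>M borel"
    using measurable_snd[of borel borel] measurable_cong_sets[OF sets_logistic_model refl] by blast
  have "emeasure (law_X (logistic_model P h)) B
      = emeasure (logistic_model P h) (snd -` B \<inter> space (logistic_model P h))"
    unfolding law_X_def by (rule emeasure_distr[OF m B])
  also have "snd -` B \<inter> space (logistic_model P h) = UNIV \<times> B"
    by (auto simp: logistic_model_def space_pair_measure)
  finally show "emeasure (law_X (logistic_model P h)) B = emeasure P B"
    by (simp only: emeasure_logistic_model_UNIV_Times[OF B])
qed simp

lemma measurable_logistic_dist: "(\<lambda>x. logistic_dist (h x)) \<in> borel \<rightarrow>\<^sub>M prob_algebra borel"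
proof (intro measurable_prob_algebraI measurable_subprob_algebra)
  show "prob_space (logistic_dist (h x))" for x by (rule prob_space_logistic_dist)
  then show "subprob_space (logistic_dist (h x))" for x by (rule prob_space_imp_subprob_space)
  fix A :: "real set" assume A [measurable]: "A \<in> sets borel"
  have "(\<lambda>x. \<integral>\<^sup>+y. ennreal (logistic_pdf (y - h x)) * indicator A y \<partial>lborel) \<in> borel_measurable borel"
    by measurable
  then show "(\<lambda>x. emeasure (logistic_dist (h x)) A) \<in> borel_measurable borel"
    by (simp add: logistic_dist_def emeasure_density)
qed simp

lemma regular_cond_dist_logistic_model:
  "regular_cond_dist (logistic_model P h) (\<lambda>x. logistic_dist (h x))"
  unfolding regular_cond_dist_def law_X_logistic_model
  using measurable_logistic_dist emeasure_logistic_model_Times by blast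

lemma cond_quantile_logistic_model:
  "AE x in P. \<forall>u\<in>{0<..<1}. cond_quantile (logistic_model P h) u x = ln (u / (1 - u)) + h x"
  using cond_quantile_eq_AE[OF prob_space_logistic_model sets_logistic_model regular_cond_dist_logistic_model]
  unfolding law_X_logistic_model
  by eventually_elim (simp add: quantile_logistic_dist)

lemma cond_A5_logistic: "C \<ge> 1 \<Longrightarrow> cond_A5 C (\<lambda>x. logistic_dist (h x)) (\<lambda>x y. logistic_pdf (y - h x))"
  unfolding cond_A5_def
proof (intro allI exI conjI)
  fix x y assume C: "C \<ge> 1"
  let ?f' = "\<lambda>y. logistic_pdf (y - h x) * (1 - 2 * logistic_cdf (y - h x))"
  show "continuous_on UNIV ?f'"
    by (intro continuous_intros continuous_on_compose2[OF continuous_logistic_pdf[of UNIV]]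
        continuous_on_compose2[OF continuous_logistic_cdf[of UNIV]]) auto
  have "((\<lambda>y. logistic_cdf (y + - h x)) has_real_derivative logistic_pdf (y + - h x)) (at y)"
    using logistic_cdf_deriv[of "y + - h x"] by (simp only: DERIV_shift)
  then show "(cdf (logistic_dist (h x)) has_real_derivative logistic_pdf (y - h x)) (at y)"
    by (simp add: cdf_logistic_dist[abs_def])
  have "((\<lambda>y. logistic_pdf (y + - h x)) has_real_derivative
      logistic_pdf (y + - h x) * (1 - 2 * logistic_cdf (y + - h x))) (at y)"
    using logistic_pdf_deriv[of "y + - h x"] by (simp only: DERIV_shift)
  then show "((\<lambda>y. logistic_pdf (y - h x)) has_real_derivative ?f' y) (at y)"
    by simp
  show "max (logistic_pdf (y - h x)) \<bar>?f' y\<bar> \<le> C"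
    using logistic_pdf_le_1[of "y - h x"] logistic_pdf_deriv_le_1[of "y - h x"] C by simp
qed

lemma cond_A6_logistic:
  assumes "0 < \<epsilon>" "\<epsilon> < 1/2" "U \<subseteq> {\<epsilon>..1-\<epsilon>}" "inverse (\<epsilon> * \<epsilon>) \<le> C"
  shows "cond_A6 U C (\<lambda>x. logistic_dist (h x)) (\<lambda>x y. logistic_pdf (y - h x))"
  unfolding cond_A6_def
proof (intro allI ballI)
  fix x u assume "u \<in> U"
  then have u: "\<epsilon> \<le> u" "\<epsilon> \<le> 1 - u" using assms(3) by auto
  have "inverse C \<le> inverse (inverse (\<epsilon> * \<epsilon>))"
    using assms by (intro le_imp_inverse_le) auto
  also have "\<dots> \<le> u * (1 - u)"
    using mult_mono[OF u] u assms(1) by simp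
  finally show "inverse C \<le> logistic_pdf (quantile (logistic_dist (h x)) u - h x)"
    using u assms(1) by (simp add: quantile_logistic_dist logistic_pdf_quantile)
qed

end

lemma logistic_model_density:
  assumes h [measurable]: "h \<in> borel_measurable borel" and k [measurable]: "k \<in> borel_measurable borel"
  shows "logistic_model P k = density (logistic_model P h)
    (\<lambda>(y, x). ennreal (logistic_pdf (y - k x) / logistic_pdf (y - h x)))"
proof -
  have "density (logistic_model P h) (\<lambda>(y, x). ennreal (logistic_pdf (y - k x) / logistic_pdf (y - h x)))
    = density (lborel \<Otimes>\<^sub>M P) (\<lambda>z. (case z of (y, x) \<Rightarrow> ennreal (logistic_pdf (y - h x))) *
        (case z of (y, x) \<Rightarrow> ennreal (logistic_pdf (y - k x) / logistic_pdf (y - h x))))"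
    unfolding logistic_model_def by (rule density_density_eq) measurable
  also have "\<dots> = density (lborel \<Otimes>\<^sub>M P) (\<lambda>(y, x). ennreal (logistic_pdf (y - k x)))"
  proof (intro density_cong AE_I2)
    fix z :: "real \<times> D01"
    have pos: "logistic_pdf w > 0" for w by (rule logistic_pdf_pos)
    show "(case z of (y, x) \<Rightarrow> ennreal (logistic_pdf (y - h x))) *
        (case z of (y, x) \<Rightarrow> ennreal (logistic_pdf (y - k x) / logistic_pdf (y - h x)))
        = (case z of (y, x) \<Rightarrow> ennreal (logistic_pdf (y - k x)))"
      using pos[of "fst z - h (snd z)"] pos[of "fst z - k (snd z)"]
      by (cases z) (simp add: ennreal_mult'[symmetric])
  qed measurable
  finally show ?thesis by (simp add: logistic_model_def)
qed

text \<open>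
  The second moment of the likelihood ratio of two location functions, obtained by integrating the
  one-dimensional bound over the covariate. The uniform bound \<open>d\<close> on the difference is available because
  the scores of the process are bounded.
\<close>
lemma logistic_model_chi_square:
  assumes h [measurable]: "h \<in> borel_measurable borel" and k [measurable]: "k \<in> borel_measurable borel"
    and close: "AE x in P. \<bar>h x - k x\<bar> \<le> d" and d: "d \<le> 1"
  shows "(\<integral>\<^sup>+z. ennreal ((case z of (y, x) \<Rightarrow> logistic_pdf (y - k x) / logistic_pdf (y - h x))\<^sup>2)
    \<partial>logistic_model P h) \<le> ennreal (1 + 4 * d\<^sup>2)"
proof -
  have "(\<integral>\<^sup>+z. ennreal ((case z of (y, x) \<Rightarrow> logistic_pdf (y - k x) / logistic_pdf (y - h x))\<^sup>2) \<partial>logistic_model P h)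
    = (\<integral>\<^sup>+x. \<integral>\<^sup>+y. ennreal (logistic_pdf (y - h x)) *
        ennreal ((case (y, x) of (y, x) \<Rightarrow> logistic_pdf (y - k x) / logistic_pdf (y - h x))\<^sup>2) \<partial>lborel \<partial>P)"
    by (rule nn_integral_logistic_model[OF h]) measurable
  also have "\<dots> \<le> (\<integral>\<^sup>+x. ennreal (1 + 4 * d\<^sup>2) \<partial>P)"
  proof (rule nn_integral_mono_AE, use close in eventually_elim)
    fix x assume x: "\<bar>h x - k x\<bar> \<le> d"
    have "ennreal (logistic_pdf (y - h x)) * ennreal ((logistic_pdf (y - k x) / logistic_pdf (y - h x))\<^sup>2)
        = ennreal ((logistic_pdf (y - k x))\<^sup>2 / logistic_pdf (y - h x))" for y
      using logistic_pdf_pos[of "y - h x"]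
      by (simp add: ennreal_mult'[symmetric] power2_eq_square)
    then have "(\<integral>\<^sup>+y. ennreal (logistic_pdf (y - h x)) *
        ennreal ((case (y, x) of (y, x) \<Rightarrow> logistic_pdf (y - k x) / logistic_pdf (y - h x))\<^sup>2) \<partial>lborel)
        = (\<integral>\<^sup>+y. ennreal ((logistic_pdf (y - k x))\<^sup>2 / logistic_pdf (y - h x)) \<partial>lborel)"
      by simp
    also have "\<dots> \<le> ennreal (1 + 4 * (h x - k x)\<^sup>2)"
      by (rule logistic_chi_square_bound) (use x d in linarith)
    also have "\<dots> \<le> ennreal (1 + 4 * d\<^sup>2)"
      using power_mono[OF x, of 2] by (intro ennreal_leI) simp
    finally show "(\<integral>\<^sup>+y. ennreal (logistic_pdf (y - h x)) *
        ennreal ((case (y, x) of (y, x) \<Rightarrow> logistic_pdf (y - k x) / logistic_pdf (y - h x))\<^sup>2) \<partial>lborel)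
        \<le> ennreal (1 + 4 * d\<^sup>2)" .
  qed
  also have "\<dots> = ennreal (1 + 4 * d\<^sup>2)" using P.emeasure_space_1 by simp
  finally show ?thesis .
qed

end

section \<open>Testing between samples of two location models\<close>

text \<open>
  Likelihood ratios of samples are products, and by independence so are their second moments.
\<close>
lemma PiM_density_power:
  fixes F :: "'a measure" and L :: "'a \<Rightarrow> real"
  assumes F: "prob_space F" and L [measurable]: "L \<in> borel_measurable F" and L0: "\<And>z. 0 \<le> L z"
    and G: "prob_space (density F (\<lambda>z. ennreal (L z)))" and I: "finite I"
  shows "PiM I (\<lambda>_. density F (\<lambda>z. ennreal (L z)))
    = density (PiM I (\<lambda>_. F)) (\<lambda>d. ennreal (\<Prod>i\<in>I. L (d i)))"
    and "(\<integral>\<^sup>+d. ennreal ((\<Prod>i\<in>I. L (d i))\<^sup>2) \<partial>PiM I (\<lambda>_. F))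
      = (\<integral>\<^sup>+z. ennreal ((L z)\<^sup>2) \<partial>F) ^ card I"
proof -
  interpret F: product_prob_space "\<lambda>_. F" I
    using F by (intro product_prob_spaceI)
  interpret G: product_prob_space "\<lambda>_. density F (\<lambda>z. ennreal (L z))" I
    using G by (intro product_prob_spaceI)
  have [measurable]: "(\<lambda>d. \<Prod>i\<in>I. L (d i)) \<in> borel_measurable (PiM I (\<lambda>_. F))"
    by measurable
  show "PiM I (\<lambda>_. density F (\<lambda>z. ennreal (L z)))
    = density (PiM I (\<lambda>_. F)) (\<lambda>d. ennreal (\<Prod>i\<in>I. L (d i)))"
  proof (rule G.PiM_eqI[symmetric])
    show "sets (density (PiM I (\<lambda>_. F)) (\<lambda>d. ennreal (\<Prod>i\<in>I. L (d i))))
        = sets (PiM I (\<lambda>_. density F (\<lambda>z. ennreal (L z))))"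
      by (simp cong: sets_PiM_cong)
    fix A assume "\<And>i. i \<in> I \<Longrightarrow> A i \<in> sets (density F (\<lambda>z. ennreal (L z)))"
    then have A: "i \<in> I \<Longrightarrow> A i \<in> sets F" for i by simp
    have PA: "Pi\<^sub>E I A \<in> sets (PiM I (\<lambda>_. F))" using A I by (intro sets_PiM_I_finite) auto
    have "emeasure (density (PiM I (\<lambda>_. F)) (\<lambda>d. ennreal (\<Prod>i\<in>I. L (d i)))) (Pi\<^sub>E I A)
        = (\<integral>\<^sup>+d. ennreal (\<Prod>i\<in>I. L (d i)) * indicator (Pi\<^sub>E I A) d \<partial>PiM I (\<lambda>_. F))"
      by (rule emeasure_density) (use PA in measurable)
    also have "\<dots> = (\<integral>\<^sup>+d. (\<Prod>i\<in>I. ennreal (L (d i)) * indicator (A i) (d i)) \<partial>PiM I (\<lambda>_. F))"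
    proof (rule nn_integral_cong)
      fix d assume "d \<in> space (PiM I (\<lambda>_. F))"
      then have "indicator (Pi\<^sub>E I A) d = (\<Prod>i\<in>I. indicator (A i) (d i) :: ennreal)"
        using I by (auto simp: space_PiM PiE_iff indicator_def prod_zero_iff)
      then show "ennreal (\<Prod>i\<in>I. L (d i)) * indicator (Pi\<^sub>E I A) d
          = (\<Prod>i\<in>I. ennreal (L (d i)) * indicator (A i) (d i))"
        by (simp add: prod.distrib prod_ennreal L0)
    qed
    also have "\<dots> = (\<Prod>i\<in>I. \<integral>\<^sup>+z. ennreal (L z) * indicator (A i) z \<partial>F)"
      by (rule F.product_nn_integral_prod[OF I]) (use A in measurable)
    also have "\<dots> = (\<Prod>i\<in>I. emeasure (density F (\<lambda>z. ennreal (L z))) (A i))"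
      by (intro prod.cong refl emeasure_density[symmetric]) (use A in auto)
    finally show "emeasure (density (PiM I (\<lambda>_. F)) (\<lambda>d. ennreal (\<Prod>i\<in>I. L (d i)))) (Pi\<^sub>E I A)
        = (\<Prod>i\<in>I. emeasure (density F (\<lambda>z. ennreal (L z))) (A i))" .
  qed (rule I)
  have "ennreal ((\<Prod>i\<in>I. L (d i))\<^sup>2) = (\<Prod>i\<in>I. ennreal ((L (d i))\<^sup>2))" for d
    by (simp add: prod_ennreal prod_power_distrib)
  then have "(\<integral>\<^sup>+d. ennreal ((\<Prod>i\<in>I. L (d i))\<^sup>2) \<partial>PiM I (\<lambda>_. F))
      = (\<integral>\<^sup>+d. (\<Prod>i\<in>I. ennreal ((L (d i))\<^sup>2)) \<partial>PiM I (\<lambda>_. F))" by simp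
  also have "\<dots> = (\<Prod>i\<in>I. \<integral>\<^sup>+z. ennreal ((L z)\<^sup>2) \<partial>F)"
    by (rule F.product_nn_integral_prod[OF I]) measurable
  finally show "(\<integral>\<^sup>+d. ennreal ((\<Prod>i\<in>I. L (d i))\<^sup>2) \<partial>PiM I (\<lambda>_. F))
      = (\<integral>\<^sup>+z. ennreal ((L z)\<^sup>2) \<partial>F) ^ card I"
    by simp
qed

context design
begin

text \<open>
  When the location functions differ by \<open>d\<close> with \<open>n d\<^sup>2 \<le> 2\<close>, the second moment of the
  likelihood ratio of \<open>n\<close> observations is at most \<open>(1 + 4 d\<^sup>2) ^ n \<le> exp 8\<close>.
\<close>
lemma sample_testing_bound:
  assumes h [measurable]: "h \<in> borel_measurable borel" and k [measurable]: "k \<in> borel_measurable borel"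
    and close: "AE x in P. \<bar>h x - k x\<bar> \<le> d" and d: "d \<le> 1" and n: "real n * d\<^sup>2 \<le> 2"
    and A: "A \<in> sets (sample n obs)"
  shows "3 / (4 * exp 8) \<le> measure (sample n (logistic_model P h)) A
    + measure (sample n (logistic_model P k)) (space (sample n obs) - A)"
proof -
  let ?F = "logistic_model P h"
  define L where "L = (\<lambda>z. case z of (y, x) \<Rightarrow> logistic_pdf (y - k x) / logistic_pdf (y - h x))"
  have Lm: "L \<in> borel_measurable obs" unfolding L_def by measurable
  then have L: "L \<in> borel_measurable ?F"
    using measurable_cong_sets[OF sets_logistic_model refl] by blast
  have L0: "0 \<le> L z" for z
    using logistic_pdf_pos by (auto simp: L_def split: prod.split intro!: divide_nonneg_nonneg less_imp_le)
  have G: "logistic_model P k = density ?F (\<lambda>z. ennreal (L z))"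
    unfolding L_def using logistic_model_density[OF h k] by (simp add: case_prod_unfold)
  have prob: "prob_space ?F" "prob_space (density ?F (\<lambda>z. ennreal (L z)))"
    using prob_space_logistic_model[OF h] prob_space_logistic_model[OF k] by (simp_all only: G)
  have fin: "finite {1..n}" by simp
  note prod = PiM_density_power[OF prob(1) L L0 prob(2) fin]
  let ?S = "sample n ?F" and ?\<Lambda> = "\<lambda>d. \<Prod>i\<in>{1..n}. L (d i)"
  have sets_S: "sets ?S = sets (sample n obs)"
    by (intro sets_PiM_cong refl sets_logistic_model)
  have "(\<integral>\<^sup>+z. ennreal ((L z)\<^sup>2) \<partial>?F) \<le> ennreal (1 + 4 * d\<^sup>2)"
    unfolding L_def by (rule logistic_model_chi_square[OF h k close d])
  then have "(\<integral>\<^sup>+z. ennreal ((L z)\<^sup>2) \<partial>?F) ^ n \<le> ennreal (1 + 4 * d\<^sup>2) ^ n"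
    by (rule power_mono) simp
  also have "\<dots> = ennreal ((1 + 4 * d\<^sup>2) ^ n)" by (rule ennreal_power) simp
  also have "\<dots> \<le> ennreal (exp 8)"
  proof (rule ennreal_leI)
    have "(1 + 4 * d\<^sup>2) ^ n \<le> exp (4 * d\<^sup>2) ^ n"
      by (intro power_mono exp_ge_add_one_self) simp
    also have "\<dots> = exp (real n * (4 * d\<^sup>2))" by (rule exp_of_nat_mult[symmetric])
    also have "\<dots> \<le> exp 8" using n by simp
    finally show "(1 + 4 * d\<^sup>2) ^ n \<le> exp 8" .
  qed
  finally have L2: "(\<integral>\<^sup>+d. ennreal ((?\<Lambda> d)\<^sup>2) \<partial>?S) \<le> ennreal (exp 8)"
    unfolding prod(2) by simp
  have "3 / (4 * exp 8) \<le> measure ?S A + measure (density ?S (\<lambda>d. ennreal (?\<Lambda> d))) (space ?S - A)"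
  proof (rule two_point_testing_bound[OF _ _ _ _ L2])
    show "prob_space ?S" by (rule prob_space_PiM) (rule prob(1))
    show "?\<Lambda> \<in> borel_measurable ?S" using L by measurable
    show "0 \<le> ?\<Lambda> d" for d by (intro prod_nonneg ballI L0)
    show "prob_space (density ?S (\<lambda>d. ennreal (?\<Lambda> d)))"
      unfolding prod(1)[symmetric] by (rule prob_space_PiM) (rule prob(2))
    show "A \<in> sets ?S" using A by (simp only: sets_S)
  qed simp
  then show ?thesis
    unfolding prod(1)[symmetric] G[symmetric] using sets_eq_imp_space_eq[OF sets_S] by simp
qed

end

section \<open>The covariate process as a random element of the Skorohod space\<close>

lemma restrict_continuous_cadlag:
  assumes "continuous_on {0..1} f"
  shows "restrict f {0..1} \<in> {x. x \<in> extensional {0..1} \<and> cadlag_unit x}"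
proof -
  have lim: "(f \<longlongrightarrow> f t) (at t within {0..1})" if "t \<in> {0..1}" for t
    using assms that by (simp add: continuous_on_def)
  have R: "(restrict f {0..1} \<longlongrightarrow> f t) (at_right t)" if t: "t \<in> {0..<1}" for t
  proof (rule Lim_transform_eventually)
    have "at t within {t..1} = at_right t" using t by (intro at_within_Icc_at_right) auto
    then show "(f \<longlongrightarrow> f t) (at_right t)"
      using tendsto_within_subset[OF lim, of t "{t..1}"] t by auto
    have "eventually (\<lambda>s. s \<in> {t<..<1}) (at_right t)"
      using t by (intro eventually_at_right_real) auto
    then show "eventually (\<lambda>s. f s = restrict f {0..1} s) (at_right t)"
      by eventually_elim (use t in auto)
  qed
  have L: "(restrict f {0..1} \<longlongrightarrow> f t) (at_left t)" if t: "t \<in> {0<..1}" for t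
  proof (rule Lim_transform_eventually)
    have "at t within {0..t} = at_left t" using t by (intro at_within_Icc_at_left) auto
    then show "(f \<longlongrightarrow> f t) (at_left t)"
      using tendsto_within_subset[OF lim, of t "{0..t}"] t by auto
    have "eventually (\<lambda>s. s \<in> {0<..<t}) (at_left t)"
      using t by (intro eventually_at_left_real) auto
    then show "eventually (\<lambda>s. f s = restrict f {0..1} s) (at_left t)"
      by eventually_elim (use t in auto)
  qed
  have "cadlag_unit (restrict f {0..1})"
    unfolding cadlag_unit_def
  proof (intro conjI ballI)
    show "(restrict f {0..1} \<longlongrightarrow> restrict f {0..1} t) (at_right t)" if "t \<in> {0..<1}" for t
      using R[OF that] that by simp
    show "\<exists>l. (restrict f {0..1} \<longlongrightarrow> l) (at_left t)" if "t \<in> {0<..1}" for t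
      using L[OF that] by blast
  qed
  then show ?thesis by simp
qed

definition sin_coef :: "nat \<Rightarrow> D01 \<Rightarrow> real" where
  "sin_coef j x = (\<integral>t. path x t * sin_basis j t \<partial>unit_leb)"

lemma measurable_sin_coef [measurable]: "sin_coef j \<in> borel_measurable borel"
proof -
  interpret prob_space unit_leb by (rule prob_space_unit_leb)
  have "(\<lambda>z. sin_basis j (snd z)) \<in> borel_measurable (borel \<Otimes>\<^sub>M unit_leb :: (D01 \<times> real) measure)"
    by (rule measurable_compose[OF measurable_snd continuous_measurable_unit_leb[OF continuous_sin_basis]])
  then have "(\<lambda>(x, t). path x t * sin_basis j t) \<in> borel_measurable (borel \<Otimes>\<^sub>M unit_leb)"
    using measurable_path_joint by (simp add: case_prod_unfold)
  then show ?thesis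
    unfolding sin_coef_def [abs_def] by (rule borel_measurable_lebesgue_integral)
qed

lemma integrable_path: "integrable unit_leb (path x)"
proof -
  obtain B where "\<And>t. t \<in> {0..1} \<Longrightarrow> \<bar>path x t\<bar> \<le> B"
    using cadlag_bounded[OF cadlag_path[of x]] by blast
  then show ?thesis by (rule bounded_integrable_unit_leb[OF measurable_path])
qed

definition sin_sum_fun :: "real \<Rightarrow> nat set \<Rightarrow> real \<Rightarrow> real" where
  "sin_sum_fun \<delta> \<theta> t = (\<Sum>j\<in>\<theta>. \<delta> * sin_basis j t)"

definition sin_sum_form :: "real \<Rightarrow> nat set \<Rightarrow> D01 \<Rightarrow> real" where
  "sin_sum_form \<delta> \<theta> x = (\<Sum>j\<in>\<theta>. \<delta> * sin_coef j x)"

lemma measurable_sin_sum_form [measurable]: "sin_sum_form \<delta> \<theta> \<in> borel_measurable borel"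
  unfolding sin_sum_form_def [abs_def] by measurable

lemma continuous_sin_sum_fun: "continuous_on A (sin_sum_fun \<delta> \<theta>)"
  unfolding sin_sum_fun_def [abs_def] by (intro continuous_intros continuous_sin_basis)

lemma integral_path_sin_sum_fun:
  "(\<integral>t. path x t * sin_sum_fun \<delta> \<theta> t \<partial>unit_leb) = sin_sum_form \<delta> \<theta> x"
proof -
  have eq: "path x t * sin_sum_fun \<delta> \<theta> t = (\<Sum>j\<in>\<theta>. \<delta> * (path x t * sin_basis j t))" for t
    by (simp add: sin_sum_fun_def sum_distrib_left mult_ac)
  have int: "integrable unit_leb (\<lambda>t. \<delta> * (path x t * sin_basis j t))" for j
    by (intro integrable_mult_right integrable_mult_continuous integrable_path continuous_sin_basis)
  show ?thesis
    unfolding eq Bochner_Integration.integral_sum[OF int] sin_sum_form_def sin_coef_def by simp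
qed

lemma in_L2_sin_sum_fun: "in_L2 (sin_sum_fun \<delta> \<theta>)"
  unfolding in_L2_def
  by (intro conjI continuous_measurable_unit_leb continuous_integrable_unit_leb
      continuous_on_power continuous_sin_sum_fun)

context polynomial_decay
begin

definition traj :: "real \<Rightarrow> D01" where
  "traj v = Abs_D01 (restrict (proc v) {0..1})"

lemma path_traj: "t \<in> {0..1} \<Longrightarrow> path (traj v) t = proc v t"
  unfolding traj_def
  by (subst Abs_D01_inverse[OF restrict_continuous_cadlag[OF continuous_proc_time]]) simp

lemma continuous_traj: "continuous_on {0..1} traj"
  unfolding continuous_on_iff
proof (intro ballI allI impI)
  fix v e :: real assume v: "v \<in> {0..1}" and e: "e > 0"
  have "uniformly_continuous_on {-1..2} wave"
    by (intro compact_uniformly_continuous continuous_on_subset[OF continuous_wave]) auto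
  moreover have "e / 4 > 0" using e by simp
  ultimately obtain d where d: "d > 0"
    "\<And>x y. x \<in> {-1..2} \<Longrightarrow> y \<in> {-1..2} \<Longrightarrow> dist y x < d \<Longrightarrow> dist (wave y) (wave x) < e / 4"
    unfolding uniformly_continuous_on_def by metis
  have "dist (traj w) (traj v) < e" if w: "w \<in> {0..1}" "dist w v < d" for w
  proof -
    have "\<bar>proc w t - proc v t\<bar> \<le> e / 2" if t: "t \<in> {0..1}" for t
    proof -
      have "dist (wave (t + w)) (wave (t + v)) < e / 4"
        by (rule d(2)) (use v w t in \<open>auto simp: dist_real_def\<close>)
      moreover have "dist (wave (t - w)) (wave (t - v)) < e / 4"
        by (rule d(2)) (use v w t in \<open>auto simp: dist_real_def\<close>)
      ultimately show ?thesis unfolding proc_def dist_real_def by linarith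
    qed
    then have "skorohod_close (e / 2) (traj w) (traj v)"
      unfolding skorohod_close_def using e
      by (intro exI[of _ "\<lambda>t. t"]) (auto simp: time_change_id path_traj)
    then have "dist (traj w) (traj v) \<le> e / 2" by (rule dist_D01_le)
    then show ?thesis using e by simp
  qed
  then show "\<exists>d>0. \<forall>w\<in>{0..1}. dist w v < d \<longrightarrow> dist (traj w) (traj v) < e"
    using d(1) by blast
qed

lemma measurable_traj: "traj \<in> unit_leb \<rightarrow>\<^sub>M borel"
  by (rule continuous_measurable_unit_leb[OF continuous_traj])

definition PX :: "D01 measure" where
  "PX = distr unit_leb borel traj"

sublocale design PX
proof (rule design.intro)
  show "prob_space PX"
    unfolding PX_def by (rule prob_space.prob_space_distr[OF prob_space_unit_leb measurable_traj])
qed (simp add: PX_def)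

lemma nn_integral_PX:
  "f \<in> borel_measurable borel \<Longrightarrow> (\<integral>\<^sup>+x. f x \<partial>PX) = (\<integral>\<^sup>+v. f (traj v) \<partial>unit_leb)"
  unfolding PX_def by (rule nn_integral_distr[OF measurable_traj]) simp

lemma integral_PX:
  fixes f :: "D01 \<Rightarrow> real"
  shows "f \<in> borel_measurable borel \<Longrightarrow> (\<integral>x. f x \<partial>PX) = (\<integral>v. f (traj v) \<partial>unit_leb)"
  unfolding PX_def by (rule integral_distr[OF measurable_traj])

lemma AE_PX_traj:
  assumes "AE x in PX. Q x" shows "AE v in unit_leb. Q (traj v)"
  using assms unfolding PX_def by (rule AE_distrD[OF measurable_traj])

text \<open>
  The range of the trajectories is a compact set of full measure, so a property of all trajectories holds
  almost surely whether or not it defines a Borel set of paths.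
\<close>
lemma AE_PX_I:
  assumes "\<And>v. v \<in> {0..1} \<Longrightarrow> Q (traj v)"
  shows "AE x in PX. Q x"
proof -
  have "compact (traj ` {0..1})" by (rule compact_continuous_image[OF continuous_traj]) simp
  then have cl: "traj ` {0..1} \<in> sets borel" by (intro borel_closed compact_imp_closed)
  have "AE x in PX. x \<in> traj ` {0..1}"
    unfolding PX_def
    by (subst AE_distr_iff[OF measurable_traj]) (use cl in auto)
  then show ?thesis by eventually_elim (use assms in blast)
qed

text \<open>
  The scores of the process: bounded, and uncorrelated as functions of the uniform phase.
\<close>
lemma sin_coef_traj: "j \<ge> 1 \<Longrightarrow> sin_coef j (traj v) = rs_sign j * amp j * cos_basis j v"
proof -
  assume j: "j \<ge> 1"
  have "sin_coef j (traj v) = (\<integral>t. proc v t * sin_basis j t \<partial>unit_leb)"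
    unfolding sin_coef_def by (rule Bochner_Integration.integral_cong) (simp_all add: path_traj)
  then show ?thesis by (simp only: integral_proc_sin[OF j])
qed

lemma abs_sin_coef_traj_le: "j \<ge> 1 \<Longrightarrow> \<bar>sin_coef j (traj v)\<bar> \<le> sqrt 2 * amp j"
  using mult_right_mono[OF cos_basis_le[of j v] amp_nonneg[of j]] amp_nonneg[of j]
  by (simp add: sin_coef_traj abs_mult abs_rs_sign mult.commute)

context
  fixes F assumes law: "law_X F = PX"
begin

lemma mean_fun_zero: "t \<in> {0..1} \<Longrightarrow> mean_fun F t = 0"
  unfolding mean_fun_def law
  by (simp add: integral_PX measurable_path_eval path_traj integral_proc_zero)

lemma centred_eq: "t \<in> {0..1} \<Longrightarrow> centred F x t = path x t"
  by (simp add: centred_def mean_fun_zero)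

lemma cov_kernel_eq: "s \<in> {0..1} \<Longrightarrow> t \<in> {0..1} \<Longrightarrow> cov_kernel F s t = kern s t"
  unfolding cov_kernel_def kern_def law
  by (simp add: centred_eq path_traj
      integral_PX[OF borel_measurable_times[OF measurable_path_eval measurable_path_eval]])

lemma score_eq: "score F (sin_basis j) x = sin_coef j x"
  unfolding score_def sin_coef_def
  by (rule Bochner_Integration.integral_cong) (simp_all add: centred_eq)

end

lemma kern_le: "\<bar>kern s t\<bar> \<le> kern_tail 0"
  using kern_partial_diff_le[of s t 0] by (simp add: kern_partial_def)

lemma kern_tail_le: "kern_tail N \<le> kern_tail 0"
  unfolding kern_tail_def using kap_nonneg by (simp add: sum_nonneg)

lemma kern_eigen:
  assumes "j \<ge> 1"
  shows "(\<integral>t. kern s t * sin_basis j t \<partial>unit_leb) = kap j * sin_basis j s"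
proof (rule sines.coefficient_of_bounded_limit[OF _ _ assms])
  show "(\<lambda>N. \<Sum>i=1..N. kap i * sin_basis i s * sin_basis i t) \<longlonglongrightarrow> kern s t" for t
    using kern_partial_tendsto[of s t] by (simp only: kern_partial_def)
  show "\<bar>\<Sum>i=1..N. kap i * sin_basis i s * sin_basis i t\<bar> \<le> 2 * kern_tail 0" for N t
    using kern_partial_diff_le[of s t N] kern_le[of s t] kern_tail_le[of N]
    unfolding kern_partial_def by linarith
qed

lemma kap_antimono: "1 \<le> j \<Longrightarrow> kap (Suc j) \<le> kap j"
  unfolding kap_def using \<alpha> by (intro powr_mono2') auto

lemma spectral_expansion_process:
  assumes law: "law_X F = PX"
  shows "spectral_expansion F kap sin_basis"
  unfolding spectral_expansion_def
proof (intro conjI allI impI)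
  fix j :: nat assume j: "1 \<le> j"
  show "kap (Suc j) \<le> kap j" by (rule kap_antimono[OF j])
  show "0 \<le> kap (Suc j)" by (rule kap_nonneg)
  show "in_L2 (sin_basis j)" by (rule in_L2_sin_basis)
  show "(\<integral>t. sin_basis i t * sin_basis j t \<partial>unit_leb) = (if i = j then 1 else 0)" if "1 \<le> i" for i
    by (rule integral_sin_basis[OF that j])
  show "AE s in unit_leb. (\<integral>t. cov_kernel F s t * sin_basis j t \<partial>unit_leb) = kap j * sin_basis j s"
  proof (rule AE_I2)
    fix s assume "s \<in> space unit_leb"
    then have s: "s \<in> {0..1}" by simp
    have "(\<integral>t. cov_kernel F s t * sin_basis j t \<partial>unit_leb) = (\<integral>t. kern s t * sin_basis j t \<partial>unit_leb)"
      by (rule Bochner_Integration.integral_cong) (simp_all add: cov_kernel_eq[OF law s])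
    then show "(\<integral>t. cov_kernel F s t * sin_basis j t \<partial>unit_leb) = kap j * sin_basis j s"
      by (simp only: kern_eigen[OF j])
  qed
next
  fix f assume "in_L2 f" "\<forall>j\<ge>1. (\<integral>t. f t * sin_basis j t \<partial>unit_leb) = 0"
  then show "AE t in unit_leb. f t = 0" by (intro sin_basis_complete) auto
next
  let ?I = "\<lambda>N. \<integral>\<^sup>+s. \<integral>\<^sup>+t. ennreal ((cov_kernel F s t - (\<Sum>j=1..N. kap j * sin_basis j s * sin_basis j t))\<^sup>2)
        \<partial>unit_leb \<partial>unit_leb"
  have one: "emeasure unit_leb {0..1} = 1"
    using prob_space.emeasure_space_1[OF prob_space_unit_leb] by simp
  have "?I N \<le> ennreal ((kern_tail N)\<^sup>2)" for N
  proof -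
    have "?I N \<le> (\<integral>\<^sup>+s. \<integral>\<^sup>+t. ennreal ((kern_tail N)\<^sup>2) \<partial>unit_leb \<partial>unit_leb)"
    proof (intro nn_integral_mono ennreal_leI)
      fix s t assume "s \<in> space unit_leb" "t \<in> space unit_leb"
      then have "cov_kernel F s t - (\<Sum>j=1..N. kap j * sin_basis j s * sin_basis j t) = kern s t - kern_partial N s t"
        by (simp add: cov_kernel_eq[OF law] kern_partial_def)
      then show "(cov_kernel F s t - (\<Sum>j=1..N. kap j * sin_basis j s * sin_basis j t))\<^sup>2 \<le> (kern_tail N)\<^sup>2"
        using power_mono[OF kern_partial_diff_le[of s t N] abs_ge_zero, of 2] by simp
    qed
    then show ?thesis by (simp add: one)
  qed
  moreover have "(\<lambda>N. ennreal ((kern_tail N)\<^sup>2)) \<longlonglongrightarrow> ennreal (0\<^sup>2)"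
    by (intro tendsto_ennrealI tendsto_power kern_tail_tendsto)
  ultimately show "?I \<longlonglongrightarrow> 0"
    by (intro tendsto_sandwich[of "\<lambda>_. 0" ?I sequentially "\<lambda>N. ennreal ((kern_tail N)\<^sup>2)"]) simp_all
qed

text \<open>
  Multiplying by \<open>\<surd>2 cos (\<pi> j v)\<close> and integrating over the phase removes the constant \<open>c\<close> and isolates the
  \<open>j\<close>-th sine coefficient of \<open>k\<close>, up to the nonzero factor \<open>\<epsilon>\<^bsub>j\<^esub> \<surd>\<kappa>\<^bsub>j\<^esub>\<close>. So no nonzero slope gives an
  almost surely constant linear form.
\<close>
lemma slope_identified:
  assumes k: "in_L2 k" and AE: "AE v in unit_leb. c + (\<integral>t. k t * proc v t \<partial>unit_leb) = 0"
  shows "AE t in unit_leb. k t = 0"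
proof (rule sin_basis_complete[OF k])
  fix j :: nat assume j: "j \<ge> 1"
  have ki: "integrable unit_leb k" using k by (rule in_L2_integrable)
  then have km [measurable]: "k \<in> borel_measurable unit_leb" by simp
  define K where "K = (\<integral>t. \<bar>k t\<bar> \<partial>unit_leb)"
  define a where "a i = (\<integral>t. k t * proc_coef i t \<partial>unit_leb)" for i
  define W where "W v = (\<integral>t. k t * proc v t \<partial>unit_leb)" for v
  define WN where "WN N v = (\<integral>t. k t * proc_partial N v t \<partial>unit_leb)" for N v
  have WN: "WN N v = (\<Sum>i\<in>{1..N}. a i * cos_basis i v)" for N v
  proof -
    have "integrable unit_leb (\<lambda>t. k t * proc_coef i t)" for i
      unfolding proc_coef_def [abs_def]
      by (intro integrable_mult_continuous[OF ki] continuous_intros continuous_sin_basis)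
    then have int: "integrable unit_leb (\<lambda>t. (k t * proc_coef i t) * cos_basis i v)" for i
      by (rule integrable_mult_left)
    have "k t * proc_partial N v t = (\<Sum>i\<in>{1..N}. (k t * proc_coef i t) * cos_basis i v)" for t
      by (simp only: proc_partial_def sum_distrib_left mult_ac)
    then show ?thesis
      unfolding WN_def a_def by (simp only: Bochner_Integration.integral_sum[OF int] integral_mult_left_zero)
  qed
  have WN_lim: "(\<lambda>N. WN N v) \<longlonglongrightarrow> W v" for v
    unfolding WN_def W_def
  proof (rule integral_dominated_convergence[where w="\<lambda>t. \<bar>k t\<bar> * proc_bound"])
    show "AE t in unit_leb. (\<lambda>N. k t * proc_partial N v t) \<longlonglongrightarrow> k t * proc v t"
      by (intro AE_I2 tendsto_mult tendsto_const proc_partial_tendsto)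
    show "AE t in unit_leb. norm (k t * proc_partial N v t) \<le> \<bar>k t\<bar> * proc_bound" for N
      unfolding real_norm_def abs_mult
      by (intro AE_I2 mult_left_mono proc_partial_le) auto
    show "(\<lambda>t. k t * proc v t) \<in> borel_measurable unit_leb"
      "\<And>N. (\<lambda>t. k t * proc_partial N v t) \<in> borel_measurable unit_leb"
      by (intro borel_measurable_times km continuous_measurable_unit_leb
          continuous_proc_time continuous_proc_partial_time)+
    show "integrable unit_leb (\<lambda>t. \<bar>k t\<bar> * proc_bound)" using ki by simp
  qed
  have WN_le: "\<bar>WN N v\<bar> \<le> K * proc_bound" for N v
  proof -
    have "\<bar>WN N v\<bar> \<le> (\<integral>t. \<bar>k t * proc_partial N v t\<bar> \<partial>unit_leb)"
      unfolding WN_def by (rule integral_abs_bound)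
    also have "\<dots> \<le> (\<integral>t. \<bar>k t\<bar> * proc_bound \<partial>unit_leb)"
    proof (rule integral_mono)
      show "integrable unit_leb (\<lambda>t. \<bar>k t * proc_partial N v t\<bar>)"
        by (rule integrable_abs[OF integrable_mult_continuous[OF ki continuous_proc_partial_time]])
      show "\<bar>k t * proc_partial N v t\<bar> \<le> \<bar>k t\<bar> * proc_bound" for t
        unfolding abs_mult by (intro mult_left_mono proc_partial_le) auto
    qed (use ki in simp)
    finally show ?thesis by (simp add: K_def)
  qed
  have "a j = (\<integral>v. W v * cos_basis j v \<partial>unit_leb)"
    by (rule cosines.coefficient_of_bounded_limit[OF WN_lim[unfolded WN] WN_le[unfolded WN] j, symmetric])
  also have "\<dots> = (\<integral>v. (- c) * cos_basis j v \<partial>unit_leb)"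
  proof (rule integral_cong_AE)
    show "AE v in unit_leb. W v * cos_basis j v = (- c) * cos_basis j v"
      using AE by eventually_elim (simp add: W_def add_eq_0_iff)
    have cont: "continuous_on {0..1} (\<lambda>v. \<Sum>i=1..N. a i * cos_basis i v)" for N
      by (intro continuous_intros continuous_cos_basis)
    have "W \<in> borel_measurable unit_leb"
      by (rule borel_measurable_LIMSEQ_real[OF WN_lim[unfolded WN] continuous_measurable_unit_leb[OF cont]])
    then show "(\<lambda>v. W v * cos_basis j v) \<in> borel_measurable unit_leb"
      by (intro borel_measurable_times continuous_measurable_unit_leb[OF continuous_cos_basis])
    show "(\<lambda>v. (- c) * cos_basis j v) \<in> borel_measurable unit_leb"
      by (intro continuous_measurable_unit_leb continuous_intros continuous_cos_basis)
  qed
  also have "\<dots> = 0" using integral_cos_basis_zero[OF j] by simp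
  finally have "(\<integral>t. k t * proc_coef j t \<partial>unit_leb) = 0" by (simp add: a_def)
  moreover have "k t * proc_coef j t = (rs_sign j * amp j) * (k t * sin_basis j t)" for t
    by (simp only: proc_coef_def mult_ac)
  moreover have "rs_sign j * amp j \<noteq> 0"
    using abs_rs_sign[of j] j by (auto simp: amp_def)
  ultimately show "(\<integral>t. k t * sin_basis j t \<partial>unit_leb) = 0" by simp
qed

end

section \<open>Membership in the model class and identification of the slope\<close>

lemma in_L2_diff:
  assumes "in_L2 f" "in_L2 g" shows "in_L2 (\<lambda>t. f t - g t)"
  unfolding in_L2_def
proof
  have m: "f \<in> borel_measurable unit_leb" "g \<in> borel_measurable unit_leb"
    and i: "integrable unit_leb (\<lambda>t. (f t)\<^sup>2)" "integrable unit_leb (\<lambda>t. (g t)\<^sup>2)"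
    using assms by (auto simp: in_L2_def)
  show "(\<lambda>t. f t - g t) \<in> borel_measurable unit_leb" using m by simp
  show "integrable unit_leb (\<lambda>t. (f t - g t)\<^sup>2)"
  proof (rule Bochner_Integration.integrable_bound[of _ "\<lambda>t. 2 * (f t)\<^sup>2 + 2 * (g t)\<^sup>2"])
    show "integrable unit_leb (\<lambda>t. 2 * (f t)\<^sup>2 + 2 * (g t)\<^sup>2)" using i by simp
    show "(\<lambda>t. (f t - g t)\<^sup>2) \<in> borel_measurable unit_leb" using m by simp
    have "(f t - g t)\<^sup>2 \<le> 2 * (f t)\<^sup>2 + 2 * (g t)\<^sup>2" for t
      using zero_le_power2[of "f t + g t"] by (simp add: power2_eq_square algebra_simps)
    then show "AE t in unit_leb. norm ((f t - g t)\<^sup>2) \<le> norm (2 * (f t)\<^sup>2 + 2 * (g t)\<^sup>2)"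
      by (intro AE_I2) simp
  qed
qed

lemma integral_sin_sum_fun:
  assumes \<theta>: "finite \<theta>" "\<And>i. i \<in> \<theta> \<Longrightarrow> i \<ge> 1" and j: "j \<ge> 1"
  shows "(\<integral>t. sin_sum_fun \<delta> \<theta> t * sin_basis j t \<partial>unit_leb) = (if j \<in> \<theta> then \<delta> else 0)"
proof -
  have eq: "sin_sum_fun \<delta> \<theta> t * sin_basis j t = (\<Sum>i\<in>\<theta>. \<delta> * (sin_basis i t * sin_basis j t))" for t
    by (simp only: sin_sum_fun_def sum_distrib_right mult.assoc)
  have int: "integrable unit_leb (\<lambda>t. \<delta> * (sin_basis i t * sin_basis j t))" for i
    by (intro continuous_integrable_unit_leb continuous_intros continuous_sin_basis)
  have "(\<integral>t. sin_sum_fun \<delta> \<theta> t * sin_basis j t \<partial>unit_leb)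
      = (\<Sum>i\<in>\<theta>. \<delta> * (\<integral>t. sin_basis i t * sin_basis j t \<partial>unit_leb))"
    unfolding eq Bochner_Integration.integral_sum[OF int] by simp
  also have "\<dots> = (\<Sum>i\<in>\<theta>. if i = j then \<delta> else 0)"
  proof (rule sum.cong[OF refl])
    fix i assume "i \<in> \<theta>"
    from integral_sin_basis[OF \<theta>(2)[OF this] j]
    show "\<delta> * (\<integral>t. sin_basis i t * sin_basis j t \<partial>unit_leb) = (if i = j then \<delta> else 0)" by simp
  qed
  also have "\<dots> = (if j \<in> \<theta> then \<delta> else 0)" using \<theta>(1) by simp
  finally show ?thesis .
qed

context polynomial_decay
begin

lemma kap_gap:
  assumes "j \<ge> 1"
  shows "inverse (2 powr (\<alpha> + 1)) * real j powr (- \<alpha> - 1) \<le> kap j - kap (Suc j)"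
proof -
  have j: "real j \<ge> 1" using assms by simp
  have "(2 * real j) powr (- \<alpha> - 1) \<le> (real j + 1) powr (- \<alpha> - 1)"
    using j \<alpha> by (intro powr_mono2') auto
  also have "\<dots> \<le> \<alpha> * (real j + 1) powr (- \<alpha> - 1)"
    using \<alpha> mult_right_mono[of 1 \<alpha> "(real j + 1) powr (- \<alpha> - 1)"] by simp
  also have "\<dots> \<le> real j powr (- \<alpha>) - (real j + 1) powr (- \<alpha>)"
    by (rule powr_diff_bounds(2)) (use \<alpha> j in auto)
  also have "\<dots> = kap j - kap (Suc j)" by (simp add: kap_def add.commute)
  also have "(2 * real j) powr (- \<alpha> - 1) = inverse (2 powr (\<alpha> + 1)) * real j powr (- \<alpha> - 1)"
  proof -
    have "(2 * real j) powr (- \<alpha> - 1) = 2 powr (- (\<alpha> + 1)) * real j powr (- \<alpha> - 1)"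
      using j by (simp add: powr_mult)
    then show ?thesis by (simp only: powr_minus)
  qed
  finally show ?thesis .
qed

definition hoelder_const :: "real \<Rightarrow> real" where
  "hoelder_const \<gamma> = 8 * pi powr \<gamma> * (\<Sum>j. real j powr (\<gamma> - \<alpha>))"

text \<open>
  The difference of the sines is at most \<open>2\<close> and at most \<open>y = \<pi> j |t - s|\<close>; interpolating between the two
  bounds gives every power \<open>\<gamma> \<le> 2\<close> of \<open>y\<close>.
\<close>
lemma sin_diff_sq_le:
  assumes "0 < \<gamma>" "\<gamma> \<le> 2"
  shows "(sin_basis j t - sin_basis j s)\<^sup>2 \<le> 8 * (pi * real j * \<bar>t - s\<bar>) powr \<gamma>"
proof -
  define y where "y = pi * real j * \<bar>t - s\<bar>"
  have y: "y \<ge> 0" by (simp add: y_def)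
  define D where "D = \<bar>sin (pi * real j * t) - sin (pi * real j * s)\<bar>"
  have D: "D \<ge> 0" "D \<le> 2" "D \<le> y"
  proof -
    show "D \<ge> 0" by (simp add: D_def)
    show "D \<le> 2" unfolding D_def
      using sin_le_one[of "pi * real j * t"] sin_ge_minus_one[of "pi * real j * t"]
        sin_le_one[of "pi * real j * s"] sin_ge_minus_one[of "pi * real j * s"] by linarith
    define a b where "a = pi * real j * t" and "b = pi * real j * s"
    have "sin a - sin b = 2 * sin ((a - b) / 2) * cos ((a + b) / 2)"
      by (rule sin_diff_sin)
    then have "D = 2 * (\<bar>sin ((a - b) / 2)\<bar> * \<bar>cos ((a + b) / 2)\<bar>)"
      by (simp add: D_def a_def b_def abs_mult)
    also have "\<dots> \<le> 2 * (\<bar>(a - b) / 2\<bar> * 1)"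
      by (intro mult_left_mono mult_mono abs_sin_x_le_abs_x abs_cos_le_one) auto
    also have "\<dots> = \<bar>a - b\<bar>" by simp
    also have "a - b = pi * real j * (t - s)" by (simp add: a_def b_def right_diff_distrib)
    also have "\<bar>pi * real j * (t - s)\<bar> = y" by (simp add: y_def abs_mult)
    finally show "D \<le> y" .
  qed
  have "D\<^sup>2 \<le> 4 * y powr \<gamma>"
  proof (cases "y \<le> 1")
    case True
    have "D\<^sup>2 \<le> y\<^sup>2" using D by (intro power_mono)
    also have "y\<^sup>2 \<le> y powr \<gamma>"
    proof (cases "y = 0")
      case False
      then have "y\<^sup>2 = y powr 2" using y by simp
      also have "\<dots> \<le> y powr \<gamma>" using True y False assms by (intro powr_mono') auto
      finally show ?thesis .
    qed simp
    also have "\<dots> \<le> 4 * y powr \<gamma>" by simp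
    finally show ?thesis .
  next
    case False
    have "D\<^sup>2 \<le> 2\<^sup>2" using D by (intro power_mono)
    also have "\<dots> \<le> 4 * y powr \<gamma>"
      using False assms by (simp add: ge_one_powr_ge_zero)
    finally show ?thesis .
  qed
  moreover have "(sin_basis j t - sin_basis j s)\<^sup>2 = 2 * D\<^sup>2"
    unfolding sin_basis_def D_def right_diff_distrib[symmetric] power_mult_distrib by simp
  ultimately show ?thesis by (simp add: y_def)
qed

text \<open>
  Mean-square smoothness costs a factor \<open>j powr \<gamma>\<close> in each term of the eigenvalue series, which stays
  summable because \<open>\<gamma> < \<alpha> - 1\<close>.
\<close>
lemma integral_proc_increment_le:
  assumes \<gamma>: "0 < \<gamma>" "\<gamma> \<le> 2" "\<gamma> < \<alpha> - 1"
  shows "(\<integral>v. (proc v t - proc v s)\<^sup>2 \<partial>unit_leb) \<le> hoelder_const \<gamma> * \<bar>t - s\<bar> powr \<gamma>"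
proof -
  have summ: "summable (\<lambda>j. real j powr (\<gamma> - \<alpha>))"
    unfolding summable_real_powr_iff using \<gamma> by simp
  let ?D = "\<lambda>N. kern_partial N t t - 2 * kern_partial N s t + kern_partial N s s"
  have "?D \<longlonglongrightarrow> kern t t - 2 * kern s t + kern s s"
    by (intro tendsto_add tendsto_diff tendsto_mult tendsto_const kern_partial_tendsto)
  moreover have "?D N \<le> hoelder_const \<gamma> * \<bar>t - s\<bar> powr \<gamma>" for N
  proof -
    have "?D N = (\<Sum>j=1..N. kap j * (sin_basis j t - sin_basis j s)\<^sup>2)"
      unfolding kern_partial_def sum_distrib_left sum_subtractf[symmetric] sum.distrib[symmetric]
      by (rule sum.cong) (simp_all add: power2_eq_square algebra_simps)
    also have "\<dots> \<le> (\<Sum>j=1..N. 8 * pi powr \<gamma> * real j powr (\<gamma> - \<alpha>) * \<bar>t - s\<bar> powr \<gamma>)"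
    proof (rule sum_mono)
      fix j assume j: "j \<in> {1..N}"
      have "kap j * (sin_basis j t - sin_basis j s)\<^sup>2 \<le> kap j * (8 * (pi * real j * \<bar>t - s\<bar>) powr \<gamma>)"
        by (intro mult_left_mono sin_diff_sq_le \<gamma> kap_nonneg)
      also have "(pi * real j * \<bar>t - s\<bar>) powr \<gamma> = pi powr \<gamma> * real j powr \<gamma> * \<bar>t - s\<bar> powr \<gamma>"
        by (simp add: powr_mult)
      also have "kap j * (8 * (pi powr \<gamma> * real j powr \<gamma> * \<bar>t - s\<bar> powr \<gamma>))
          = 8 * pi powr \<gamma> * (real j powr \<gamma> * real j powr (- \<alpha>)) * \<bar>t - s\<bar> powr \<gamma>"
        by (simp only: kap_def mult_ac)
      also have "real j powr \<gamma> * real j powr (- \<alpha>) = real j powr (\<gamma> - \<alpha>)"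
        by (simp flip: powr_add)
      finally show "kap j * (sin_basis j t - sin_basis j s)\<^sup>2
          \<le> 8 * pi powr \<gamma> * real j powr (\<gamma> - \<alpha>) * \<bar>t - s\<bar> powr \<gamma>" .
    qed
    also have "\<dots> = 8 * pi powr \<gamma> * (\<Sum>j=1..N. real j powr (\<gamma> - \<alpha>)) * \<bar>t - s\<bar> powr \<gamma>"
      by (simp only: sum_distrib_left sum_distrib_right)
    also have "\<dots> \<le> hoelder_const \<gamma> * \<bar>t - s\<bar> powr \<gamma>"
      unfolding hoelder_const_def
      by (intro mult_right_mono mult_left_mono sum_le_suminf summ) auto
    finally show ?thesis .
  qed
  ultimately show ?thesis
    unfolding integral_proc_increment by (intro tendsto_upperbound) auto
qed

lemma hoelder_const_nonneg: "hoelder_const \<gamma> \<ge> 0" if "\<gamma> < \<alpha> - 1"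
proof -
  have "summable (\<lambda>j. real j powr (\<gamma> - \<alpha>))"
    unfolding summable_real_powr_iff using that by simp
  then have "0 \<le> (\<Sum>j. real j powr (\<gamma> - \<alpha>))" by (rule suminf_nonneg) simp
  then show ?thesis by (simp add: hoelder_const_def)
qed

text \<open>
  Each term of the sum is nonnegative and meets some of the conditions of the class, so that a constant above
  the sum meets all of them.
\<close>
definition class_const :: "real \<Rightarrow> real \<Rightarrow> real" where
  "class_const \<epsilon> \<gamma> = 4 + proc_bound ^ 4 + 2 powr (\<alpha> + 1) + inverse (\<epsilon> * \<epsilon>) + hoelder_const \<gamma>"

lemma class_const_ge:
  assumes "0 < \<epsilon>" "\<gamma> < \<alpha> - 1"
  shows "4 \<le> class_const \<epsilon> \<gamma>" "proc_bound ^ 4 \<le> class_const \<epsilon> \<gamma>"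
    "2 powr (\<alpha> + 1) \<le> class_const \<epsilon> \<gamma>" "inverse (\<epsilon> * \<epsilon>) \<le> class_const \<epsilon> \<gamma>"
    "hoelder_const \<gamma> \<le> class_const \<epsilon> \<gamma>"
proof -
  have "0 \<le> proc_bound ^ 4" "0 \<le> 2 powr (\<alpha> + 1)" "0 \<le> inverse (\<epsilon> * \<epsilon>)" "0 \<le> hoelder_const \<gamma>"
    using proc_bound_nonneg assms hoelder_const_nonneg by simp_all
  then show "4 \<le> class_const \<epsilon> \<gamma>" "proc_bound ^ 4 \<le> class_const \<epsilon> \<gamma>"
    "2 powr (\<alpha> + 1) \<le> class_const \<epsilon> \<gamma>" "inverse (\<epsilon> * \<epsilon>) \<le> class_const \<epsilon> \<gamma>"
    "hoelder_const \<gamma> \<le> class_const \<epsilon> \<gamma>"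
    unfolding class_const_def by linarith+
qed

lemma nn_integral_PX_path_power_le:
  assumes "even k"
  shows "(\<integral>\<^sup>+t. \<integral>\<^sup>+x. ennreal ((path x t) ^ k) \<partial>PX \<partial>unit_leb) \<le> ennreal (proc_bound ^ k)"
proof -
  have "(\<integral>\<^sup>+x. ennreal ((path x t) ^ k) \<partial>PX) \<le> ennreal (proc_bound ^ k)" if t: "t \<in> {0..1}" for t
  proof -
    have "(\<integral>\<^sup>+x. ennreal ((path x t) ^ k) \<partial>PX) \<le> (\<integral>\<^sup>+x. ennreal (proc_bound ^ k) \<partial>PX)"
    proof (rule nn_integral_mono_AE, rule AE_PX_I, rule ennreal_leI)
      fix v
      have "(proc v t) ^ k = \<bar>proc v t\<bar> ^ k" using assms by (simp add: power_even_abs)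
      also have "\<dots> \<le> proc_bound ^ k" by (intro power_mono proc_le) simp
      finally show "path (traj v) t ^ k \<le> proc_bound ^ k" using t by (simp add: path_traj)
    qed
    then show ?thesis using P.emeasure_space_1 by simp
  qed
  then have "(\<integral>\<^sup>+t. \<integral>\<^sup>+x. ennreal ((path x t) ^ k) \<partial>PX \<partial>unit_leb)
      \<le> (\<integral>\<^sup>+t. ennreal (proc_bound ^ k) \<partial>unit_leb)"
    by (intro nn_integral_mono) simp
  then show ?thesis
    using prob_space.emeasure_space_1[OF prob_space_unit_leb] by simp
qed

lemma linear_quantile_logistic_model:
  assumes U: "U \<subseteq> {0<..<1}"
  shows "linear_quantile U (logistic_model PX (sin_sum_form \<delta> \<theta>))
    (\<lambda>u. ln (u / (1 - u))) (\<lambda>t u. sin_sum_fun \<delta> \<theta> t)"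
proof -
  let ?F = "logistic_model PX (sin_sum_form \<delta> \<theta>)"
  have law: "law_X ?F = PX" by (rule law_X_logistic_model) measurable
  have form: "(\<integral>t. sin_sum_fun \<delta> \<theta> t * centred ?F x t \<partial>unit_leb) = sin_sum_form \<delta> \<theta> x" for x
  proof -
    have "(\<integral>t. sin_sum_fun \<delta> \<theta> t * centred ?F x t \<partial>unit_leb) = (\<integral>t. path x t * sin_sum_fun \<delta> \<theta> t \<partial>unit_leb)"
      by (rule Bochner_Integration.integral_cong) (simp_all add: centred_eq[OF law])
    then show ?thesis by (simp only: integral_path_sin_sum_fun)
  qed
  have "AE x in PX. \<forall>u\<in>{0<..<1}. cond_quantile ?F u x = ln (u / (1 - u)) + sin_sum_form \<delta> \<theta> x"
    by (rule cond_quantile_logistic_model) measurable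
  then show ?thesis
    unfolding linear_quantile_def law form
    using U in_L2_sin_sum_fun by (auto elim!: eventually_mono)
qed

lemma logistic_process_in_class:
  assumes \<theta>: "finite \<theta>" "\<And>j. j \<in> \<theta> \<Longrightarrow> j \<ge> 1" and \<delta>: "\<delta> \<ge> 0" "\<And>j. j \<in> \<theta> \<Longrightarrow> \<delta> \<le> real j powr (- \<beta>)"
    and \<epsilon>: "0 < \<epsilon>" "\<epsilon> < 1/2" and U: "U \<subseteq> {\<epsilon>..1-\<epsilon>}"
    and \<gamma>: "0 < \<gamma>" "\<gamma> \<le> 2" "\<gamma> < \<alpha> - 1" and C: "class_const \<epsilon> \<gamma> \<le> C"
  shows "logistic_model PX (sin_sum_form \<delta> \<theta>) \<in> model_class U C \<alpha> \<beta> \<gamma>"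
proof -
  let ?F = "logistic_model PX (sin_sum_form \<delta> \<theta>)"
  have h: "sin_sum_form \<delta> \<theta> \<in> borel_measurable borel" by measurable
  note C' = class_const_ge[OF \<epsilon>(1) \<gamma>(3), THEN order_trans[OF _ C]]
  have law: "law_X ?F = PX" by (rule law_X_logistic_model[OF h])
  have U': "U \<subseteq> {0<..<1}" using U \<epsilon> by auto
  have A2: "cond_A2 C ?F kap sin_basis"
    unfolding cond_A2_def law score_eq[OF law]
  proof (intro conjI allI impI)
    show "(\<integral>\<^sup>+t. \<integral>\<^sup>+x. ennreal ((path x t) ^ 4) \<partial>PX \<partial>unit_leb) \<le> ennreal C"
      using nn_integral_PX_path_power_le[of 4] ennreal_leI[OF C'(2)] by (auto intro: order_trans)
    fix j :: nat assume j: "1 \<le> j"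
    have "(\<integral>\<^sup>+x. ennreal (sin_coef j x ^ 4) \<partial>PX) \<le> (\<integral>\<^sup>+x. ennreal (C * (kap j)\<^sup>2) \<partial>PX)"
    proof (rule nn_integral_mono_AE, rule AE_PX_I, rule ennreal_leI)
      fix v
      have "sin_coef j (traj v) ^ 4 = \<bar>sin_coef j (traj v)\<bar> ^ 4" by (simp add: power_even_abs)
      also have "\<dots> \<le> (sqrt 2 * amp j) ^ 4"
        by (intro power_mono abs_sin_coef_traj_le j) simp
      also have "\<dots> = ((sqrt 2)\<^sup>2)\<^sup>2 * ((amp j)\<^sup>2)\<^sup>2"
        by (simp only: power_mult_distrib flip: power_mult) simp
      also have "\<dots> = 4 * (kap j)\<^sup>2" by (simp add: amp_sq)
      also have "\<dots> \<le> C * (kap j)\<^sup>2" using C'(1) by (intro mult_right_mono) auto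
      finally show "sin_coef j (traj v) ^ 4 \<le> C * (kap j)\<^sup>2" .
    qed
    then show "(\<integral>\<^sup>+x. ennreal (sin_coef j x ^ 4) \<partial>PX) \<le> ennreal (C * (kap j)\<^sup>2)"
      using P.emeasure_space_1 by simp
  qed
  have A3: "cond_A3 C \<alpha> kap"
    unfolding cond_A3_def
  proof (intro allI impI conjI)
    fix j :: nat assume j: "1 \<le> j"
    have "inverse C \<le> 1" using C'(1) by (simp add: inverse_le_1_iff)
    from mult_right_mono[OF this, of "real j powr (- \<alpha>)"]
    show "inverse C * real j powr (- \<alpha>) \<le> kap j" by (simp add: kap_def)
    from mult_right_mono[of 1 C "real j powr (- \<alpha>)"]
    show "kap j \<le> C * real j powr (- \<alpha>)" using C'(1) by (simp add: kap_def)
    have "inverse C \<le> inverse (2 powr (\<alpha> + 1))"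
      using C'(3) by (intro le_imp_inverse_le) auto
    from mult_right_mono[OF this, of "real j powr (- \<alpha> - 1)"] kap_gap[OF j]
    show "inverse C * real j powr (- \<alpha> - 1) \<le> kap j - kap (Suc j)" by simp
  qed
  have A4: "cond_A4 U C \<beta> (\<lambda>t u. sin_sum_fun \<delta> \<theta> t) sin_basis"
    unfolding cond_A4_def
  proof (intro allI impI ballI)
    fix j :: nat assume j: "1 \<le> j"
    have "\<bar>\<integral>t. sin_sum_fun \<delta> \<theta> t * sin_basis j t \<partial>unit_leb\<bar> \<le> real j powr (- \<beta>)"
      using integral_sin_sum_fun[OF \<theta> j, of \<delta>] \<delta> by auto
    also have "\<dots> \<le> C * real j powr (- \<beta>)"
      using C'(1) mult_right_mono[of 1 C "real j powr (- \<beta>)"] by simp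
    finally show "\<bar>\<integral>t. sin_sum_fun \<delta> \<theta> t * sin_basis j t \<partial>unit_leb\<bar> \<le> C * real j powr (- \<beta>)" .
  qed
  have A8: "cond_A8 C \<gamma> ?F"
    unfolding cond_A8_def law
  proof (intro ballI)
    fix s t :: real assume s: "s \<in> {0..1}" and t: "t \<in> {0..1}"
    have m: "(\<lambda>x. ennreal ((path x t - path x s)\<^sup>2)) \<in> borel_measurable borel"
      using measurable_path_eval[of t] measurable_path_eval[of s] by measurable
    have int: "integrable unit_leb (\<lambda>v. (proc v t - proc v s)\<^sup>2)"
      by (intro continuous_integrable_unit_leb continuous_intros continuous_proc_phase)
    have "(\<integral>\<^sup>+x. ennreal ((path x t - path x s)\<^sup>2) \<partial>PX) = (\<integral>\<^sup>+v. ennreal ((proc v t - proc v s)\<^sup>2) \<partial>unit_leb)"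
      using nn_integral_PX[OF m] by (simp add: path_traj[OF s] path_traj[OF t])
    also have "\<dots> = ennreal (\<integral>v. (proc v t - proc v s)\<^sup>2 \<partial>unit_leb)"
      by (rule nn_integral_eq_integral[OF int]) simp
    also have "\<dots> \<le> ennreal (C * \<bar>t - s\<bar> powr \<gamma>)"
    proof (rule ennreal_leI)
      have "hoelder_const \<gamma> * \<bar>t - s\<bar> powr \<gamma> \<le> C * \<bar>t - s\<bar> powr \<gamma>"
        using C'(5) by (intro mult_right_mono) auto
      then show "(\<integral>v. (proc v t - proc v s)\<^sup>2 \<partial>unit_leb) \<le> C * \<bar>t - s\<bar> powr \<gamma>"
        using integral_proc_increment_le[OF \<gamma>, of t s] by linarith
    qed
    finally show "(\<integral>\<^sup>+x. ennreal ((path x t - path x s)\<^sup>2) \<partial>PX) \<le> ennreal (C * \<bar>t - s\<bar> powr \<gamma>)" .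
  qed
  have fin: "(\<integral>\<^sup>+t. \<integral>\<^sup>+x. ennreal ((path x t)\<^sup>2) \<partial>law_X ?F \<partial>unit_leb) < \<infinity>"
    unfolding law using nn_integral_PX_path_power_le[of 2] by (auto intro: le_less_trans)
  have "\<exists>a b \<kappa> \<phi> \<mu> f. linear_quantile U ?F a b \<and> spectral_expansion ?F \<kappa> \<phi> \<and> regular_cond_dist ?F \<mu> \<and>
      cond_A2 C ?F \<kappa> \<phi> \<and> cond_A3 C \<alpha> \<kappa> \<and> cond_A4 U C \<beta> b \<phi> \<and>
      cond_A5 C \<mu> f \<and> cond_A6 U C \<mu> f \<and> cond_A8 C \<gamma> ?F"
    apply (rule exI[of _ "\<lambda>u. ln (u / (1 - u))"])
    apply (rule exI[of _ "\<lambda>t u. sin_sum_fun \<delta> \<theta> t"])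
    apply (rule exI[of _ kap])
    apply (rule exI[of _ sin_basis])
    apply (rule exI[of _ "\<lambda>x. logistic_dist (sin_sum_form \<delta> \<theta> x)"])
    apply (rule exI[of _ "\<lambda>x y. logistic_pdf (y - sin_sum_form \<delta> \<theta> x)"])
    using linear_quantile_logistic_model[OF U'] spectral_expansion_process[OF law]
      regular_cond_dist_logistic_model[OF h] A2 A3 A4 A8
      cond_A5_logistic[OF h, of C] C'(1) cond_A6_logistic[OF h \<epsilon> U C'(4)] by simp
  then show ?thesis
    unfolding model_class_def
    using prob_space_logistic_model[OF h] sets_logistic_model fin by blast
qed

text \<open>
  The slope of a distribution is an arbitrary choice among all functions that represent its conditional
  quantiles; identifiability shows that the choice makes no difference.
\<close>
lemma slope_logistic_model:
  assumes U: "U \<subseteq> {0<..<1}" and u: "u \<in> U"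
  shows "AE t in unit_leb. slope U (logistic_model PX (sin_sum_form \<delta> \<theta>)) t u = sin_sum_fun \<delta> \<theta> t"
proof -
  let ?F = "logistic_model PX (sin_sum_form \<delta> \<theta>)"
  have law: "law_X ?F = PX" by (rule law_X_logistic_model) measurable
  note lq = linear_quantile_logistic_model[OF U, of \<delta> \<theta>]
  define b' where "b' = slope U ?F"
  have "\<exists>a. linear_quantile U ?F a b'"
    unfolding b'_def slope_def
    using someI_ex[of "\<lambda>b. \<exists>a. linear_quantile U ?F a b"] lq by blast
  then obtain a' where a': "linear_quantile U ?F a' b'" ..
  define k where "k t = b' t u - sin_sum_fun \<delta> \<theta> t" for t
  have L2: "in_L2 (\<lambda>t. b' t u)" using a' u by (simp add: linear_quantile_def)
  have k: "in_L2 k" unfolding k_def by (rule in_L2_diff[OF L2 in_L2_sin_sum_fun])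
  have "AE x in PX. cond_quantile ?F u x = a' u + (\<integral>t. b' t u * centred ?F x t \<partial>unit_leb)"
    using a' u unfolding linear_quantile_def law by blast
  moreover have "AE x in PX. cond_quantile ?F u x
      = ln (u / (1 - u)) + (\<integral>t. sin_sum_fun \<delta> \<theta> t * centred ?F x t \<partial>unit_leb)"
    using lq u unfolding linear_quantile_def law by blast
  ultimately have "AE x in PX. a' u + (\<integral>t. b' t u * centred ?F x t \<partial>unit_leb)
      = ln (u / (1 - u)) + (\<integral>t. sin_sum_fun \<delta> \<theta> t * centred ?F x t \<partial>unit_leb)"
    by eventually_elim simp
  then have "AE v in unit_leb. a' u + (\<integral>t. b' t u * centred ?F (traj v) t \<partial>unit_leb)
      = ln (u / (1 - u)) + (\<integral>t. sin_sum_fun \<delta> \<theta> t * centred ?F (traj v) t \<partial>unit_leb)"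
    by (rule AE_PX_traj)
  moreover have "(\<integral>t. f t * centred ?F (traj v) t \<partial>unit_leb) = (\<integral>t. f t * proc v t \<partial>unit_leb)" for f v
    by (rule Bochner_Integration.integral_cong) (simp_all add: centred_eq[OF law] path_traj)
  ultimately have AE: "AE v in unit_leb. a' u + (\<integral>t. b' t u * proc v t \<partial>unit_leb)
      = ln (u / (1 - u)) + (\<integral>t. sin_sum_fun \<delta> \<theta> t * proc v t \<partial>unit_leb)" by simp
  have split: "(\<integral>t. k t * proc v t \<partial>unit_leb) = (\<integral>t. b' t u * proc v t \<partial>unit_leb) - (\<integral>t. sin_sum_fun \<delta> \<theta> t * proc v t \<partial>unit_leb)" for v
    unfolding k_def left_diff_distrib
    by (intro Bochner_Integration.integral_diff integrable_mult_continuous in_L2_integrable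
        L2 in_L2_sin_sum_fun continuous_proc_time)
  have "AE v in unit_leb. (a' u - ln (u / (1 - u))) + (\<integral>t. k t * proc v t \<partial>unit_leb) = 0"
    using AE by eventually_elim (simp add: split)
  from slope_identified[OF k this] show ?thesis
    by eventually_elim (simp add: k_def b'_def)
qed

end

section \<open>The hypercube of hypotheses\<close>

lemma emeasure_le_inner_prob:
  assumes "A \<in> sets M" "\<And>\<omega>. \<omega> \<in> A \<Longrightarrow> Q \<omega>"
  shows "emeasure M A \<le> inner_prob M Q"
  unfolding inner_prob_def by (rule SUP_upper) (use assms in auto)

lemma nn_integral_square_triangle:
  fixes q f g :: "'a \<Rightarrow> real"
  assumes [measurable]: "q \<in> borel_measurable N" "f \<in> borel_measurable N" "g \<in> borel_measurable N"
  shows "(\<integral>\<^sup>+x. ennreal ((f x - g x)\<^sup>2) \<partial>N)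
    \<le> 2 * (\<integral>\<^sup>+x. ennreal ((q x - f x)\<^sup>2) \<partial>N) + 2 * (\<integral>\<^sup>+x. ennreal ((q x - g x)\<^sup>2) \<partial>N)"
proof -
  have "(\<integral>\<^sup>+x. ennreal ((f x - g x)\<^sup>2) \<partial>N)
      \<le> (\<integral>\<^sup>+x. 2 * ennreal ((q x - f x)\<^sup>2) + 2 * ennreal ((q x - g x)\<^sup>2) \<partial>N)"
  proof (rule nn_integral_mono)
    fix x
    have "(f x - g x)\<^sup>2 \<le> 2 * (q x - f x)\<^sup>2 + 2 * (q x - g x)\<^sup>2"
      using zero_le_power2[of "(q x - f x) + (q x - g x)"] by (simp add: power2_eq_square algebra_simps)
    then have "ennreal ((f x - g x)\<^sup>2) \<le> ennreal (2 * (q x - f x)\<^sup>2 + 2 * (q x - g x)\<^sup>2)"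
      by (rule ennreal_leI)
    also have "\<dots> = 2 * ennreal ((q x - f x)\<^sup>2) + 2 * ennreal ((q x - g x)\<^sup>2)"
      by (simp add: ennreal_plus ennreal_mult)
    finally show "ennreal ((f x - g x)\<^sup>2) \<le> 2 * ennreal ((q x - f x)\<^sup>2) + 2 * ennreal ((q x - g x)\<^sup>2)" .
  qed
  also have "\<dots> = 2 * (\<integral>\<^sup>+x. ennreal ((q x - f x)\<^sup>2) \<partial>N) + 2 * (\<integral>\<^sup>+x. ennreal ((q x - g x)\<^sup>2) \<partial>N)"
    by (subst nn_integral_add) (auto simp: nn_integral_cmult)
  finally show ?thesis .
qed

definition test_const :: real where "test_const = 3 / (4 * exp 8)"

lemma test_const_pos: "test_const > 0" by (simp add: test_const_def)

text \<open>
  The hypotheses for sample size \<open>n\<close> are indexed by the subsets of the block \<open>J = {m+1..2m}\<close>. The last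
  assumption says that flipping one bit changes the location of an observation by at most
  \<open>\<surd>(2/n)\<close>.
\<close>
locale hypercube = polynomial_decay \<alpha> for \<alpha> :: real +
  fixes \<beta> :: real and m n :: nat
  assumes \<beta>: "\<beta> > 0" and m: "m \<ge> 1" and n: "n \<ge> 2"
    and mn: "real m powr (- (\<alpha> + 2 * \<beta>)) \<le> 1 / real n"
begin

definition J :: "nat set" where "J = {m+1..2*m}"

definition \<delta> :: real where "\<delta> = real (2 * m) powr (- \<beta>)"

definition hyp :: "nat set \<Rightarrow> (real \<times> D01) measure" where
  "hyp \<theta> = logistic_model PX (sin_sum_form \<delta> \<theta>)"

lemma J_simps: "finite J" "card J = m" "J \<noteq> {}" "j \<in> J \<Longrightarrow> 1 \<le> j" "j \<in> J \<Longrightarrow> m \<le> j" "j \<in> J \<Longrightarrow> j \<le> 2 * m"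
  using m by (auto simp: J_def)

lemma \<delta>_pos: "\<delta> > 0" using m by (simp add: \<delta>_def)

lemma \<delta>_le: "j \<in> J \<Longrightarrow> \<delta> \<le> real j powr (- \<beta>)"
  unfolding \<delta>_def using J_simps(4,6)[of j] \<beta> by (intro powr_mono2') auto

lemma sq_\<delta>: "\<delta>\<^sup>2 = real (2 * m) powr (- (2 * \<beta>))"
  by (simp add: \<delta>_def power2_eq_square flip: powr_add)

lemma sq_step_le:
  assumes j: "j \<in> J" shows "(\<delta> * amp j)\<^sup>2 \<le> 1 / real n"
proof -
  have "(\<delta> * amp j)\<^sup>2 = \<delta>\<^sup>2 * kap j" by (simp add: power_mult_distrib amp_sq)
  also have "\<dots> \<le> real m powr (- (2 * \<beta>)) * real m powr (- \<alpha>)"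
  proof (rule mult_mono)
    show "\<delta>\<^sup>2 \<le> real m powr (- (2 * \<beta>))"
      unfolding sq_\<delta> using m \<beta> by (intro powr_mono2') auto
    show "kap j \<le> real m powr (- \<alpha>)"
      unfolding kap_def using m \<alpha> J_simps(5)[OF j] by (intro powr_mono2') auto
  qed (auto simp: kap_nonneg)
  also have "\<dots> = real m powr (- (\<alpha> + 2 * \<beta>))"
    unfolding powr_add[symmetric] by (simp add: algebra_simps)
  finally show ?thesis using mn by linarith
qed

lemma sin_sum_form_toggle:
  assumes "finite \<theta>"
  shows "\<bar>sin_sum_form \<delta> \<theta> x - sin_sum_form \<delta> (toggle j \<theta>) x\<bar> = \<delta> * \<bar>sin_coef j x\<bar>"
proof (cases "j \<in> \<theta>")
  case True
  then show ?thesis using assms \<delta>_pos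
    by (simp add: sin_sum_form_def toggle_def sum.remove[OF assms True] abs_mult)
next
  case False
  then show ?thesis using assms \<delta>_pos
    by (simp add: sin_sum_form_def toggle_def abs_mult)
qed

lemma hyp_testing_bound:
  assumes \<theta>: "\<theta> \<subseteq> J" and j: "j \<in> J" and A: "A \<in> sets (sample n obs)"
  shows "test_const \<le> measure (sample n (hyp \<theta>)) A
    + measure (sample n (hyp (toggle j \<theta>))) (space (sample n obs) - A)"
  unfolding test_const_def hyp_def
proof (rule sample_testing_bound[where d="sqrt (2 / real n)"])
  show "AE x in PX. \<bar>sin_sum_form \<delta> \<theta> x - sin_sum_form \<delta> (toggle j \<theta>) x\<bar> \<le> sqrt (2 / real n)"
  proof (rule AE_PX_I)
    fix v
    have fin: "finite \<theta>" using \<theta> J_simps(1) finite_subset by blast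
    have "\<bar>sin_sum_form \<delta> \<theta> (traj v) - sin_sum_form \<delta> (toggle j \<theta>) (traj v)\<bar> \<le> \<delta> * (sqrt 2 * amp j)"
      unfolding sin_sum_form_toggle[OF fin]
      using abs_sin_coef_traj_le[OF J_simps(4)[OF j]] \<delta>_pos by (intro mult_left_mono) auto
    also have "\<dots> = sqrt 2 * (\<delta> * amp j)" by simp
    also have "\<dots> \<le> sqrt 2 * sqrt (1 / real n)"
      by (intro mult_left_mono real_le_rsqrt sq_step_le j) simp
    also have "\<dots> = sqrt (2 / real n)" by (simp add: real_sqrt_divide)
    finally show "\<bar>sin_sum_form \<delta> \<theta> (traj v) - sin_sum_form \<delta> (toggle j \<theta>) (traj v)\<bar> \<le> sqrt (2 / real n)" .
  qed
  show "sqrt (2 / real n) \<le> 1" using n by simp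
  show "real n * (sqrt (2 / real n))\<^sup>2 \<le> 2" using n by simp
  show "A \<in> sets (sample n obs)" by (rule A)
qed measurable

lemma sets_sample_hyp: "sets (sample n (hyp \<theta>)) = sets (sample n obs)"
  unfolding hyp_def by (intro sets_PiM_cong refl sets_logistic_model)

lemma prob_space_sample_hyp: "prob_space (sample n (hyp \<theta>))"
  unfolding hyp_def by (rule prob_space_PiM) (rule prob_space_logistic_model, measurable)

text \<open>
  The form in which Assouad's argument is applied: \<open>loss\<close> is a measurable lower bound of the loss \<open>L\<close> under
  study, and \<open>sep\<close> says that an estimate close to two hypotheses forces these to differ in few bits,
  each of which is worth \<open>D\<close>. Since \<open>L\<close> itself may fail to be measurable, the conclusion speaks of inner
  probabilities.
\<close>
lemma hypercube_lower_bound: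
  fixes loss L :: "nat set \<Rightarrow> (nat \<Rightarrow> real \<times> D01) \<Rightarrow> ennreal"
  assumes meas: "\<And>\<theta>. \<theta> \<subseteq> J \<Longrightarrow> loss \<theta> \<in> borel_measurable (sample n obs)"
    and le: "\<And>\<theta> d. loss \<theta> d \<le> L \<theta> d"
    and D: "D > 0" and \<tau>: "\<tau> \<le> test_const * real m * D / 16"
    and sep: "\<And>\<theta> \<theta>' d. \<theta> \<subseteq> J \<Longrightarrow> \<theta>' \<subseteq> J \<Longrightarrow> d \<in> space (sample n obs) \<Longrightarrow>
      ennreal (D * real (card (sym_diff \<theta> \<theta>'))) \<le> 2 * loss \<theta> d + 2 * loss \<theta>' d"
  shows "\<exists>\<theta>\<subseteq>J. ennreal (test_const / 4) \<le> inner_prob (sample n (hyp \<theta>)) (\<lambda>d. L \<theta> d > ennreal \<tau>)"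
proof -
  define t where "t = test_const * real m * D / 16"
  have t: "t \<ge> 0" using D test_const_pos by (simp add: t_def)
  define A where "A \<theta> = {d \<in> space (sample n obs). loss \<theta> d \<le> ennreal t}" for \<theta>
  have "\<exists>\<theta>\<subseteq>J. measure (sample n (hyp \<theta>)) (space (sample n obs) - A \<theta>) \<ge> test_const / 4"
  proof (rule assouad_decoding)
    show "finite J" "J \<noteq> {}" by (fact J_simps)+
    show "test_const \<ge> 0" using test_const_pos by simp
    show "prob_space (sample n (hyp \<theta>))" for \<theta> by (rule prob_space_sample_hyp)
    show "sets (sample n (hyp \<theta>)) = sets (sample n obs)" for \<theta> by (rule sets_sample_hyp)
    show "A \<theta> \<in> sets (sample n obs)" if "\<theta> \<subseteq> J" for \<theta>
      unfolding A_def using meas[OF that] by measurable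
    show "test_const \<le> measure (sample n (hyp \<theta>)) B + measure (sample n (hyp (toggle j \<theta>))) (space (sample n obs) - B)"
      if "\<theta> \<subseteq> J" "j \<in> J" "B \<in> sets (sample n obs)" for \<theta> j B
      by (rule hyp_testing_bound[OF that])
    show "real (card (sym_diff \<theta> \<theta>')) \<le> test_const * real (card J) / 4"
      if \<theta>: "\<theta> \<subseteq> J" "\<theta>' \<subseteq> J" and d: "d \<in> A \<theta>" "d \<in> A \<theta>'" for \<theta> \<theta>' d
    proof -
      have "ennreal (D * real (card (sym_diff \<theta> \<theta>'))) \<le> 2 * loss \<theta> d + 2 * loss \<theta>' d"
        by (rule sep) (use \<theta> d in \<open>auto simp: A_def\<close>)
      also have "\<dots> \<le> 2 * ennreal t + 2 * ennreal t"
        using d by (intro add_mono mult_left_mono) (auto simp: A_def)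
      also have "\<dots> = ennreal (2 * t) + ennreal (2 * t)"
        using t by (simp add: ennreal_mult)
      also have "\<dots> = ennreal (2 * t + 2 * t)"
        using t by (intro ennreal_plus[symmetric]) auto
      finally have "D * real (card (sym_diff \<theta> \<theta>')) \<le> 4 * t"
        using t by (subst (asm) ennreal_le_iff) auto
      also have "4 * t = D * (test_const * real (card J) / 4)" by (simp add: t_def J_simps(2))
      finally show ?thesis using D by (simp only: mult_le_cancel_left_pos)
    qed
  qed
  then obtain \<theta> where \<theta>: "\<theta> \<subseteq> J"
    "test_const / 4 \<le> measure (sample n (hyp \<theta>)) (space (sample n obs) - A \<theta>)" by blast
  interpret H: prob_space "sample n (hyp \<theta>)" by (rule prob_space_sample_hyp)
  have eq: "space (sample n obs) - A \<theta> = {d \<in> space (sample n obs). loss \<theta> d > ennreal t}"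
    by (auto simp: A_def not_le)
  have "ennreal (test_const / 4)
      \<le> emeasure (sample n (hyp \<theta>)) {d \<in> space (sample n obs). loss \<theta> d > ennreal t}"
    unfolding H.emeasure_eq_measure eq[symmetric] using \<theta>(2) by (rule ennreal_leI)
  also have "\<dots> \<le> inner_prob (sample n (hyp \<theta>)) (\<lambda>d. L \<theta> d > ennreal \<tau>)"
  proof (rule emeasure_le_inner_prob)
    show "{d \<in> space (sample n obs). loss \<theta> d > ennreal t} \<in> sets (sample n (hyp \<theta>))"
      unfolding sets_sample_hyp using meas[OF \<theta>(1)] by measurable
    fix d assume "d \<in> {d \<in> space (sample n obs). loss \<theta> d > ennreal t}"
    then have "ennreal t < L \<theta> d" using le[of \<theta> d] by (auto intro: less_le_trans)
    then show "ennreal \<tau> < L \<theta> d" using ennreal_leI[OF \<tau>] unfolding t_def by (rule le_less_trans[rotated])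
  qed
  finally show ?thesis using \<theta>(1) by blast
qed

definition sgn_diff :: "nat set \<Rightarrow> nat set \<Rightarrow> nat \<Rightarrow> real" where
  "sgn_diff \<theta> \<theta>' j = of_bool (j \<in> \<theta>) - of_bool (j \<in> \<theta>')"

lemma sum_sgn_diff:
  assumes "\<theta> \<subseteq> J" "\<theta>' \<subseteq> J"
  shows "(\<Sum>j\<in>\<theta>. \<delta> * f j) - (\<Sum>j\<in>\<theta>'. \<delta> * f j) = (\<Sum>j\<in>J. \<delta> * sgn_diff \<theta> \<theta>' j * f j)"
proof -
  have *: "(\<Sum>j\<in>\<theta>. \<delta> * f j) = (\<Sum>j\<in>J. of_bool (j \<in> \<theta>) * (\<delta> * f j))" if "\<theta> \<subseteq> J" for \<theta>
    using that J_simps(1) by (simp add: sum.inter_restrict[symmetric] Int_absorb1 of_bool_def if_distrib[of "\<lambda>x. x * _"] cong: if_cong)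
  show ?thesis
    unfolding *[OF assms(1)] *[OF assms(2)] sgn_diff_def sum_subtractf[symmetric]
    by (simp only: algebra_simps)
qed

lemma sum_sq_sgn_diff:
  assumes "\<theta> \<subseteq> J" "\<theta>' \<subseteq> J"
  shows "(\<Sum>j\<in>J. (sgn_diff \<theta> \<theta>' j)\<^sup>2) = real (card (sym_diff \<theta> \<theta>'))"
proof -
  have "(\<Sum>j\<in>J. (sgn_diff \<theta> \<theta>' j)\<^sup>2) = (\<Sum>j\<in>J. if j \<in> sym_diff \<theta> \<theta>' then 1 else 0)"
    by (intro sum.cong) (auto simp: sgn_diff_def)
  also have "\<dots> = real (card (J \<inter> sym_diff \<theta> \<theta>'))"
    using J_simps(1) by (simp add: sum.If_cases Int_def del: Un_iff Diff_iff)
  also have "J \<inter> sym_diff \<theta> \<theta>' = sym_diff \<theta> \<theta>'" using assms by blast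
  finally show ?thesis .
qed

text \<open>
  Parseval in the sine basis.
\<close>
lemma slope_separation:
  assumes "\<theta> \<subseteq> J" "\<theta>' \<subseteq> J"
  shows "(\<integral>\<^sup>+t. ennreal ((sin_sum_fun \<delta> \<theta> t - sin_sum_fun \<delta> \<theta>' t)\<^sup>2) \<partial>unit_leb)
    = ennreal (\<delta>\<^sup>2 * real (card (sym_diff \<theta> \<theta>')))"
proof -
  have eq: "sin_sum_fun \<delta> \<theta> t - sin_sum_fun \<delta> \<theta>' t = (\<Sum>j\<in>J. (\<delta> * sgn_diff \<theta> \<theta>' j) * sin_basis j t)" for t
    unfolding sin_sum_fun_def by (rule sum_sgn_diff[OF assms])
  have "(\<integral>\<^sup>+t. ennreal ((sin_sum_fun \<delta> \<theta> t - sin_sum_fun \<delta> \<theta>' t)\<^sup>2) \<partial>unit_leb)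
      = ennreal (\<integral>t. (sin_sum_fun \<delta> \<theta> t - sin_sum_fun \<delta> \<theta>' t)\<^sup>2 \<partial>unit_leb)"
    by (intro nn_integral_eq_integral continuous_integrable_unit_leb continuous_on_power
        continuous_on_diff continuous_sin_sum_fun) simp
  also have "(\<integral>t. (sin_sum_fun \<delta> \<theta> t - sin_sum_fun \<delta> \<theta>' t)\<^sup>2 \<partial>unit_leb)
      = (\<Sum>j\<in>J. (\<delta> * sgn_diff \<theta> \<theta>' j) * (\<delta> * sgn_diff \<theta> \<theta>' j))"
    unfolding eq power2_eq_square
    by (rule sines.integral_sum_product[OF J_simps(1) J_simps(4)])
  also have "\<dots> = \<delta>\<^sup>2 * (\<Sum>j\<in>J. (sgn_diff \<theta> \<theta>' j)\<^sup>2)"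
    by (simp only: sum_distrib_left power2_eq_square mult_ac)
  finally show ?thesis by (simp only: sum_sq_sgn_diff[OF assms])
qed

text \<open>
  Parseval in the phase: the linear forms of two hypotheses differ by a cosine sum in \<open>v\<close>, in which bit \<open>j\<close>
  has weight \<open>\<delta>\<^sup>2 \<kappa>\<^bsub>j\<^esub>\<close>, and \<open>2m\<close> is the largest index.
\<close>
lemma prediction_separation:
  assumes "\<theta> \<subseteq> J" "\<theta>' \<subseteq> J"
  shows "ennreal (\<delta>\<^sup>2 * real (2 * m) powr (- \<alpha>) * real (card (sym_diff \<theta> \<theta>')))
    \<le> (\<integral>\<^sup>+x. ennreal ((sin_sum_form \<delta> \<theta> x - sin_sum_form \<delta> \<theta>' x)\<^sup>2) \<partial>PX)"
proof -
  define c where "c j = \<delta> * sgn_diff \<theta> \<theta>' j * (rs_sign j * amp j)" for j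
  have "sin_sum_form \<delta> \<theta> (traj v) - sin_sum_form \<delta> \<theta>' (traj v) = (\<Sum>j\<in>J. c j * cos_basis j v)" for v
    unfolding sin_sum_form_def sum_sgn_diff[OF assms] c_def
    by (rule sum.cong[OF refl]) (simp only: sin_coef_traj[OF J_simps(4)] mult_ac)
  note eq = this
  have m1: "(\<lambda>x. ennreal ((sin_sum_form \<delta> \<theta> x - sin_sum_form \<delta> \<theta>' x)\<^sup>2)) \<in> borel_measurable borel"
    by measurable
  have "\<delta>\<^sup>2 * real (2 * m) powr (- \<alpha>) * real (card (sym_diff \<theta> \<theta>'))
      = (\<Sum>j\<in>J. \<delta>\<^sup>2 * (sgn_diff \<theta> \<theta>' j)\<^sup>2 * real (2 * m) powr (- \<alpha>))"
    unfolding sum_sq_sgn_diff[OF assms, symmetric] by (simp only: sum_distrib_left mult_ac)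
  also have "\<dots> \<le> (\<Sum>j\<in>J. \<delta>\<^sup>2 * (sgn_diff \<theta> \<theta>' j)\<^sup>2 * kap j)"
  proof (intro sum_mono mult_left_mono)
    fix j assume "j \<in> J"
    then show "real (2 * m) powr (- \<alpha>) \<le> kap j"
      unfolding kap_def using J_simps(4,6)[of j] \<alpha> by (intro powr_mono2') auto
  qed simp
  also have "\<dots> = (\<Sum>j\<in>J. c j * c j)"
  proof (rule sum.cong[OF refl])
    fix j
    have "c j * c j = \<delta>\<^sup>2 * (sgn_diff \<theta> \<theta>' j)\<^sup>2 * ((rs_sign j)\<^sup>2 * (amp j)\<^sup>2)"
      by (simp only: c_def power2_eq_square mult_ac)
    then show "\<delta>\<^sup>2 * (sgn_diff \<theta> \<theta>' j)\<^sup>2 * kap j = c j * c j"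
      by (simp only: rs_sign_sq amp_sq mult_1_left)
  qed
  also have "\<dots> = (\<integral>v. (sin_sum_form \<delta> \<theta> (traj v) - sin_sum_form \<delta> \<theta>' (traj v))\<^sup>2 \<partial>unit_leb)"
    unfolding eq power2_eq_square
    by (rule cosines.integral_sum_product[OF J_simps(1) J_simps(4), symmetric])
  finally have "ennreal (\<delta>\<^sup>2 * real (2 * m) powr (- \<alpha>) * real (card (sym_diff \<theta> \<theta>')))
      \<le> ennreal (\<integral>v. (sin_sum_form \<delta> \<theta> (traj v) - sin_sum_form \<delta> \<theta>' (traj v))\<^sup>2 \<partial>unit_leb)"
    by (rule ennreal_leI)
  also have "\<dots> = (\<integral>\<^sup>+v. ennreal ((sin_sum_form \<delta> \<theta> (traj v) - sin_sum_form \<delta> \<theta>' (traj v))\<^sup>2) \<partial>unit_leb)"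
    unfolding eq
    by (intro nn_integral_eq_integral[symmetric] continuous_integrable_unit_leb continuous_intros
        continuous_cos_basis) simp
  also have "\<dots> = (\<integral>\<^sup>+x. ennreal ((sin_sum_form \<delta> \<theta> x - sin_sum_form \<delta> \<theta>' x)\<^sup>2) \<partial>PX)"
    by (rule nn_integral_PX[OF m1, symmetric])
  finally show ?thesis .
qed

end

section \<open>Minimax lower bounds\<close>

context hypercube
begin

lemma law_X_hyp: "law_X (hyp \<theta>) = PX"
  unfolding hyp_def by (rule law_X_logistic_model) measurable

text \<open>
  The supremum over \<open>U\<close> is bounded below by the loss at one \<open>u\<close>, which is a measurable function
  of the data, whereas the supremum need not be one.
\<close>
lemma slope_lower_bound:
  assumes U: "U \<subseteq> {0<..<1}" and u: "u \<in> U" and b': "b' \<in> slope_estimators U n"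
    and \<tau>: "\<tau> \<le> test_const * real m * \<delta>\<^sup>2 / 16"
  shows "\<exists>\<theta>\<subseteq>J. ennreal (test_const / 4) \<le> inner_prob (sample n (hyp \<theta>))
    (\<lambda>d. (SUP u\<in>U. slope_loss U (hyp \<theta>) (b' d) u) > ennreal \<tau>)"
proof -
  interpret L: prob_space unit_leb by (rule prob_space_unit_leb)
  have bm [measurable]: "(\<lambda>(d, t). b' d t u) \<in> borel_measurable (sample n obs \<Otimes>\<^sub>M unit_leb)"
    using b' u by (simp add: slope_estimators_def)
  have fm [measurable]: "sin_sum_fun \<delta> \<theta> \<in> borel_measurable unit_leb" for \<theta>
    by (rule continuous_measurable_unit_leb[OF continuous_sin_sum_fun])
  define loss where "loss \<theta> d = (\<integral>\<^sup>+t. ennreal ((b' d t u - sin_sum_fun \<delta> \<theta> t)\<^sup>2) \<partial>unit_leb)" for \<theta> d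
  have loss: "slope_loss U (hyp \<theta>) (b' d) u = loss \<theta> d" for \<theta> d
    unfolding slope_loss_def loss_def
  proof (rule nn_integral_cong_AE)
    show "AE t in unit_leb. ennreal ((b' d t u - slope U (hyp \<theta>) t u)\<^sup>2) = ennreal ((b' d t u - sin_sum_fun \<delta> \<theta> t)\<^sup>2)"
      using slope_logistic_model[OF U u, of \<delta> \<theta>] unfolding hyp_def by eventually_elim simp
  qed
  show ?thesis
  proof (rule hypercube_lower_bound[OF _ _ _ \<tau>])
    show "loss \<theta> d \<le> (SUP u\<in>U. slope_loss U (hyp \<theta>) (b' d) u)" for \<theta> d
      unfolding loss[symmetric] by (rule SUP_upper[OF u])
    show "loss \<theta> \<in> borel_measurable (sample n obs)" for \<theta>
      unfolding loss_def [abs_def] by measurable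
    show "\<delta>\<^sup>2 > 0" using \<delta>_pos by simp
    fix \<theta> \<theta>' d assume \<theta>: "\<theta> \<subseteq> J" "\<theta>' \<subseteq> J" and d: "d \<in> space (sample n obs)"
    have q: "(\<lambda>t. b' d t u) \<in> borel_measurable unit_leb"
      using measurable_compose[OF measurable_Pair1'[OF d] bm] by simp
    show "ennreal (\<delta>\<^sup>2 * real (card (sym_diff \<theta> \<theta>'))) \<le> 2 * loss \<theta> d + 2 * loss \<theta>' d"
      unfolding slope_separation[OF \<theta>, symmetric] loss_def
      by (rule nn_integral_square_triangle[OF q fm fm])
  qed
qed

text \<open>
  The price of one wrong bit in the squared prediction error.
\<close>
definition pred_sep :: real where "pred_sep = \<delta>\<^sup>2 * real (2 * m) powr (- \<alpha>)"

lemma pred_sep_pos: "pred_sep > 0"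
  using \<delta>_pos m by (simp add: pred_sep_def)

definition logit_form :: "nat set \<Rightarrow> real \<Rightarrow> D01 \<Rightarrow> real" where
  "logit_form \<theta> u x = ln (u / (1 - u)) + sin_sum_form \<delta> \<theta> x"

lemma measurable_logit_form [measurable]:
  "(\<lambda>z. logit_form \<theta> (fst z) (snd z)) \<in> borel_measurable (borel \<Otimes>\<^sub>M borel)"
  "logit_form \<theta> u \<in> borel_measurable borel"
  unfolding logit_form_def [abs_def] by measurable

lemma pred_loss_hyp:
  assumes "u \<in> {0<..<1}"
  shows "pred_loss (hyp \<theta>) q u = (\<integral>\<^sup>+x. ennreal ((q u x - logit_form \<theta> u x)\<^sup>2) \<partial>PX)"
  unfolding pred_loss_def law_X_hyp
proof (rule nn_integral_cong_AE)
  have "AE x in PX. \<forall>u\<in>{0<..<1}. cond_quantile (hyp \<theta>) u x = ln (u / (1 - u)) + sin_sum_form \<delta> \<theta> x"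
    unfolding hyp_def by (rule cond_quantile_logistic_model) measurable
  then show "AE x in PX. ennreal ((q u x - cond_quantile (hyp \<theta>) u x)\<^sup>2) = ennreal ((q u x - logit_form \<theta> u x)\<^sup>2)"
    by eventually_elim (use assms in \<open>simp add: logit_form_def\<close>)
qed

lemma pred_loss_triangle:
  assumes \<theta>: "\<theta> \<subseteq> J" "\<theta>' \<subseteq> J" and q: "q \<in> borel_measurable borel"
  shows "ennreal (pred_sep * real (card (sym_diff \<theta> \<theta>')))
    \<le> 2 * (\<integral>\<^sup>+x. ennreal ((q x - logit_form \<theta> u x)\<^sup>2) \<partial>PX)
      + 2 * (\<integral>\<^sup>+x. ennreal ((q x - logit_form \<theta>' u x)\<^sup>2) \<partial>PX)"
proof -
  have "ennreal (pred_sep * real (card (sym_diff \<theta> \<theta>')))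
      \<le> (\<integral>\<^sup>+x. ennreal ((sin_sum_form \<delta> \<theta> x - sin_sum_form \<delta> \<theta>' x)\<^sup>2) \<partial>PX)"
    unfolding pred_sep_def by (rule prediction_separation[OF \<theta>])
  also have "\<dots> = (\<integral>\<^sup>+x. ennreal ((logit_form \<theta> u x - logit_form \<theta>' u x)\<^sup>2) \<partial>PX)"
    by (simp add: logit_form_def)
  also have "\<dots> \<le> 2 * (\<integral>\<^sup>+x. ennreal ((q x - logit_form \<theta> u x)\<^sup>2) \<partial>PX)
      + 2 * (\<integral>\<^sup>+x. ennreal ((q x - logit_form \<theta>' u x)\<^sup>2) \<partial>PX)"
    by (intro nn_integral_square_triangle measurable_P q measurable_logit_form)
  finally show ?thesis .
qed

lemma prediction_lower_bound:
  assumes U: "U \<subseteq> {0<..<1}" and u: "u \<in> U" and q: "q \<in> quantile_estimators U n"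
    and \<tau>: "\<tau> \<le> test_const * real m * pred_sep / 16"
  shows "\<exists>\<theta>\<subseteq>J. ennreal (test_const / 4) \<le> inner_prob (sample n (hyp \<theta>))
    (\<lambda>d. (SUP u\<in>U. pred_loss (hyp \<theta>) (q d) u) > ennreal \<tau>)"
proof -
  have qm: "(\<lambda>(d, x). q d u x) \<in> borel_measurable (sample n obs \<Otimes>\<^sub>M borel)"
    using q u by (simp add: quantile_estimators_def)
  have qm' [measurable]: "(\<lambda>(d, x). q d u x) \<in> borel_measurable (sample n obs \<Otimes>\<^sub>M PX)"
    using qm by (simp cong: measurable_cong_sets sets_pair_measure_cong)
  have u1: "u \<in> {0<..<1}" using U u by blast
  define loss where "loss \<theta> d = (\<integral>\<^sup>+x. ennreal ((q d u x - logit_form \<theta> u x)\<^sup>2) \<partial>PX)" for \<theta> d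
  have loss: "pred_loss (hyp \<theta>) (q d) u = loss \<theta> d" for \<theta> d
    unfolding loss_def by (rule pred_loss_hyp[OF u1])
  have loss_m: "loss \<theta> \<in> borel_measurable (sample n obs)" for \<theta>
    unfolding loss_def [abs_def] by measurable
  show ?thesis
  proof (rule hypercube_lower_bound[OF loss_m _ pred_sep_pos \<tau>])
    show "loss \<theta> d \<le> (SUP u\<in>U. pred_loss (hyp \<theta>) (q d) u)" for \<theta> d
      unfolding loss[symmetric] by (rule SUP_upper[OF u])
    fix \<theta> \<theta>' d assume \<theta>: "\<theta> \<subseteq> J" "\<theta>' \<subseteq> J" and d: "d \<in> space (sample n obs)"
    have qd: "q d u \<in> borel_measurable borel"
      using measurable_compose[OF measurable_Pair1'[OF d] qm] by simp
    show "ennreal (pred_sep * real (card (sym_diff \<theta> \<theta>'))) \<le> 2 * loss \<theta> d + 2 * loss \<theta>' d"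
      unfolding loss_def by (rule pred_loss_triangle[OF \<theta> qd])
  qed
qed

text \<open>
  The intercept is the same for all hypotheses, so the separation at each \<open>u\<close> is the same and integrating it over
  the interval multiplies it by the length.
\<close>
lemma integrated_prediction_lower_bound:
  assumes U: "U = {uL..uU}" "0 < uL" "uL < uU" "uU < 1" and q: "q \<in> measurable_quantile_estimators U n"
    and \<tau>: "\<tau> \<le> test_const * real m * ((uU - uL) * pred_sep) / 16"
  shows "\<exists>\<theta>\<subseteq>J. ennreal (test_const / 4) \<le> inner_prob (sample n (hyp \<theta>))
    (\<lambda>d. (\<integral>\<^sup>+u\<in>U. pred_loss (hyp \<theta>) (q d) u \<partial>lborel) > ennreal \<tau>)"
proof -
  define R where "R = restrict_space lborel U"
  have sets_R: "sets R = sets (restrict_space borel U)" by (simp add: R_def sets_restrict_space)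
  have space_R: "space R = U" by (simp add: R_def space_restrict_space)
  have em_R: "emeasure R U = ennreal (uU - uL)"
    unfolding R_def using U by (simp add: emeasure_restrict_space)
  interpret R: finite_measure R
    by (rule finite_measureI) (simp add: space_R em_R)
  have qm: "(\<lambda>(d, u, x). q d u x) \<in> borel_measurable (sample n obs \<Otimes>\<^sub>M (R \<Otimes>\<^sub>M borel))"
  proof -
    have "sets (sample n obs \<Otimes>\<^sub>M (R \<Otimes>\<^sub>M borel)) = sets (sample n obs \<Otimes>\<^sub>M (restrict_space borel U \<Otimes>\<^sub>M borel))"
      by (intro sets_pair_measure_cong refl sets_R)
    then show ?thesis
      using q measurable_cong_sets[OF _ refl] unfolding measurable_quantile_estimators_def by blast
  qed
  have q3 [measurable]: "(\<lambda>z. q (fst (fst z)) (snd (fst z)) (snd z))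
      \<in> borel_measurable ((sample n obs \<Otimes>\<^sub>M R) \<Otimes>\<^sub>M PX)"
  proof -
    have "(\<lambda>z. (fst (fst z), snd (fst z), snd z)) \<in> (sample n obs \<Otimes>\<^sub>M R) \<Otimes>\<^sub>M PX \<rightarrow>\<^sub>M sample n obs \<Otimes>\<^sub>M (R \<Otimes>\<^sub>M borel)"
      by measurable
    from measurable_compose[OF this qm] show ?thesis by simp
  qed
  have lm [measurable]: "(\<lambda>z. logit_form \<theta> (snd (fst z)) (snd z))
      \<in> borel_measurable ((sample n obs \<Otimes>\<^sub>M R) \<Otimes>\<^sub>M PX)" for \<theta>
  proof -
    have id: "(\<lambda>u. u) \<in> R \<rightarrow>\<^sub>M borel"
      unfolding R_def by (rule measurable_restrict_space1) simp
    have "(\<lambda>z. snd (fst z)) \<in> (sample n obs \<Otimes>\<^sub>M R) \<Otimes>\<^sub>M PX \<rightarrow>\<^sub>M R" by measurable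
    from measurable_compose[OF this id]
    have "(\<lambda>z. snd (fst z)) \<in> (sample n obs \<Otimes>\<^sub>M R) \<Otimes>\<^sub>M PX \<rightarrow>\<^sub>M borel" .
    moreover have "snd \<in> (sample n obs \<Otimes>\<^sub>M R) \<Otimes>\<^sub>M PX \<rightarrow>\<^sub>M borel" by measurable
    ultimately have "(\<lambda>z. (snd (fst z), snd z)) \<in> (sample n obs \<Otimes>\<^sub>M R) \<Otimes>\<^sub>M PX \<rightarrow>\<^sub>M borel \<Otimes>\<^sub>M borel"
      by (rule measurable_Pair)
    from measurable_compose[OF this measurable_logit_form(1)] show ?thesis by simp
  qed
  define inner where "inner \<theta> d u = (\<integral>\<^sup>+x. ennreal ((q d u x - logit_form \<theta> u x)\<^sup>2) \<partial>PX)" for \<theta> d u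
  have inner_m: "(\<lambda>z. inner \<theta> (fst z) (snd z)) \<in> borel_measurable (sample n obs \<Otimes>\<^sub>M R)" for \<theta>
    unfolding inner_def
  proof (rule P.borel_measurable_nn_integral)
    have "(\<lambda>z. ennreal ((q (fst (fst z)) (snd (fst z)) (snd z) - logit_form \<theta> (snd (fst z)) (snd z))\<^sup>2))
        \<in> borel_measurable ((sample n obs \<Otimes>\<^sub>M R) \<Otimes>\<^sub>M PX)" by measurable
    then show "(\<lambda>(z, x). ennreal ((q (fst z) (snd z) x - logit_form \<theta> (snd z) x)\<^sup>2))
        \<in> borel_measurable ((sample n obs \<Otimes>\<^sub>M R) \<Otimes>\<^sub>M PX)"
      by (simp add: case_prod_unfold)
  qed
  define loss where "loss \<theta> d = (\<integral>\<^sup>+u. inner \<theta> d u \<partial>R)" for \<theta> d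
  have loss_m: "loss \<theta> \<in> borel_measurable (sample n obs)" for \<theta>
    unfolding loss_def [abs_def]
    by (rule R.borel_measurable_nn_integral) (use inner_m in \<open>simp add: case_prod_unfold\<close>)
  have loss: "(\<integral>\<^sup>+u\<in>U. pred_loss (hyp \<theta>) (q d) u \<partial>lborel) = loss \<theta> d" for \<theta> d
  proof -
    have "(\<integral>\<^sup>+u\<in>U. pred_loss (hyp \<theta>) (q d) u \<partial>lborel) = (\<integral>\<^sup>+u. pred_loss (hyp \<theta>) (q d) u \<partial>R)"
      unfolding R_def by (rule nn_integral_restrict_space[symmetric]) (simp add: U)
    also have "\<dots> = loss \<theta> d"
      unfolding loss_def inner_def
      by (intro nn_integral_cong pred_loss_hyp) (use U in \<open>auto simp: space_R\<close>)
    finally show ?thesis .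
  qed
  show ?thesis
  proof (rule hypercube_lower_bound[OF loss_m _ _ \<tau>])
    show "loss \<theta> d \<le> (\<integral>\<^sup>+u\<in>U. pred_loss (hyp \<theta>) (q d) u \<partial>lborel)" for \<theta> d
      by (simp only: loss)
    show "(uU - uL) * pred_sep > 0" using pred_sep_pos U by simp
    fix \<theta> \<theta>' d assume \<theta>: "\<theta> \<subseteq> J" "\<theta>' \<subseteq> J" and d: "d \<in> space (sample n obs)"
    define c where "c = pred_sep * real (card (sym_diff \<theta> \<theta>'))"
    have im: "inner \<theta> d \<in> borel_measurable R" for \<theta>
      using measurable_compose[OF measurable_Pair1'[OF d] inner_m[of \<theta>]] by simp
    have "ennreal ((uU - uL) * pred_sep * real (card (sym_diff \<theta> \<theta>'))) = ennreal c * emeasure R U"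
      unfolding em_R c_def using U pred_sep_pos by (subst ennreal_mult[symmetric]) (auto simp: mult_ac)
    also have "\<dots> = (\<integral>\<^sup>+u. ennreal c \<partial>R)" by (simp add: space_R)
    also have "\<dots> \<le> (\<integral>\<^sup>+u. 2 * inner \<theta> d u + 2 * inner \<theta>' d u \<partial>R)"
    proof (rule nn_integral_mono)
      fix u assume u: "u \<in> space R"
      have "q d u \<in> borel_measurable borel"
        using measurable_compose[OF measurable_Pair1'[OF u] measurable_compose[OF measurable_Pair1'[OF d] qm]]
        by simp
      then show "ennreal c \<le> 2 * inner \<theta> d u + 2 * inner \<theta>' d u"
        unfolding c_def inner_def by (rule pred_loss_triangle[OF \<theta>])
    qed
    also have "\<dots> = 2 * loss \<theta> d + 2 * loss \<theta>' d"
      unfolding loss_def using im by (simp add: nn_integral_add nn_integral_cmult)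
    finally show "ennreal ((uU - uL) * pred_sep * real (card (sym_diff \<theta> \<theta>'))) \<le> 2 * loss \<theta> d + 2 * loss \<theta>' d" .
  qed
qed

lemma hyp_in_class:
  assumes "0 < \<epsilon>" "\<epsilon> < 1/2" "U \<subseteq> {\<epsilon>..1-\<epsilon>}" "0 < \<gamma>" "\<gamma> \<le> 2" "\<gamma> < \<alpha> - 1"
    and "class_const \<epsilon> \<gamma> \<le> C" and "\<theta> \<subseteq> J"
  shows "hyp \<theta> \<in> model_class U C \<alpha> \<beta> \<gamma>"
  unfolding hyp_def
proof (rule logistic_process_in_class)
  show "finite \<theta>" using assms(8) J_simps(1) finite_subset by blast
  show "1 \<le> j" "\<delta> \<le> real j powr (- \<beta>)" if "j \<in> \<theta>" for j
    using that assms(8) J_simps(4)[of j] \<delta>_le[of j] by auto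
  show "0 \<le> \<delta>" using \<delta>_pos by simp
qed (use assms in auto)

end

lemma liminf_minimax_pos:
  fixes Q :: "nat \<Rightarrow> 'e \<Rightarrow> 'f \<Rightarrow> ennreal"
  assumes "c > 0" "\<And>n e. n \<ge> 2 \<Longrightarrow> e \<in> E n \<Longrightarrow> \<exists>F\<in>C. c \<le> Q n e F"
  shows "liminf (\<lambda>n. INF e\<in>E n. SUP F\<in>C. Q n e F) > 0"
proof -
  have "eventually (\<lambda>n. c \<le> (INF e\<in>E n. SUP F\<in>C. Q n e F)) sequentially"
    using eventually_ge_at_top[of 2]
  proof eventually_elim
    case (elim n)
    show ?case
    proof (rule INF_greatest)
      fix e assume "e \<in> E n"
      then obtain F where "F \<in> C" "c \<le> Q n e F" using assms(2)[OF elim] by blast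
      then show "c \<le> (SUP F\<in>C. Q n e F)" by (rule SUP_upper2)
    qed
  qed
  then have "c \<le> liminf (\<lambda>n. INF e\<in>E n. SUP F\<in>C. Q n e F)" by (rule Liminf_bounded)
  with \<open>c > 0\<close> show ?thesis by (rule less_le_trans)
qed

text \<open>
  The block length balances \<open>m powr s\<close> against \<open>n\<close>. Rounding up at most doubles \<open>n powr (1/s)\<close>, which together
  with the factor \<open>2\<close> in \<open>2m\<close> accounts for the constant \<open>2 powr (1 - 2p)\<close>.
\<close>
lemma block_length:
  fixes s p :: real and n :: nat
  assumes s: "s > 0" and n: "n \<ge> 1" and m: "m = nat \<lceil>real n powr (1 / s)\<rceil>"
  shows "m \<ge> 1" "real m powr (- s) \<le> 1 / real n"
    and "p > 1 \<Longrightarrow> 2 powr (1 - 2 * p) * real n powr (- (p - 1) / s) \<le> real m * real (2 * m) powr (- p)"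
proof -
  define r where "r = real n powr (1 / s)"
  have r: "r \<ge> 1" unfolding r_def using s n by (intro ge_one_powr_ge_zero) auto
  have mr: "r \<le> real m" "real m \<le> 2 * r"
    unfolding m r_def[symmetric] using r by linarith+
  show "m \<ge> 1" using mr(1) r by linarith
  have "real m powr (- s) \<le> r powr (- s)" using mr(1) r s by (intro powr_mono2') auto
  also have "\<dots> = 1 / real n" using s n by (simp add: r_def powr_powr powr_minus_divide)
  finally show "real m powr (- s) \<le> 1 / real n" .
  assume p: "p > 1"
  have "real n powr (- (p - 1) / s) = r powr (1 - p)"
    by (simp add: r_def powr_powr)
  then have "2 powr (1 - 2 * p) * real n powr (- (p - 1) / s) = 2 powr (- p) * (2 * r) powr (1 - p)"
  proof -
    have "2 powr (1 - 2 * p) = 2 powr (- p) * (2::real) powr (1 - p)" by (simp flip: powr_add)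
    then show ?thesis using \<open>real n powr _ = _\<close> r by (simp add: powr_mult)
  qed
  also have "\<dots> \<le> 2 powr (- p) * real m powr (1 - p)"
    using mr r p by (intro mult_left_mono powr_mono2') auto
  also have "real m powr (1 - p) = real m * real m powr (- p)"
    using \<open>m \<ge> 1\<close> powr_add[of "real m" 1 "- p"] by simp
  also have "2 powr (- p) * (real m * real m powr (- p)) = real m * real (2 * m) powr (- p)"
    by (simp add: powr_mult)
  finally show "2 powr (1 - 2 * p) * real n powr (- (p - 1) / s) \<le> real m * real (2 * m) powr (- p)" .
qed

theorem proposition3p1:
  fixes U :: "real set" and \<epsilon> \<alpha> \<beta> \<gamma> :: real
  assumes "0 < \<epsilon>" and "\<epsilon> < 1/2"
    and "U \<noteq> {}" and "U \<subseteq> {\<epsilon>..1-\<epsilon>}"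
    and "\<alpha> > 1" and "\<beta> > \<alpha>/2 + 1"
    and "0 < \<gamma>"
    and "\<alpha> \<le> 3 \<Longrightarrow> \<gamma> < \<alpha> - 1"
    and "\<alpha> > 3 \<Longrightarrow> \<gamma> \<le> 2"
  shows "\<exists>C0>1. \<forall>C1\<ge>C0.
    (\<exists>M>0. liminf (\<lambda>n.
        INF b'\<in>slope_estimators U n. SUP F\<in>model_class U C1 \<alpha> \<beta> \<gamma>.
          inner_prob (sample n F)
            (\<lambda>d. (SUP u\<in>U. slope_loss U F (b' d) u)
                 > ennreal (M * real n powr (-(2*\<beta> - 1)/(\<alpha> + 2*\<beta>))))) > 0)
  \<and> (\<exists>M>0. liminf (\<lambda>n.
        INF q\<in>quantile_estimators U n. SUP F\<in>model_class U C1 \<alpha> \<beta> \<gamma>.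
          inner_prob (sample n F)
            (\<lambda>d. (SUP u\<in>U. pred_loss F (q d) u)
                 > ennreal (M * real n powr (-(\<alpha> + 2*\<beta> - 1)/(\<alpha> + 2*\<beta>))))) > 0)
  \<and> (\<forall>uL uU. 0 < uL \<and> uL < uU \<and> uU < 1 \<and> U = {uL..uU} \<longrightarrow>
      (\<exists>M>0. liminf (\<lambda>n.
        INF q\<in>measurable_quantile_estimators U n. SUP F\<in>model_class U C1 \<alpha> \<beta> \<gamma>.
          inner_prob (sample n F)
            (\<lambda>d. (\<integral>\<^sup>+u\<in>U. pred_loss F (q d) u \<partial>lborel)
                 > ennreal (M * real n powr (-(\<alpha> + 2*\<beta> - 1)/(\<alpha> + 2*\<beta>))))) > 0))"
proof -
  interpret polynomial_decay \<alpha> by standard fact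
  define s where "s = \<alpha> + 2 * \<beta>"
  have \<beta>: "\<beta> > 3/2" using assms(5,6) by simp
  have s: "s > 0" using assms(5) \<beta> by (simp add: s_def)
  have \<gamma>: "\<gamma> \<le> 2" "\<gamma> < \<alpha> - 1" using assms(8,9) by (cases "\<alpha> \<le> 3"; simp)+
  obtain u0 where u0: "u0 \<in> U" using assms(3) by blast
  have U: "U \<subseteq> {0<..<1}" using assms(1,2,4) by auto
  define m where "m n = nat \<lceil>real n powr (1 / s)\<rceil>" for n :: nat
  have cube: "hypercube \<alpha> \<beta> (m n) n" if "n \<ge> 2" for n
    using block_length(1,2)[OF s _ m_def, of n] that \<beta> unfolding s_def
    by unfold_locales auto
  have test4: "ennreal (test_const / 4) > 0" using test_const_pos by simp
  let ?p = "\<alpha> + 2 * \<beta>"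
  \<comment> \<open>The rates are \<open>m (2m) powr -p\<close> with \<open>p = 2 \<beta>\<close> for the slope and \<open>p = \<alpha> + 2 \<beta>\<close> for the
    prediction; \<open>test_const / 16\<close> is the fraction of it that Assouad's argument guarantees.\<close>
  define M1 where "M1 = test_const / 16 * 2 powr (1 - 2 * (2 * \<beta>))"
  define M2 where "M2 = test_const / 16 * 2 powr (1 - 2 * ?p)"
  have M: "M1 > 0" "M2 > 0" using test_const_pos by (simp_all add: M1_def M2_def)
  have rate1: "M1 * real n powr (-(2*\<beta> - 1)/(\<alpha> + 2*\<beta>)) \<le> test_const * real (m n) * (hypercube.\<delta> \<beta> (m n))\<^sup>2 / 16"
    if n: "n \<ge> 2" for n
  proof -
    interpret H: hypercube \<alpha> \<beta> "m n" n by (rule cube[OF n])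
    have "2 powr (1 - 2 * (2 * \<beta>)) * real n powr (- (2 * \<beta> - 1) / s)
        \<le> real (m n) * real (2 * m n) powr (- (2 * \<beta>))"
      using block_length(3)[OF s _ m_def, of n "2 * \<beta>"] n \<beta> by simp
    from mult_left_mono[OF this, of "test_const / 16"] show ?thesis
      using test_const_pos by (simp add: M1_def H.sq_\<delta> s_def mult_ac)
  qed
  have rate2: "M2 * real n powr (-(\<alpha> + 2*\<beta> - 1)/(\<alpha> + 2*\<beta>)) \<le> test_const * real (m n) * hypercube.pred_sep \<alpha> \<beta> (m n) / 16"
    if n: "n \<ge> 2" for n
  proof -
    interpret H: hypercube \<alpha> \<beta> "m n" n by (rule cube[OF n])
    have "2 powr (1 - 2 * ?p) * real n powr (- (?p - 1) / s) \<le> real (m n) * real (2 * m n) powr (- ?p)"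
      using block_length(3)[OF s _ m_def, of n ?p] n \<beta> assms(5) by simp
    moreover have "real (2 * m n) powr (- ?p) = H.pred_sep"
      unfolding H.pred_sep_def H.sq_\<delta> powr_add[symmetric] by (simp add: algebra_simps)
    ultimately have "2 powr (1 - 2 * ?p) * real n powr (- (?p - 1) / s) \<le> real (m n) * H.pred_sep" by simp
    from mult_left_mono[OF this, of "test_const / 16"] show ?thesis
      using test_const_pos by (simp add: M2_def s_def mult_ac)
  qed
  have in_class: "hypercube.hyp \<alpha> \<beta> (m n) \<theta> \<in> model_class U C1 \<alpha> \<beta> \<gamma>"
    if "n \<ge> 2" "class_const \<epsilon> \<gamma> \<le> C1" "\<theta> \<subseteq> hypercube.J (m n)" for n C1 \<theta>
    by (rule hypercube.hyp_in_class[OF cube[OF that(1)] assms(1,2,4,7) \<gamma> that(2,3)])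
  show ?thesis
  proof (rule exI[of _ "class_const \<epsilon> \<gamma>"], intro conjI allI impI)
    show "1 < class_const \<epsilon> \<gamma>" using class_const_ge(1)[OF assms(1) \<gamma>(2)] by simp
    fix C1 assume C1: "class_const \<epsilon> \<gamma> \<le> C1"
    show "\<exists>M>0. liminf (\<lambda>n.
        INF b'\<in>slope_estimators U n. SUP F\<in>model_class U C1 \<alpha> \<beta> \<gamma>.
          inner_prob (sample n F)
            (\<lambda>d. (SUP u\<in>U. slope_loss U F (b' d) u)
                 > ennreal (M * real n powr (-(2*\<beta> - 1)/(\<alpha> + 2*\<beta>))))) > 0"
    proof (intro exI[of _ M1] conjI M liminf_minimax_pos[OF test4])
      fix n b' assume n: "n \<ge> (2::nat)" and b': "b' \<in> slope_estimators U n"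
      from hypercube.slope_lower_bound[OF cube[OF n] U u0 b' rate1[OF n]] in_class[OF n C1]
      show "\<exists>F\<in>model_class U C1 \<alpha> \<beta> \<gamma>. ennreal (test_const / 4) \<le> inner_prob (sample n F)
            (\<lambda>d. (SUP u\<in>U. slope_loss U F (b' d) u)
                 > ennreal (M1 * real n powr (-(2*\<beta> - 1)/(\<alpha> + 2*\<beta>))))" by blast
    qed
    show "\<exists>M>0. liminf (\<lambda>n.
        INF q\<in>quantile_estimators U n. SUP F\<in>model_class U C1 \<alpha> \<beta> \<gamma>.
          inner_prob (sample n F)
            (\<lambda>d. (SUP u\<in>U. pred_loss F (q d) u)
                 > ennreal (M * real n powr (-(\<alpha> + 2*\<beta> - 1)/(\<alpha> + 2*\<beta>))))) > 0"
    proof (intro exI[of _ M2] conjI M liminf_minimax_pos[OF test4])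
      fix n q assume n: "n \<ge> (2::nat)" and q: "q \<in> quantile_estimators U n"
      from hypercube.prediction_lower_bound[OF cube[OF n] U u0 q rate2[OF n]] in_class[OF n C1]
      show "\<exists>F\<in>model_class U C1 \<alpha> \<beta> \<gamma>. ennreal (test_const / 4) \<le> inner_prob (sample n F)
            (\<lambda>d. (SUP u\<in>U. pred_loss F (q d) u)
                 > ennreal (M2 * real n powr (-(\<alpha> + 2*\<beta> - 1)/(\<alpha> + 2*\<beta>))))" by blast
    qed
    fix uL uU assume I: "0 < uL \<and> uL < uU \<and> uU < 1 \<and> U = {uL..uU}"
    then have I': "U = {uL..uU}" "0 < uL" "uL < uU" "uU < 1" by auto
    show "\<exists>M>0. liminf (\<lambda>n.
        INF q\<in>measurable_quantile_estimators U n. SUP F\<in>model_class U C1 \<alpha> \<beta> \<gamma>.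
          inner_prob (sample n F)
            (\<lambda>d. (\<integral>\<^sup>+u\<in>U. pred_loss F (q d) u \<partial>lborel)
                 > ennreal (M * real n powr (-(\<alpha> + 2*\<beta> - 1)/(\<alpha> + 2*\<beta>))))) > 0"
    proof (intro exI[of _ "(uU - uL) * M2"] conjI liminf_minimax_pos[OF test4])
      show "(uU - uL) * M2 > 0" using I' M by simp
      fix n q assume n: "n \<ge> (2::nat)" and q: "q \<in> measurable_quantile_estimators U n"
      have "(uU - uL) * M2 * real n powr (-(\<alpha> + 2*\<beta> - 1)/(\<alpha> + 2*\<beta>))
          \<le> test_const * real (m n) * ((uU - uL) * hypercube.pred_sep \<alpha> \<beta> (m n)) / 16"
        using mult_left_mono[OF rate2[OF n], of "uU - uL"] I' by (simp add: mult_ac)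
      from hypercube.integrated_prediction_lower_bound[OF cube[OF n] I' q this] in_class[OF n C1]
      show "\<exists>F\<in>model_class U C1 \<alpha> \<beta> \<gamma>. ennreal (test_const / 4) \<le> inner_prob (sample n F)
            (\<lambda>d. (\<integral>\<^sup>+u\<in>U. pred_loss F (q d) u \<partial>lborel)
                 > ennreal ((uU - uL) * M2 * real n powr (-(\<alpha> + 2*\<beta> - 1)/(\<alpha> + 2*\<beta>))))" by blast
    qed
  qed
qed

end
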